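(* Let $\phi$ be a quantum channel on $\mathcal M(d;\mathbb C)$. The following are equivalent: (1) $\phi$ is asymptotically entanglement-saving; (2) in the structure decomposition of the phase subspace $\chi_\phi=\big(\bigoplus_i\mathcal M_{d_i^{(1)}}\otimes\rho_{i,2}\big)\oplus 0$ (see context), at least one $d_i^{(1)}$ is strictly greater than $1$; (3) $\phi$ admits two phase points $Z_1,Z_2$ that do not commute, $[Z_1,Z_2]\neq0$.
   Context: A quantum channel is a completely positive, trace-preserving linear map on $\mathcal M(d;\mathbb C)$; spectral notions refer to it as a linear operator on $\mathcal M(d;\mathbb C)$. A phase point of $\phi$ is a nonzero matrix $Z$ with $\phi(Z)=e^{i\theta}Z$ for some $\theta\in\mathbb R$; the phase subspace $\chi_\phi$ is the linear span of all phase points. It is known (structure theorem for the phase subspace) that there is a subspace $\mathcal K\subseteq\mathbb C^d$ and an orthogonal decomposition $\mathcal K=\bigoplus_i\mathbb C^{d_i^{(1)}}\otimes\mathbb C^{d_i^{(2)}}$ together with density matrices $\rho_{i,2}$ on $\mathbb C^{d_i^{(2)}}$ such that, with respect to $\mathbb C^d=\mathcal K\oplus\mathcal K^\perp$, $\chi_\phi=\big(\bigoplus_i\mathcal M_{d_i^{(1)}}\otimes\rho_{i,2}\big)\oplus 0$, where $\mathcal M_n$ denotes all $n\times n$ complex matrices. A channel is entanglement-breaking if $(\psi\otimes I)(\rho)$ is separable for every bipartite state $\rho$. $\phi$ is asymptotically entanglement-saving (AES) if no limit point of the sequence $(\phi^n)_{n\in\mathbb N}$ of its powers is entanglement-breaking.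 *)

theory Defs
  imports "Jordan_Normal_Form.Matrix" Complex_Main
begin

text \<open>Matrices in M(n;C) are represented as "complex mat" values in carrier_mat n n.
  A linear map on M(d;C) is represented by a function on complex mat; only its
  values on carrier_mat d d matter.  Bipartite systems C^d (x) C^k are indexed
  by i*k + a (i < d, a < k).\<close>

definition mtrace :: "complex mat \<Rightarrow> complex" where
  "mtrace A = (\<Sum>i<dim_row A. A $$ (i,i))"

definition madj :: "complex mat \<Rightarrow> complex mat" where
  "madj A = mat (dim_col A) (dim_row A) (\<lambda>(i,j). cnj (A $$ (j,i)))"

definition psd :: "nat \<Rightarrow> complex mat \<Rightarrow> bool" where
  "psd n A \<longleftrightarrow> A \<in> carrier_mat n n \<and>
     (\<forall>v :: nat \<Rightarrow> complex.
        Im (\<Sum>i<n. \<Sum>j<n. cnj (v i) * A $$ (i,j) * v j) = 0 \<and>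
        Re (\<Sum>i<n. \<Sum>j<n. cnj (v i) * A $$ (i,j) * v j) \<ge> 0)"

definition density :: "nat \<Rightarrow> complex mat \<Rightarrow> bool" where
  "density n \<rho> \<longleftrightarrow> psd n \<rho> \<and> mtrace \<rho> = 1"

definition kron :: "complex mat \<Rightarrow> complex mat \<Rightarrow> complex mat" where
  "kron A B = mat (dim_row A * dim_row B) (dim_col A * dim_col B)
     (\<lambda>(r,c). A $$ (r div dim_row B, c div dim_col B) * B $$ (r mod dim_row B, c mod dim_col B))"

text \<open>(psi (x) id_k) applied to an element X of M(d*k;C) = M(d) (x) M(k).\<close>
definition ampl :: "nat \<Rightarrow> nat \<Rightarrow> (complex mat \<Rightarrow> complex mat) \<Rightarrow> complex mat \<Rightarrow> complex mat" where
  "ampl d k \<psi> X = mat (d*k) (d*k) (\<lambda>(r,c).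
      \<psi> (mat d d (\<lambda>(i,j). X $$ (i*k + r mod k, j*k + c mod k))) $$ (r div k, c div k))"

definition lin_map :: "nat \<Rightarrow> (complex mat \<Rightarrow> complex mat) \<Rightarrow> bool" where
  "lin_map d \<phi> \<longleftrightarrow>
     (\<forall>A \<in> carrier_mat d d. \<phi> A \<in> carrier_mat d d) \<and>
     (\<forall>A \<in> carrier_mat d d. \<forall>B \<in> carrier_mat d d. \<phi> (A + B) = \<phi> A + \<phi> B) \<and>
     (\<forall>A \<in> carrier_mat d d. \<forall>c. \<phi> (c \<cdot>\<^sub>m A) = c \<cdot>\<^sub>m \<phi> A)"

definition completely_positive :: "nat \<Rightarrow> (complex mat \<Rightarrow> complex mat) \<Rightarrow> bool" where
  "completely_positive d \<phi> \<longleftrightarrow> (\<forall>k X. psd (d*k) X \<longrightarrow> psd (d*k) (ampl d k \<phi> X))"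

definition trace_preserving :: "nat \<Rightarrow> (complex mat \<Rightarrow> complex mat) \<Rightarrow> bool" where
  "trace_preserving d \<phi> \<longleftrightarrow> (\<forall>A \<in> carrier_mat d d. mtrace (\<phi> A) = mtrace A)"

definition quantum_channel :: "nat \<Rightarrow> (complex mat \<Rightarrow> complex mat) \<Rightarrow> bool" where
  "quantum_channel d \<phi> \<longleftrightarrow> lin_map d \<phi> \<and> completely_positive d \<phi> \<and> trace_preserving d \<phi>"

definition separable :: "nat \<Rightarrow> nat \<Rightarrow> complex mat \<Rightarrow> bool" where
  "separable d k \<rho> \<longleftrightarrow> (\<exists>(n::nat) (p::nat \<Rightarrow> real) \<sigma> \<tau>.
      (\<forall>i<n. p i \<ge> 0 \<and> density d (\<sigma> i) \<and> density k (\<tau> i)) \<and> (\<Sum>i<n. p i) = 1 \<and>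
      \<rho> = mat (d*k) (d*k) (\<lambda>rc. \<Sum>i<n. complex_of_real (p i) * kron (\<sigma> i) (\<tau> i) $$ rc))"

definition entanglement_breaking :: "nat \<Rightarrow> (complex mat \<Rightarrow> complex mat) \<Rightarrow> bool" where
  "entanglement_breaking d \<psi> \<longleftrightarrow>
     (\<forall>k \<rho>. density (d*k) \<rho> \<longrightarrow> separable d k (ampl d k \<psi> \<rho>))"

text \<open>psi is a limit point of the sequence of powers phi^n (convergence of linear maps on the
  finite-dimensional space M(d;C), i.e. entrywise on every input).\<close>
definition power_limit_point :: "nat \<Rightarrow> (complex mat \<Rightarrow> complex mat) \<Rightarrow> (complex mat \<Rightarrow> complex mat) \<Rightarrow> bool" where
  "power_limit_point d \<phi> \<psi> \<longleftrightarrow> (\<exists>s :: nat \<Rightarrow> nat. strict_mono s \<and>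
     (\<forall>A \<in> carrier_mat d d. \<forall>i<d. \<forall>j<d.
        (\<lambda>n. (\<phi> ^^ s n) A $$ (i,j)) \<longlonglongrightarrow> \<psi> A $$ (i,j)))"

definition asympt_ent_saving :: "nat \<Rightarrow> (complex mat \<Rightarrow> complex mat) \<Rightarrow> bool" where
  "asympt_ent_saving d \<phi> \<longleftrightarrow>
     (\<forall>\<psi>. power_limit_point d \<phi> \<psi> \<longrightarrow> \<not> entanglement_breaking d \<psi>)"

definition phase_point :: "nat \<Rightarrow> (complex mat \<Rightarrow> complex mat) \<Rightarrow> complex mat \<Rightarrow> bool" where
  "phase_point d \<phi> Z \<longleftrightarrow> Z \<in> carrier_mat d d \<and> Z \<noteq> 0\<^sub>m d d \<and>
     (\<exists>\<theta>::real. \<phi> Z = exp (\<i> * complex_of_real \<theta>) \<cdot>\<^sub>m Z)"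

definition phase_subspace :: "nat \<Rightarrow> (complex mat \<Rightarrow> complex mat) \<Rightarrow> complex mat set" where
  "phase_subspace d \<phi> = {A. \<exists>(n::nat) (c::nat \<Rightarrow> complex) Z.
      (\<forall>i<n. phase_point d \<phi> (Z i)) \<and>
      A = mat d d (\<lambda>rc. \<Sum>i<n. c i * Z i $$ rc)}"

text \<open>Block structure: a list of blocks (d1, d2, rho2).  Block i occupies the
  index range [off i, off i + d1*d2).  Given A i (d1 x d1), blockdiag forms the
  d x d matrix (direct sum of A i (x) rho2_i) (+) 0.\<close>
definition block_off :: "(nat \<times> nat \<times> complex mat) list \<Rightarrow> nat \<Rightarrow> nat" where
  "block_off bl i = sum_list (map (\<lambda>(a,b,_). a*b) (take i bl))"

definition block_embed :: "nat \<Rightarrow> (nat \<times> nat \<times> complex mat) list \<Rightarrow> (nat \<Rightarrow> complex mat) \<Rightarrow> complex mat" where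
  "block_embed d bl A = mat d d (\<lambda>(r,c).
     (\<Sum>i<length bl. (case bl ! i of (d1, d2, \<rho>) \<Rightarrow>
        if block_off bl i \<le> r \<and> r < block_off bl i + d1*d2 \<and>
           block_off bl i \<le> c \<and> c < block_off bl i + d1*d2
        then kron (A i) \<rho> $$ (r - block_off bl i, c - block_off bl i) else 0)))"

text \<open>Structure decomposition of the phase subspace: a unitary U (identifying
  C^d with (direct sum of C^{d1_i} (x) C^{d2_i}) (+) K^perp in an orthonormal basis),
  block sizes with sum of d1_i*d2_i at most d, density matrices rho_{i,2}, and
  chi_phi = U ((direct sum M_{d1_i} (x) rho_{i,2}) (+) 0) U*.\<close>
definition phase_structure :: "nat \<Rightarrow> (complex mat \<Rightarrow> complex mat) \<Rightarrow> complex mat \<Rightarrow> (nat \<times> nat \<times> complex mat) list \<Rightarrow> bool" where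
  "phase_structure d \<phi> U bl \<longleftrightarrow>
     U \<in> carrier_mat d d \<and> U * madj U = 1\<^sub>m d \<and>
     sum_list (map (\<lambda>(a,b,_). a*b) bl) \<le> d \<and>
     (\<forall>(d1, d2, \<rho>) \<in> set bl. d1 \<ge> 1 \<and> density d2 \<rho>) \<and>
     phase_subspace d \<phi> =
       {U * block_embed d bl A * madj U | A.
          \<forall>i<length bl. A i \<in> carrier_mat (fst (bl ! i)) (fst (bl ! i))}"

end

theory Submission
  imports Defs "Jordan_Normal_Form.Spectral_Radius"
begin

text \<open>Some sequence of powers of the channel \<phi> converges to an idempotent channel P whose range is
  the phase subspace: on the range of P the powers of \<phi> are bounded in both directions, so there are
  neither Jordan blocks nor eigenvalues off the unit circle. Write P in Kraus form and compress the
  Kraus operators to the support e of P. Since P(e) is an invariant state that is faithful on the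
  support, the fixed points of the adjoint of P are exactly the commutant of the compressed Kraus
  operators and their adjoints. Minimal projections of this commutant and Schur's lemma give
  orthonormal vectors w(j,s) in which the range of P is a direct sum of blocks M(d1) (x) rho.

  If some d1 exceeds 1, then the operators E_01 (x) rho and E_10 (x) rho do not commute, and every
  limit point \<psi> of the powers satisfies P = \<psi> Q for a channel Q. If \<psi> were entanglement-breaking, then
  so would be P, but P (x) id fixes the state 1/2 sum E_ab (x) rho (x) E_ab, whose partial transpose
  is not positive. If all d1 are 1, then the phase subspace is spanned by states with orthogonal
  supports; hence it is commutative and P measures and prepares, so that P is an
  entanglement-breaking limit point.\<close>

section \<open>Finitely supported complex matrices\<close>

text \<open>Condition (2) is existential. One implication therefore starts from an arbitrary
  \<open>phase_structure\<close>; the other, by contraposition, has to construct one before it can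
  conclude that all its \<open>d1\<close> are 1. The states rho come from duality. Let
  \<open>E\<close> be the adjoint of P compressed to the support; it is a conditional expectation
  onto the commutant. The entry of P B at w(j,s), w(k,t) is the trace of B against the image under
  \<open>E\<close> of w(k,t) w(j,s)*. Partial isometries u(j) of the commutant carry one basis to
  all w(j,s) of a class, so Schur's lemma makes that image a multiple of u(k) u(j)*; the multiple
  depends on s, t and the class only and is the (s,t) entry of rho. Unitality of \<open>E\<close>
  gives trace one, positivity of \<open>E\<close> gives positivity. The compression matters because
  the fixed points of a unital completely positive map form an algebra once some invariant state is
  faithful, but not in general. Condition (1) concerns every limit point, while P is built from one
  of them. This is harmless: whichever is used, the range of P is the phase subspace.\<close>

text \<open>Square matrices of all sizes are embedded into one non-unital ring of finitely supported infinite
  matrices, so that ring identities hold without side conditions on dimensions. Below, M d is the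
  corner of d x d matrices, and V d is the space of column vectors, placed in column 0, so that
  ip is at the same time the Hilbert-Schmidt inner product on M d and the usual one on V d.\<close>
definition in_dim :: "nat \<Rightarrow> (nat \<Rightarrow> nat \<Rightarrow> complex) \<Rightarrow> bool" where
  "in_dim N f \<longleftrightarrow> (\<forall>i j. N \<le> i \<or> N \<le> j \<longrightarrow> f i j = 0)"

lemma in_dim_mono: "in_dim N f \<Longrightarrow> N \<le> N' \<Longrightarrow> in_dim N' f"
  by (auto simp: in_dim_def)

typedef fmat = "{f :: nat \<Rightarrow> nat \<Rightarrow> complex. \<exists>N. in_dim N f}" morphisms ent Fmat
  by (rule exI[of _ "\<lambda>_ _. 0"]) (auto simp: in_dim_def)

setup_lifting type_definition_fmat

definition M :: "nat \<Rightarrow> fmat set" where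
  "M d = {X. in_dim d (ent X)}"

lemma M_ex: "\<exists>N. X \<in> M N"
  using ent[of X] by (auto simp: M_def)

lemma M_mono: "X \<in> M N \<Longrightarrow> N \<le> N' \<Longrightarrow> X \<in> M N'"
  by (auto simp: M_def intro: in_dim_mono)

lemma M_ex2: "\<exists>N. X \<in> M N \<and> Y \<in> M N"
  by (meson M_ex M_mono linorder_linear)

lemma M_ex3: "\<exists>N. X \<in> M N \<and> Y \<in> M N \<and> Z \<in> M N"
  by (meson M_ex M_ex2 M_mono linorder_linear)

lemma M_ent: "X \<in> M N \<Longrightarrow> N \<le> i \<or> N \<le> j \<Longrightarrow> ent X i j = 0"
  by (auto simp: M_def in_dim_def)

lemma M_I: "(\<And>i j. N \<le> i \<or> N \<le> j \<Longrightarrow> ent X i j = 0) \<Longrightarrow> X \<in> M N"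
  by (auto simp: M_def in_dim_def)

lemma fmat_eqI: "(\<And>i j. ent X i j = ent Y i j) \<Longrightarrow> X = Y"
  by (metis ent_inject ext)

lemma M_eqI: "X \<in> M N \<Longrightarrow> Y \<in> M N \<Longrightarrow> (\<And>i j. i < N \<Longrightarrow> j < N \<Longrightarrow> ent X i j = ent Y i j) \<Longrightarrow> X = Y"
proof (rule fmat_eqI)
  fix i j
  assume *: "X \<in> M N" "Y \<in> M N" "\<And>i j. i < N \<Longrightarrow> j < N \<Longrightarrow> ent X i j = ent Y i j"
  show "ent X i j = ent Y i j"
    by (cases "N \<le> i \<or> N \<le> j") (simp_all add: * M_ent[OF *(1)] M_ent[OF *(2)])
qed

instantiation fmat :: ab_group_add
begin
lift_definition zero_fmat :: fmat is "\<lambda>_ _. 0" by (auto simp: in_dim_def)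
lift_definition plus_fmat :: "fmat \<Rightarrow> fmat \<Rightarrow> fmat" is "\<lambda>f g i j. f i j + g i j"
proof -
  fix f g assume "\<exists>N. in_dim N f" "\<exists>N. in_dim N g"
  then obtain N N' where "in_dim N f" "in_dim N' g" by blast
  then show "\<exists>N. in_dim N (\<lambda>i j. f i j + g i j)"
    by (intro exI[of _ "max N N'"]) (auto simp: in_dim_def)
qed
lift_definition minus_fmat :: "fmat \<Rightarrow> fmat \<Rightarrow> fmat" is "\<lambda>f g i j. f i j - g i j"
proof -
  fix f g assume "\<exists>N. in_dim N f" "\<exists>N. in_dim N g"
  then obtain N N' where "in_dim N f" "in_dim N' g" by blast
  then show "\<exists>N. in_dim N (\<lambda>i j. f i j - g i j)"
    by (intro exI[of _ "max N N'"]) (auto simp: in_dim_def)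
qed
lift_definition uminus_fmat :: "fmat \<Rightarrow> fmat" is "\<lambda>f i j. - f i j"
  by (auto simp: in_dim_def)
instance
  by standard (transfer, auto simp: fun_eq_iff algebra_simps)+
end

lemma ent_zero [simp]: "ent 0 i j = 0" by transfer simp
lemma ent_add [simp]: "ent (X + Y) i j = ent X i j + ent Y i j" by transfer simp
lemma ent_diff [simp]: "ent (X - Y) i j = ent X i j - ent Y i j" by transfer simp
lemma ent_uminus [simp]: "ent (- X) i j = - ent X i j" by transfer simp
lemma ent_sum [simp]: "ent (\<Sum>a\<in>S. f a) i j = (\<Sum>a\<in>S. ent (f a) i j)"
  by (induction S rule: infinite_finite_induct) auto

instantiation fmat :: ring
begin
text \<open>Summing over the nonzero entries of a row keeps the sum finite without naming a
  dimension; \<open>ent_times\<close> recovers the usual formula for every dimension that contains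
  the left factor.\<close>

lift_definition times_fmat :: "fmat \<Rightarrow> fmat \<Rightarrow> fmat" is
  "\<lambda>f g i j. \<Sum>k | f i k \<noteq> 0. f i k * g k j"
proof -
  fix f g :: "nat \<Rightarrow> nat \<Rightarrow> complex" assume "\<exists>N. in_dim N f" "\<exists>N. in_dim N g"
  then obtain N N' where *: "in_dim N f" "in_dim N' g" by blast
  then show "\<exists>N. in_dim N (\<lambda>i j. \<Sum>k | f i k \<noteq> 0. f i k * g k j)"
    by (intro exI[of _ "max N N'"]) (auto simp: in_dim_def)
qed

lemma ent_times:
  assumes "X \<in> M N"
  shows "ent (X * Y) i j = (\<Sum>k<N. ent X i k * ent Y k j)"
proof -
  have "ent (X * Y) i j = (\<Sum>k | ent X i k \<noteq> 0. ent X i k * ent Y k j)"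
    by (simp add: times_fmat.rep_eq)
  also have "\<dots> = (\<Sum>k<N. ent X i k * ent Y k j)"
    by (rule sum.mono_neutral_left) (use M_ent[OF assms] in \<open>auto simp: not_le[symmetric]\<close>)
  finally show ?thesis .
qed

instance
proof
  fix X Y Z :: fmat
  obtain N where N: "X \<in> M N" "Y \<in> M N" "Z \<in> M N" using M_ex3 by blast
  have XY: "X * Y \<in> M N"
    by (rule M_I) (use N in \<open>auto simp: ent_times[OF N(1)] M_ent\<close>)
  have XpY: "X + Y \<in> M N"
    by (rule M_I) (use N in \<open>auto simp: M_ent\<close>)
  show "X * Y * Z = X * (Y * Z)"
  proof (rule fmat_eqI)
    fix i j
    have "ent (X * Y * Z) i j = (\<Sum>k<N. \<Sum>l<N. ent X i l * ent Y l k * ent Z k j)"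
      by (simp add: ent_times[OF N(1)] ent_times[OF XY] sum_distrib_right)
    also have "\<dots> = (\<Sum>l<N. \<Sum>k<N. ent X i l * ent Y l k * ent Z k j)"
      by (rule sum.swap)
    also have "\<dots> = ent (X * (Y * Z)) i j"
      by (simp add: ent_times[OF N(1)] ent_times[OF N(2)] sum_distrib_left mult.assoc)
    finally show "ent (X * Y * Z) i j = ent (X * (Y * Z)) i j" .
  qed
  show "(X + Y) * Z = X * Z + Y * Z"
    by (rule fmat_eqI) (simp add: ent_times[OF N(1)] ent_times[OF N(2)] ent_times[OF XpY] sum.distrib algebra_simps)
  show "Z * (X + Y) = Z * X + Z * Y"
    by (rule fmat_eqI) (simp add: ent_times[OF N(3)] sum.distrib algebra_simps)
qed
end

lemma ent_times':
  assumes "Y \<in> M N"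
  shows "ent (X * Y) i j = (\<Sum>k<N. ent X i k * ent Y k j)"
proof -
  obtain N' where X: "X \<in> M N'" using M_ex by blast
  have XX: "X \<in> M (max N N')" using M_mono[OF X] by simp
  show ?thesis unfolding ent_times[OF XX]
    by (rule sum.mono_neutral_right) (auto simp: M_ent[OF assms])
qed

section \<open>Scalar multiplication and adjoint\<close>

lift_definition sc :: "complex \<Rightarrow> fmat \<Rightarrow> fmat" (infixr "*\<^sub>C" 75) is "\<lambda>c f i j. c * f i j"
  by (auto simp: in_dim_def)

lift_definition star :: "fmat \<Rightarrow> fmat" is "\<lambda>f i j. cnj (f j i)"
  by (auto simp: in_dim_def)

lemma ent_sc [simp]: "ent (c *\<^sub>C X) i j = c * ent X i j" by transfer simp
lemma ent_star [simp]: "ent (star X) i j = cnj (ent X j i)" by transfer simp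

lemma M_zero [simp]: "0 \<in> M d" by (auto intro!: M_I)
lemma M_add [simp]: "X \<in> M d \<Longrightarrow> Y \<in> M d \<Longrightarrow> X + Y \<in> M d" by (auto intro!: M_I simp: M_ent)
lemma M_diff [simp]: "X \<in> M d \<Longrightarrow> Y \<in> M d \<Longrightarrow> X - Y \<in> M d" by (auto intro!: M_I simp: M_ent)
lemma M_sc [simp]: "X \<in> M d \<Longrightarrow> c *\<^sub>C X \<in> M d" by (auto intro!: M_I simp: M_ent)
lemma M_star [simp]: "X \<in> M d \<Longrightarrow> star X \<in> M d" by (auto intro!: M_I simp: M_ent)
lemma M_sum [simp, intro]: "(\<And>a. a \<in> S \<Longrightarrow> f a \<in> M d) \<Longrightarrow> sum f S \<in> M d"
  by (induction S rule: infinite_finite_induct) auto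
lemma M_times [simp]: "X \<in> M d \<Longrightarrow> Y \<in> M d \<Longrightarrow> X * Y \<in> M d"
  by (rule M_I) (auto simp: ent_times M_ent)

lemma sc_simps [simp]:
  "(c *\<^sub>C X) * Y = c *\<^sub>C (X * Y)" "X * (c *\<^sub>C Y) = c *\<^sub>C (X * Y)"
  "c *\<^sub>C c' *\<^sub>C X = (c * c') *\<^sub>C X" "1 *\<^sub>C X = X" "0 *\<^sub>C X = 0" "c *\<^sub>C 0 = 0"
proof -
  obtain N where N: "X \<in> M N" "Y \<in> M N" using M_ex2 by blast
  show "(c *\<^sub>C X) * Y = c *\<^sub>C (X * Y)"
    by (rule fmat_eqI) (simp add: ent_times[OF N(1)] ent_times[OF M_sc[OF N(1)]] sum_distrib_left mult.assoc)
  show "X * (c *\<^sub>C Y) = c *\<^sub>C (X * Y)"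
    by (rule fmat_eqI) (simp add: ent_times[OF N(1)] sum_distrib_left algebra_simps)
qed (auto intro!: fmat_eqI)

lemma sc_add: "c *\<^sub>C (X + Y) = c *\<^sub>C X + c *\<^sub>C Y"
  by (auto intro!: fmat_eqI simp: algebra_simps)
lemma sc_add_left: "(c + c') *\<^sub>C X = c *\<^sub>C X + c' *\<^sub>C X"
  by (auto intro!: fmat_eqI simp: algebra_simps)
lemma sc_diff: "c *\<^sub>C (X - Y) = c *\<^sub>C X - c *\<^sub>C Y"
  by (auto intro!: fmat_eqI simp: algebra_simps)
lemma sc_diff_left: "(c - c') *\<^sub>C X = c *\<^sub>C X - c' *\<^sub>C X"
  by (auto intro!: fmat_eqI simp: algebra_simps)
lemma sc_sum: "c *\<^sub>C (\<Sum>a\<in>S. f a) = (\<Sum>a\<in>S. c *\<^sub>C f a)"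
  by (auto intro!: fmat_eqI simp: sum_distrib_left)
lemma sc_sum_left: "(\<Sum>a\<in>S. f a) *\<^sub>C X = (\<Sum>a\<in>S. f a *\<^sub>C X)"
  by (auto intro!: fmat_eqI simp: sum_distrib_right)
lemma sc_eq_0: "c *\<^sub>C X = 0 \<longleftrightarrow> c = 0 \<or> X = 0"
proof
  assume *: "c *\<^sub>C X = 0"
  have "c * ent X i j = 0" for i j using arg_cong[OF *, of "\<lambda>Y. ent Y i j"] by simp
  then show "c = 0 \<or> X = 0" by (auto intro: fmat_eqI)
qed auto
lemma sc_minus1: "- X = (-1) *\<^sub>C X"
  by (auto intro!: fmat_eqI)

lemma star_star [simp]: "star (star X) = X" by (auto intro!: fmat_eqI)
lemma star_zero [simp]: "star 0 = 0" by (auto intro!: fmat_eqI)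
lemma star_add [simp]: "star (X + Y) = star X + star Y" by (auto intro!: fmat_eqI)
lemma star_diff [simp]: "star (X - Y) = star X - star Y" by (auto intro!: fmat_eqI)
lemma star_sc [simp]: "star (c *\<^sub>C X) = cnj c *\<^sub>C star X" by (auto intro!: fmat_eqI)
lemma star_sum [simp]: "star (\<Sum>a\<in>S. f a) = (\<Sum>a\<in>S. star (f a))" by (auto intro!: fmat_eqI)
lemma star_times [simp]: "star (X * Y) = star Y * star X"
proof -
  obtain N where N: "X \<in> M N" "Y \<in> M N" using M_ex2 by blast
  show ?thesis
    by (rule fmat_eqI) (simp add: ent_times[OF N(1)] ent_times[OF M_star[OF N(2)]] mult.commute)
qed
lemma star_eq_0 [simp]: "star X = 0 \<longleftrightarrow> X = 0"
  by (metis star_star star_zero)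

section \<open>Trace and Hilbert-Schmidt inner product\<close>

lift_definition tr :: "fmat \<Rightarrow> complex" is "\<lambda>f. \<Sum>i | f i i \<noteq> 0. f i i" .

lemma tr_eq: assumes "X \<in> M N" shows "tr X = (\<Sum>i<N. ent X i i)"
proof -
  have "tr X = (\<Sum>i | ent X i i \<noteq> 0. ent X i i)" by transfer simp
  also have "\<dots> = (\<Sum>i<N. ent X i i)"
    by (rule sum.mono_neutral_left) (use M_ent[OF assms] in \<open>auto simp: not_le[symmetric]\<close>)
  finally show ?thesis .
qed

lemma tr_zero [simp]: "tr 0 = 0" by transfer simp
lemma tr_add [simp]: "tr (X + Y) = tr X + tr Y"
proof -
  obtain N where N: "X \<in> M N" "Y \<in> M N" using M_ex2 by blast
  then show ?thesis by (simp add: tr_eq[of _ N] sum.distrib)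
qed
lemma tr_sc [simp]: "tr (c *\<^sub>C X) = c * tr X"
proof -
  obtain N where N: "X \<in> M N" using M_ex by blast
  then show ?thesis by (simp add: tr_eq[of _ N] sum_distrib_left)
qed
lemma tr_diff [simp]: "tr (X - Y) = tr X - tr Y"
proof -
  obtain N where N: "X \<in> M N" "Y \<in> M N" using M_ex2 by blast
  then show ?thesis by (simp add: tr_eq[of _ N] sum_subtractf)
qed
lemma tr_sum [simp]: "tr (\<Sum>a\<in>S. f a) = (\<Sum>a\<in>S. tr (f a))"
  by (induction S rule: infinite_finite_induct) auto
lemma tr_star [simp]: "tr (star X) = cnj (tr X)"
proof -
  obtain N where N: "X \<in> M N" using M_ex by blast
  then show ?thesis by (simp add: tr_eq[of _ N])
qed
lemma tr_comm: "tr (X * Y) = tr (Y * X)"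
proof -
  obtain N where N: "X \<in> M N" "Y \<in> M N" using M_ex2 by blast
  have "tr (X * Y) = (\<Sum>i<N. \<Sum>k<N. ent X i k * ent Y k i)"
    using N by (simp add: tr_eq[of _ N] ent_times[of _ N])
  also have "\<dots> = (\<Sum>k<N. \<Sum>i<N. ent X i k * ent Y k i)" by (rule sum.swap)
  also have "\<dots> = tr (Y * X)"
    using N by (simp add: tr_eq[of _ N] ent_times[of _ N] mult.commute)
  finally show ?thesis .
qed

definition ip :: "fmat \<Rightarrow> fmat \<Rightarrow> complex" where "ip X Y = tr (star X * Y)"

lemma ip_simps [simp]:
  "ip X (Y + Z) = ip X Y + ip X Z" "ip (X + Y) Z = ip X Z + ip Y Z"
  "ip X (Y - Z) = ip X Y - ip X Z" "ip (X - Y) Z = ip X Z - ip Y Z"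
  "ip X (c *\<^sub>C Y) = c * ip X Y" "ip (c *\<^sub>C X) Y = cnj c * ip X Y"
  "ip X 0 = 0" "ip 0 X = 0"
  "ip X (\<Sum>a\<in>S. f a) = (\<Sum>a\<in>S. ip X (f a))" "ip (\<Sum>a\<in>S. f a) Y = (\<Sum>a\<in>S. ip (f a) Y)"
  by (simp_all add: ip_def distrib_left distrib_right right_diff_distrib left_diff_distrib
      sum_distrib_left sum_distrib_right)

lemma ip_cnj: "cnj (ip X Y) = ip Y X"
  by (simp add: ip_def flip: tr_star)

lemma ip_times: "ip (A * X) Y = ip X (star A * Y)"
  by (simp add: ip_def mult.assoc)

lemma ip_eq: assumes "X \<in> M N" shows "ip X Y = (\<Sum>j<N. \<Sum>i<N. cnj (ent X i j) * ent Y i j)"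
proof -
  obtain N' where N': "star X * Y \<in> M N'" using M_ex by blast
  have "ip X Y = (\<Sum>j<max N N'. ent (star X * Y) j j)"
    unfolding ip_def by (rule tr_eq) (auto intro: M_mono[OF N'])
  also have "\<dots> = (\<Sum>j<max N N'. \<Sum>i<N. cnj (ent X i j) * ent Y i j)"
    by (simp add: ent_times[OF M_star[OF assms]])
  also have "\<dots> = (\<Sum>j<N. \<Sum>i<N. cnj (ent X i j) * ent Y i j)"
    by (rule sum.mono_neutral_right) (auto simp: M_ent[OF assms])
  finally show ?thesis .
qed

definition nsq :: "fmat \<Rightarrow> real" where "nsq X = Re (ip X X)"

lemma ip_self: "ip X X = complex_of_real (nsq X)"
proof -
  have "cnj (ip X X) = ip X X" by (rule ip_cnj)
  then show ?thesis by (simp add: nsq_def complex_eq_iff)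
qed

lemma nsq_eq: assumes "X \<in> M N" shows "nsq X = (\<Sum>j<N. \<Sum>i<N. (cmod (ent X i j))\<^sup>2)"
proof -
  have "complex_of_real (nsq X) = (\<Sum>j<N. \<Sum>i<N. complex_of_real ((cmod (ent X i j))\<^sup>2))"
    unfolding ip_self[symmetric] ip_eq[OF assms]
    by (intro sum.cong refl) (metis complex_norm_square mult.commute)
  also have "\<dots> = complex_of_real (\<Sum>j<N. \<Sum>i<N. (cmod (ent X i j))\<^sup>2)" by simp
  finally show ?thesis using of_real_eq_iff by blast
qed

lemma nsq_ge_0 [simp]: "nsq X \<ge> 0"
proof -
  obtain N where "X \<in> M N" using M_ex by blast
  then show ?thesis by (simp add: nsq_eq sum_nonneg)
qed

lemma nsq_eq_0 [simp]: "nsq X = 0 \<longleftrightarrow> X = 0"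
proof
  assume 0: "nsq X = 0"
  obtain N where N: "X \<in> M N" using M_ex by blast
  have "(\<Sum>j<N. \<Sum>i<N. (cmod (ent X i j))\<^sup>2) = 0" using 0 nsq_eq[OF N] by simp
  then have "\<forall>j<N. \<forall>i<N. ent X i j = 0"
    by (simp add: sum_nonneg_eq_0_iff sum_nonneg)
  then show "X = 0" by (intro M_eqI[OF N]) auto
qed (simp add: nsq_def)

lemma ip_eq_0 [simp]: "ip X X = 0 \<longleftrightarrow> X = 0"
  by (simp add: ip_self)

lemma nsq_sum_0: "finite S \<Longrightarrow> (\<Sum>a\<in>S. nsq (f a)) = 0 \<Longrightarrow> a \<in> S \<Longrightarrow> f a = 0"
  using sum_nonneg_eq_0_iff[of S "\<lambda>a. nsq (f a)"] by simp

text \<open>The matrix unit E_ij. In particular \<open>mu i 0\<close> is the standard basis vector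
  e_i in the column encoding.\<close>

lift_definition mu :: "nat \<Rightarrow> nat \<Rightarrow> fmat" is "\<lambda>i j i' j'. if i' = i \<and> j' = j then 1 else 0"
proof -
  fix i j :: nat
  show "\<exists>N. in_dim N (\<lambda>i' j'. if i' = i \<and> j' = j then 1 else 0)"
    by (rule exI[of _ "Suc (max i j)"]) (auto simp: in_dim_def)
qed

lemma ent_mu [simp]: "ent (mu i j) i' j' = (if i' = i \<and> j' = j then 1 else 0)"
  by transfer simp

lemma mu_M [simp]: "i < d \<Longrightarrow> j < d \<Longrightarrow> mu i j \<in> M d"
  by (rule M_I) auto

lemma M_expand: assumes "X \<in> M d" shows "X = (\<Sum>i<d. \<Sum>j<d. ent X i j *\<^sub>C mu i j)"
proof (rule M_eqI[OF assms])
  show "(\<Sum>i<d. \<Sum>j<d. ent X i j *\<^sub>C mu i j) \<in> M d" by (intro M_sum M_sc mu_M) auto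
  fix i j assume ij: "i < d" "j < d"
  have "ent (\<Sum>i<d. \<Sum>j<d. ent X i j *\<^sub>C mu i j) i j = (\<Sum>i'<d. \<Sum>j'<d. if j' = j then if i' = i then ent X i' j' else 0 else 0)"
    unfolding ent_sum ent_sc ent_mu by (intro sum.cong refl) simp
  also have "\<dots> = ent X i j" using ij by simp
  finally show "ent X i j = ent (\<Sum>i<d. \<Sum>j<d. ent X i j *\<^sub>C mu i j) i j" by simp
qed

lemma mu_mult: "mu i j * mu k l = (if j = k then mu i l else 0)"
proof (rule fmat_eqI)
  fix a b
  obtain N where N: "i < N" "j < N" by (meson less_Suc_eq_le max.cobounded1 max.cobounded2)
  have "ent (mu i j * mu k l) a b = (\<Sum>c<N. ent (mu i j) a c * ent (mu k l) c b)"
    using N by (intro ent_times) auto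
  also have "\<dots> = (\<Sum>c<N. if c = j then (if a = i \<and> j = k \<and> b = l then 1 else 0) else 0)"
    by (intro sum.cong) auto
  also have "\<dots> = ent (if j = k then mu i l else 0) a b" using N by simp
  finally show "ent (mu i j * mu k l) a b = ent (if j = k then mu i l else 0) a b" .
qed

lemma star_mu [simp]: "star (mu i j) = mu j i" by (rule fmat_eqI) auto

lemma ip_mu: "ip (mu i j) X = ent X i j"
proof -
  obtain N where N: "i < N" "j < N" by (meson less_Suc_eq_le max.cobounded1 max.cobounded2)
  have "ip (mu i j) X = (\<Sum>j'<N. \<Sum>i'<N. cnj (ent (mu i j) i' j') * ent X i' j')"
    using N by (intro ip_eq) auto
  also have "\<dots> = (\<Sum>j'<N. \<Sum>i'<N. if i' = i then if j' = j then ent X i' j' else 0 else 0)"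
    by (intro sum.cong refl) simp
  also have "\<dots> = ent X i j" using N by simp
  finally show ?thesis .
qed

text \<open>A local unit: the ring of all finitely supported matrices has no unit of its
  own.\<close>

definition idm :: "nat \<Rightarrow> fmat" where "idm d = (\<Sum>i<d. mu i i)"

lemma ent_idm: "ent (idm d) i j = (if i = j \<and> i < d then 1 else 0)"
proof -
  have "ent (idm d) i j = (\<Sum>k<d. if k = i then (if i = j then 1 else 0) else 0)"
    unfolding idm_def ent_sum by (intro sum.cong) auto
  then show ?thesis by simp
qed

lemma idm_M [simp]: "idm d \<in> M d" unfolding idm_def by (intro M_sum mu_M) auto
lemma star_idm [simp]: "star (idm d) = idm d" by (auto simp: idm_def)

lemma idm_left [simp]: "X \<in> M d \<Longrightarrow> idm d * X = X"
proof (rule M_eqI[of _ d])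
  fix i j assume *: "X \<in> M d" "i < d" "j < d"
  have "ent (idm d * X) i j = (\<Sum>k<d. if k = i then ent X k j else 0)"
    unfolding ent_times[OF idm_M] ent_idm using * by (intro sum.cong refl) auto
  then show "ent (idm d * X) i j = ent X i j" using * by simp
qed auto

lemma idm_right [simp]: "X \<in> M d \<Longrightarrow> X * idm d = X"
proof -
  assume "X \<in> M d"
  then have "idm d * star X = star X" by simp
  from arg_cong[OF this, of star] show "X * idm d = X"
    by (simp only: star_times star_star star_idm)
qed

lemma tr_idm: "tr (idm d) = of_nat d"
  by (simp add: tr_eq[of _ d] ent_idm)

definition V :: "nat \<Rightarrow> fmat set" where
  "V d = {X. \<forall>i j. ent X i j \<noteq> 0 \<longrightarrow> i < d \<and> j = 0}"

lemma V_I: "(\<And>i j. d \<le> i \<or> j \<noteq> 0 \<Longrightarrow> ent X i j = 0) \<Longrightarrow> X \<in> V d"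
  unfolding V_def using linorder_not_le by blast
lemma V_ent: "X \<in> V d \<Longrightarrow> d \<le> i \<or> j \<noteq> 0 \<Longrightarrow> ent X i j = 0"
  unfolding V_def using linorder_not_le by blast
text \<open>For \<open>d = 0\<close> the use of column 0 does no harm, since the zero vector is then
  the only one.\<close>

lemma V_M [simp]: "X \<in> V d \<Longrightarrow> X \<in> M d"
  by (rule M_I) (metis V_ent le_zero_eq linorder_le_cases not_less_eq_eq order_trans)
lemma V_zero [simp]: "0 \<in> V d" by (auto simp: V_def)
lemma V_add [simp]: "X \<in> V d \<Longrightarrow> Y \<in> V d \<Longrightarrow> X + Y \<in> V d" by (auto intro!: V_I simp: V_ent)
lemma V_diff [simp]: "X \<in> V d \<Longrightarrow> Y \<in> V d \<Longrightarrow> X - Y \<in> V d" by (auto intro!: V_I simp: V_ent)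
lemma V_sc [simp]: "X \<in> V d \<Longrightarrow> c *\<^sub>C X \<in> V d" by (auto intro!: V_I simp: V_ent)
lemma V_times [simp]: "A \<in> M d \<Longrightarrow> X \<in> V d \<Longrightarrow> A * X \<in> V d"
  by (rule V_I) (auto simp: ent_times[of _ d] V_ent M_ent)
lemma V_sum [simp, intro]: "(\<And>a. a \<in> S \<Longrightarrow> f a \<in> V d) \<Longrightarrow> sum f S \<in> V d"
  by (induction S rule: infinite_finite_induct) auto
lemma V_mu [simp]: "i < d \<Longrightarrow> mu i 0 \<in> V d" by (rule V_I) auto

lemma V_outer [simp]: assumes "v \<in> V d" "w \<in> V d" shows "v * star w \<in> M d"
  using assms by simp

text \<open>A row times a column has a single entry, at position (0,0), so \<open>mu 0 0\<close>
  plays the role of the scalar 1; by \<open>V_mu00\<close> it acts trivially on columns from the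
  right.\<close>

lemma V_star_times: assumes "v \<in> V d" "w \<in> V d" shows "star v * w = ip v w *\<^sub>C mu 0 0"
proof (rule fmat_eqI)
  fix i j
  have "ip v w = (\<Sum>j<d. if j = 0 then (\<Sum>k<d. cnj (ent v k j) * ent w k j) else 0)"
    unfolding ip_eq[OF V_M[OF assms(1)]] by (intro sum.cong) (auto simp: V_ent[OF assms(1)])
  also have "\<dots> = (\<Sum>k<d. cnj (ent v k 0) * ent w k 0)" by (cases d) auto
  finally have *: "ip v w = (\<Sum>k<d. cnj (ent v k 0) * ent w k 0)" .
  show "ent (star v * w) i j = ent (ip v w *\<^sub>C mu 0 0) i j"
    unfolding ent_times[OF M_star[OF V_M[OF assms(1)]]] * using assms by (auto simp: V_ent)
qed

lemma V_mu00: assumes "v \<in> V d" shows "v * mu 0 0 = v"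
proof (rule fmat_eqI)
  fix i j show "ent (v * mu 0 0) i j = ent v i j"
    by (subst ent_times'[of "mu 0 0" "Suc 0"]) (simp_all add: V_ent[OF assms])
qed

lemma outer_apply: assumes "v \<in> V d" "w \<in> V d" "x \<in> V d" shows "v * star w * x = ip w x *\<^sub>C v"
  by (simp add: mult.assoc V_star_times[OF assms(2,3)] V_mu00[OF assms(1)])

lemma outer_times: assumes "v \<in> V d" "w \<in> V d" "x \<in> V d"
  shows "v * star w * (x * star y) = ip w x *\<^sub>C (v * star y)"
  using outer_apply[OF assms] by (simp flip: mult.assoc)

lemma tr_outer: "tr (B * (v * star w)) = ip w (B * v)"
  unfolding ip_def using tr_comm[of "B * v" "star w"] by (simp add: mult.assoc)

lemma mu_outer: "mu i j = mu i 0 * star (mu j 0)" by (simp add: mu_mult)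

lemma M_eq_vecI:
  assumes "X \<in> M d" "Y \<in> M d" "\<And>v. v \<in> V d \<Longrightarrow> X * v = Y * v"
  shows "X = Y"
proof (rule M_eqI[OF assms(1,2)])
  fix i j assume ij: "i < d" "j < d"
  have "ent (Z * mu j 0) i 0 = ent Z i j" if "Z \<in> M d" for Z
  proof -
    have "ent (Z * mu j 0) i 0 = (\<Sum>k<d. if k = j then ent Z i k else 0)"
      unfolding ent_times[OF that] ent_mu by (intro sum.cong refl) simp
    then show ?thesis using ij by simp
  qed
  then show "ent X i j = ent Y i j" using assms ij by (metis V_mu)
qed

section \<open>Orthonormal bases, eigenvectors and projections\<close>

lemma nsq_pos [simp]: "nsq X > 0 \<longleftrightarrow> X \<noteq> 0"
  using nsq_eq_0[of X] by (auto simp: less_le simp del: nsq_eq_0)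

lemma star_eq_timesD: "X * Y = Z \<Longrightarrow> star Y * star X = star Z"
  by auto

section \<open>Orthonormal families in complex subspaces\<close>

definition csub :: "fmat set \<Rightarrow> bool" where
  "csub S \<longleftrightarrow> 0 \<in> S \<and> (\<forall>X\<in>S. \<forall>Y\<in>S. X + Y \<in> S) \<and> (\<forall>c. \<forall>X\<in>S. c *\<^sub>C X \<in> S)"

lemma csubI: "0 \<in> S \<Longrightarrow> (\<And>X Y. X \<in> S \<Longrightarrow> Y \<in> S \<Longrightarrow> X + Y \<in> S) \<Longrightarrow> (\<And>c X. X \<in> S \<Longrightarrow> c *\<^sub>C X \<in> S) \<Longrightarrow> csub S"
  by (auto simp: csub_def)
lemma csub_zero: "csub S \<Longrightarrow> 0 \<in> S" by (auto simp: csub_def)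
lemma csub_add: "csub S \<Longrightarrow> X \<in> S \<Longrightarrow> Y \<in> S \<Longrightarrow> X + Y \<in> S" by (auto simp: csub_def)
lemma csub_sc: "csub S \<Longrightarrow> X \<in> S \<Longrightarrow> c *\<^sub>C X \<in> S" by (auto simp: csub_def)
lemma csub_sum: "csub S \<Longrightarrow> (\<And>a. a \<in> I \<Longrightarrow> f a \<in> S) \<Longrightarrow> sum f I \<in> S"
  by (induction I rule: infinite_finite_induct) (auto simp: csub_zero csub_add)
lemma csub_diff: "csub S \<Longrightarrow> X \<in> S \<Longrightarrow> Y \<in> S \<Longrightarrow> X - Y \<in> S"
  using csub_add[of S X "- Y"] csub_sc[of S Y "-1"] by (simp add: sc_minus1[symmetric])

definition ortho :: "nat \<Rightarrow> (nat \<Rightarrow> fmat) \<Rightarrow> bool" where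
  "ortho n b \<longleftrightarrow> (\<forall>i<n. \<forall>j<n. ip (b i) (b j) = (if i = j then 1 else 0))"

lemma ortho_ip: "ortho n b \<Longrightarrow> i < n \<Longrightarrow> j < n \<Longrightarrow> ip (b i) (b j) = (if i = j then 1 else 0)"
  by (auto simp: ortho_def)

lemma ortho_coeff:
  assumes "ortho n b" "i < n"
  shows "ip (b i) (\<Sum>j<n. c j *\<^sub>C b j) = c i"
proof -
  have "ip (b i) (\<Sum>j<n. c j *\<^sub>C b j) = (\<Sum>j<n. if j = i then c j else 0)"
    unfolding ip_simps by (intro sum.cong refl) (use assms in \<open>auto simp: ortho_ip\<close>)
  then show ?thesis using assms by simp
qed

lemma bessel:
  assumes "ortho n b"
  shows "(\<Sum>i<n. (cmod (ip (b i) x))\<^sup>2) \<le> nsq x"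
proof -
  define y where "y = (\<Sum>i<n. ip (b i) x *\<^sub>C b i)"
  have yy: "ip y y = ip y x"
    unfolding y_def ip_simps(6,10) using ortho_coeff[OF assms, of _ "\<lambda>i. ip (b i) x"]
    by (intro sum.cong refl) (simp del: ip_simps(9))
  have yx: "ip y x = complex_of_real (\<Sum>i<n. (cmod (ip (b i) x))\<^sup>2)"
    unfolding y_def ip_simps(6,10) of_real_sum by (intro sum.cong refl) (metis complex_norm_square mult.commute)
  have xy: "ip x y = ip y x"
    using ip_cnj[of y x] yx by (metis complex_cnj_complex_of_real)
  have "ip (x - y) (x - y) = ip x x - ip y x"
    by (simp add: yy xy)
  then have "nsq (x - y) = nsq x - (\<Sum>i<n. (cmod (ip (b i) x))\<^sup>2)"
    unfolding yx ip_self by (metis of_real_diff of_real_eq_iff)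
  with nsq_ge_0[of "x - y"] show ?thesis by linarith
qed

text \<open>Count the squared moduli of all entries: their total is \<open>n\<close>, and for each
  of the \<open>d * d\<close> positions Bessel's inequality at the matrix unit bounds the
  contribution by 1.\<close>

lemma ortho_bound:
  assumes "ortho n b" "\<And>i. i < n \<Longrightarrow> b i \<in> M d"
  shows "n \<le> d * d"
proof -
  have nb: "nsq (b i) = 1" if "i < n" for i
    using ortho_ip[OF assms(1) that that] by (simp add: ip_self)
  have mu1: "nsq (mu k l) = 1" for k l
    using ip_mu[of k l "mu k l"] by (simp add: ip_self)
  have "real n = (\<Sum>i<n. nsq (b i))" by (simp add: nb)
  also have "\<dots> = (\<Sum>i<n. \<Sum>l<d. \<Sum>k<d. (cmod (ent (b i) k l))\<^sup>2)"
    by (intro sum.cong refl) (simp add: nsq_eq[OF assms(2)])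
  also have "\<dots> = (\<Sum>l<d. \<Sum>i<n. \<Sum>k<d. (cmod (ent (b i) k l))\<^sup>2)" by (rule sum.swap)
  also have "\<dots> = (\<Sum>l<d. \<Sum>k<d. \<Sum>i<n. (cmod (ent (b i) k l))\<^sup>2)"
    by (rule sum.cong[OF refl]) (rule sum.swap)
  also have "\<dots> \<le> (\<Sum>l<d. \<Sum>k<d. 1)"
  proof (intro sum_mono)
    fix k l
    have "cmod (ent (b i) k l) = cmod (ip (b i) (mu k l))" for i
      by (metis complex_mod_cnj ip_cnj ip_mu)
    then show "(\<Sum>i<n. (cmod (ent (b i) k l))\<^sup>2) \<le> 1"
      using bessel[OF assms(1), of "mu k l"] mu1 by simp
  qed
  also have "\<dots> = real (d * d)" by simp
  finally show ?thesis by linarith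
qed

lemma ortho_extend:
  assumes "ortho n b" "y \<noteq> 0" "\<And>i. i < n \<Longrightarrow> ip (b i) y = 0"
  shows "ortho (Suc n) (b(n := complex_of_real (1 / sqrt (nsq y)) *\<^sub>C y))"
proof -
  have pos: "nsq y > 0" using assms(2) by simp
  have a: "ip y (b i) = 0" if "i < n" for i
    using ip_cnj[of "b i" y] assms(3)[OF that] by simp
  have "complex_of_real (1 / sqrt (nsq y)) * (complex_of_real (1 / sqrt (nsq y)) * complex_of_real (nsq y)) = complex_of_real (1 / sqrt (nsq y) * (1 / sqrt (nsq y) * nsq y))"
    by (simp only: of_real_mult)
  also have "1 / sqrt (nsq y) * (1 / sqrt (nsq y) * nsq y) = 1"
    using pos assms(2) by (simp add: field_simps)
  finally have nn: "complex_of_real (1 / sqrt (nsq y)) * (complex_of_real (1 / sqrt (nsq y)) * complex_of_real (nsq y)) = 1" by simp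
  show ?thesis unfolding ortho_def
    using assms(1,3) a nn by (auto simp: less_Suc_eq ortho_ip ip_self)
qed

text \<open>An orthonormal family in \<open>S\<close> of greatest length exists because
  \<open>ortho_bound\<close> caps the length; a nonzero residual of some \<open>x\<close> in
  \<open>S\<close> would extend it.\<close>

lemma csub_ortho_basis:
  assumes S: "csub S" "S \<subseteq> M d"
  obtains n b where "ortho n b" "\<And>i. i < n \<Longrightarrow> b i \<in> S"
    "\<And>x. x \<in> S \<Longrightarrow> x = (\<Sum>i<n. ip (b i) x *\<^sub>C b i)"
proof -
  define Q where "Q n \<longleftrightarrow> (\<exists>b. ortho n b \<and> (\<forall>i<n. b i \<in> S))" for n
  have "Q 0" by (auto simp: Q_def ortho_def)
  moreover have bnd: "n \<le> d * d" if "Q n" for n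
    using that S(2) ortho_bound unfolding Q_def by (metis subsetD)
  ultimately have QG: "Q (GREATEST n. Q n)" by (rule GreatestI_nat)
  then obtain n b where n: "n = (GREATEST n. Q n)" and b: "ortho n b" "\<And>i. i < n \<Longrightarrow> b i \<in> S"
    unfolding Q_def by blast
  have "x = (\<Sum>i<n. ip (b i) x *\<^sub>C b i)" if "x \<in> S" for x
  proof (rule ccontr)
    define y where "y = x - (\<Sum>i<n. ip (b i) x *\<^sub>C b i)"
    assume "x \<noteq> (\<Sum>i<n. ip (b i) x *\<^sub>C b i)"
    then have y0: "y \<noteq> 0" by (simp add: y_def)
    have yS: "y \<in> S" unfolding y_def by (intro csub_diff csub_sum csub_sc S that b)  auto
    have "ip (b i) y = 0" if "i < n" for i
      unfolding y_def ip_simps(3) ortho_coeff[OF b(1) that] by simp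
    from ortho_extend[OF b(1) y0 this]
    have "Q (Suc n)" unfolding Q_def
      by (intro exI[of _ "b(n := complex_of_real (1 / sqrt (nsq y)) *\<^sub>C y)"]) (auto simp: less_Suc_eq b csub_sc S yS)
    then have "Suc n \<le> n" unfolding n by (rule Greatest_le_nat) (rule bnd)
    then show False by simp
  qed
  with that b show ?thesis by blast
qed

text \<open>In an orthonormal basis of \<open>S\<close> the map becomes a complex square matrix of
  positive size, whose spectrum is not empty.\<close>

lemma eigenvector_ex:
  assumes S: "csub S" "S \<subseteq> M d" "\<exists>x\<in>S. x \<noteq> 0"
    and T: "\<And>x. x \<in> S \<Longrightarrow> T x \<in> S" "\<And>x y. x \<in> S \<Longrightarrow> y \<in> S \<Longrightarrow> T (x + y) = T x + T y"
      "\<And>c x. x \<in> S \<Longrightarrow> T (c *\<^sub>C x) = c *\<^sub>C T x"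
  obtains x c where "x \<in> S" "x \<noteq> 0" "T x = c *\<^sub>C x"
proof -
  obtain n b where b: "ortho n b" "\<And>i. i < n \<Longrightarrow> b i \<in> S"
    "\<And>x. x \<in> S \<Longrightarrow> x = (\<Sum>i<n. ip (b i) x *\<^sub>C b i)"
    using csub_ortho_basis[OF S(1,2)] by blast
  have n0: "n > 0"
  proof (rule ccontr)
    assume "\<not> n > 0"
    then have "x = 0" if "x \<in> S" for x using b(3)[OF that] by simp
    with S(3) show False by blast
  qed
  have T0: "T 0 = 0" using T(3)[OF csub_zero[OF S(1)], of 0] by simp
  have Tsum: "T (\<Sum>i\<in>I. c i *\<^sub>C b i) = (\<Sum>i\<in>I. c i *\<^sub>C T (b i))" if "finite I" "I \<subseteq> {..<n}" for I c
    using that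
  proof (induction I)
    case (insert i I)
    have "(\<Sum>i\<in>I. c i *\<^sub>C b i) \<in> S" using insert.prems by (intro csub_sum csub_sc S b) auto
    then show ?case using insert by (simp add: T csub_sc S b)
  qed (simp add: T0)
  define A where "A = mat n n (\<lambda>(s,t). ip (b s) (T (b t)))"
  have A: "A \<in> carrier_mat n n" by (simp add: A_def)
  from spectrum_non_empty[OF A n0] obtain c v where v: "eigenvector A v c"
    by (auto simp: spectrum_def eigenvalue_def)
  then have v': "v \<in> carrier_vec n" "v \<noteq> 0\<^sub>v n" "A *\<^sub>v v = c \<cdot>\<^sub>v v" using A by (auto simp: eigenvector_def)
  define x where "x = (\<Sum>t<n. (v $ t) *\<^sub>C b t)"
  have xS: "x \<in> S" unfolding x_def by (intro csub_sum csub_sc S b) auto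
  have "ip (b s) (T x) = c * v $ s" if s: "s < n" for s
  proof -
    have "ip (b s) (T x) = (\<Sum>t<n. A $$ (s,t) * v $ t)"
      unfolding x_def Tsum[OF finite_lessThan subset_refl] ip_simps
      using s by (intro sum.cong refl) (simp add: A_def)
    also have "\<dots> = (A *\<^sub>v v) $ s"
      using s v'(1) A by (simp add: scalar_prod_def atLeast0LessThan)
    finally show ?thesis using s v' by simp
  qed
  then have "T x = (\<Sum>s<n. (c * v $ s) *\<^sub>C b s)"
    using b(3)[OF T(1)[OF xS]] by simp
  also have "\<dots> = c *\<^sub>C x" by (simp add: x_def sc_sum)
  finally have 1: "T x = c *\<^sub>C x" .
  have "x \<noteq> 0"
  proof
    assume "x = 0"
    then have "v $ t = 0" if "t < n" for t
      using ortho_coeff[OF b(1) that, of "\<lambda>t. v $ t"] by (simp add: x_def)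
    then show False using v'(1,2) by (metis carrier_vecD eq_vecI index_zero_vec)
  qed
  with that 1 xS show ?thesis by blast
qed

section \<open>Orthogonal projections\<close>

definition proj :: "nat \<Rightarrow> fmat \<Rightarrow> bool" where
  "proj d p \<longleftrightarrow> p \<in> M d \<and> star p = p \<and> p * p = p"

text \<open>The trace is recorded as a natural number because it later serves as the induction
  measure for decreasing chains of projections.\<close>

lemma subspace_proj:
  assumes S: "csub S" "S \<subseteq> V d"
  obtains p n b where "proj d p" "ortho n b" "\<And>i. i < n \<Longrightarrow> b i \<in> S" "p = (\<Sum>i<n. b i * star (b i))"
    "\<And>v. v \<in> V d \<Longrightarrow> p * v \<in> S" "\<And>v. v \<in> S \<Longrightarrow> p * v = v" "tr p = of_nat n"
proof -
  have SM: "S \<subseteq> M d" using S(2) V_M by blast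
  obtain n b where b: "ortho n b" "\<And>i. i < n \<Longrightarrow> b i \<in> S"
    "\<And>x. x \<in> S \<Longrightarrow> x = (\<Sum>i<n. ip (b i) x *\<^sub>C b i)"
    using csub_ortho_basis[OF S(1) SM] by blast
  have bV: "b i \<in> V d" if "i < n" for i using b(2)[OF that] S(2) by blast
  define p where "p = (\<Sum>i<n. b i * star (b i))"
  have pv: "p * v = (\<Sum>i<n. ip (b i) v *\<^sub>C b i)" if "v \<in> V d" for v
    unfolding p_def sum_distrib_right by (intro sum.cong refl outer_apply[OF bV bV that]) auto
  have pM: "p \<in> M d" unfolding p_def by (intro M_sum V_outer bV) auto
  have pS: "p * v \<in> S" if "v \<in> V d" for v
    unfolding pv[OF that] by (intro csub_sum csub_sc S b) auto
  have pid: "p * v = v" if "v \<in> S" for v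
    using that S(2) pv[of v] b(3)[OF that] by auto
  have "p * p = (\<Sum>i<n. p * b i * star (b i))"
    by (subst (2) p_def) (simp add: sum_distrib_left mult.assoc)
  also have "\<dots> = p" unfolding p_def[symmetric] using pid[OF b(2)] by (simp add: p_def)
  finally have "p * p = p" .
  then have pr: "proj d p" using pM by (simp add: proj_def p_def)
  have "tr p = (\<Sum>i<n. ip (b i) (b i))"
    unfolding p_def tr_sum ip_def by (intro sum.cong refl tr_comm)
  also have "\<dots> = of_nat n" using b(1) by (simp add: ortho_ip)
  finally have "tr p = of_nat n" .
  with that[OF pr b(1,2) p_def pS pid] show ?thesis by blast
qed

lemma proj_M [simp]: "proj d p \<Longrightarrow> p \<in> M d" by (simp add: proj_def)
lemma proj_star: "proj d p \<Longrightarrow> star p = p" by (simp add: proj_def)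
lemma proj_idem: "proj d p \<Longrightarrow> p * p = p" by (simp add: proj_def)

lemma proj_idem2: "proj d p \<Longrightarrow> p * (p * X) = p * X"
  by (metis mult.assoc proj_idem)

lemma csub_proj_range: "csub {v \<in> V d. p * v = v}"
  by (rule csubI) (auto simp: distrib_left)

text \<open>The projection \<open>q\<close> built from the range of \<open>p\<close> coincides with
  \<open>p\<close>: each of the two fixes the range of the other, and both are self-adjoint.\<close>

lemma proj_basis:
  assumes p: "proj d p"
  obtains n b where "ortho n b" "\<And>i. i < n \<Longrightarrow> b i \<in> V d" "\<And>i. i < n \<Longrightarrow> p * b i = b i"
    "p = (\<Sum>i<n. b i * star (b i))" "tr p = of_nat n"
proof -
  obtain q n b where q: "proj d q" "ortho n b" "\<And>i. i < n \<Longrightarrow> b i \<in> {v \<in> V d. p * v = v}" "q = (\<Sum>i<n. b i * star (b i))"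
    "\<And>v. v \<in> V d \<Longrightarrow> q * v \<in> {v \<in> V d. p * v = v}" "\<And>v. v \<in> {v \<in> V d. p * v = v} \<Longrightarrow> q * v = v" "tr q = of_nat n"
    using subspace_proj[OF csub_proj_range, of d p] by blast
  have q5: "q * v \<in> V d" "p * (q * v) = q * v" if "v \<in> V d" for v using q(5)[OF that] by blast+
  have pq: "p * q = q"
    by (rule M_eq_vecI[of _ d]) (use p q(1) q5 in \<open>simp_all add: mult.assoc\<close>)
  have qpv: "q * p * v = p * v" if "v \<in> V d" for v
    using q(6)[of "p * v"] that proj_M[OF p] proj_idem2[OF p] V_times[of p d v] by (simp add: mult.assoc)
  have "q * p = p"
    using M_eq_vecI[OF M_times[OF proj_M[OF q(1)] proj_M[OF p]] proj_M[OF p] qpv] by blast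
  from star_eq_timesD[OF this] have "p * q = p" unfolding proj_star[OF p] proj_star[OF q(1)] .
  then have "p = q" by (rule trans[OF sym pq])
  then show ?thesis using that[OF q(2)] q(3,4,7) by blast
qed

text \<open>The difference \<open>p - q\<close> is a projection, so its trace is its squared
  norm.\<close>

lemma proj_tr_mono:
  assumes "proj d p" "proj d q" "p * q = q" "p \<noteq> q"
  shows "Re (tr q) < Re (tr p)"
proof -
  have qp: "q * p = q" using star_eq_timesD[OF assms(3)] assms by (simp add: proj_star)
  have "ip (p - q) (p - q) = tr (p - q)"
    unfolding ip_def using assms by (simp add: proj_star proj_idem qp algebra_simps)
  moreover have "nsq (p - q) > 0" using assms(4) by simp
  ultimately show ?thesis by (simp add: nsq_def)
qed

lemma proj_diff:
  assumes "proj d p" "proj d q" "p * q = q"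
  shows "proj d (p - q)" "q * p = q"
proof -
  show qp: "q * p = q" using star_eq_timesD[OF assms(3)] assms by (simp add: proj_star)
  show "proj d (p - q)" using assms qp by (simp add: proj_def algebra_simps)
qed

section \<open>Minimal projections and matrix units\<close>

text \<open>The last axiom says that the range of a projection in the algebra, cut down to the kernel
  of another element, again has its projection in the algebra; it holds for commutants and
  replaces spectral theory in Schur's lemma.\<close>
locale star_algebra =
  fixes d :: nat and A :: "fmat set"
  assumes A_M: "X \<in> A \<Longrightarrow> X \<in> M d"
    and A_add: "X \<in> A \<Longrightarrow> Y \<in> A \<Longrightarrow> X + Y \<in> A"
    and A_sc: "X \<in> A \<Longrightarrow> c *\<^sub>C X \<in> A"
    and A_times: "X \<in> A \<Longrightarrow> Y \<in> A \<Longrightarrow> X * Y \<in> A"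
    and A_star: "X \<in> A \<Longrightarrow> star X \<in> A"
    and A_ker: "proj d p \<Longrightarrow> p \<in> A \<Longrightarrow> X \<in> A \<Longrightarrow>
      \<exists>q\<in>A. proj d q \<and> p * q = q \<and> X * q = 0 \<and> (\<forall>v\<in>V d. p * v = v \<longrightarrow> X * v = 0 \<longrightarrow> q * v = v)"
begin

lemma A_diff: "X \<in> A \<Longrightarrow> Y \<in> A \<Longrightarrow> X - Y \<in> A"
  using A_add[of X "- Y"] A_sc[of Y "-1"] by (simp add: sc_minus1[symmetric])

definition minp :: "fmat \<Rightarrow> bool" where
  "minp p \<longleftrightarrow> p \<in> A \<and> proj d p \<and> p \<noteq> 0 \<and> (\<forall>q\<in>A. proj d q \<longrightarrow> p * q = q \<longrightarrow> q = 0 \<or> q = p)"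

lemma proj_tr_nat: "proj d p \<Longrightarrow> \<exists>n. tr p = of_nat n"
  by (metis proj_basis)

text \<open>Descent on the trace, a natural number that drops strictly when a projection is replaced
  by a proper subprojection.\<close>

lemma minp_below:
  assumes "f \<in> A" "proj d f" "f \<noteq> 0"
  shows "\<exists>p. minp p \<and> f * p = p"
proof -
  obtain n where "tr f = of_nat n" using proj_tr_nat[OF assms(2)] by blast
  then show ?thesis using assms
  proof (induction n arbitrary: f rule: less_induct)
    case (less n)
    show ?case
    proof (cases "minp f")
      case True
      then show ?thesis using less.prems by (auto simp: proj_idem)
    next
      case False
      then obtain q where q: "q \<in> A" "proj d q" "f * q = q" "q \<noteq> 0" "q \<noteq> f"
        using less.prems unfolding minp_def by blast
      obtain k where k: "tr q = of_nat k" using proj_tr_nat[OF q(2)] by blast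
      have "k < n" using proj_tr_mono[OF less.prems(3) q(2,3)] q(5) k less.prems(1) by auto
      from less.IH[OF this k q(1,2,4)] obtain p where p: "minp p" "q * p = p" by blast
      have "f * p = f * q * p" using p(2) by (simp add: mult.assoc)
      then have "f * p = p" using q(3) p(2) by simp
      with p show ?thesis by blast
    qed
  qed
qed

text \<open>Split off one minimal projection \<open>q\<close> and continue with
  \<open>f - q\<close>, whose trace is smaller.\<close>

lemma minp_family:
  assumes "f \<in> A" "proj d f"
  shows "\<exists>m p. (\<forall>j<m. minp (p j)) \<and> (\<forall>j<m. \<forall>k<m. j \<noteq> k \<longrightarrow> p j * p k = 0) \<and> f = (\<Sum>j<m::nat. p j)"
proof -
  obtain n where "tr f = of_nat n" using proj_tr_nat[OF assms(2)] by blast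
  then show ?thesis using assms
  proof (induction n arbitrary: f rule: less_induct)
    case (less n)
    show ?case
    proof (cases "f = 0")
      case True
      then show ?thesis by (intro exI[of _ 0]) auto
    next
      case False
      then obtain q where q: "minp q" "f * q = q" using minp_below less.prems by blast
      have qA: "q \<in> A" "proj d q" "q \<noteq> 0" using q(1) by (auto simp: minp_def)
      have fq: "proj d (f - q)" "q * f = q" using proj_diff[OF less.prems(3) qA(2) q(2)] by auto
      obtain k where k: "tr (f - q) = of_nat k" using proj_tr_nat[OF fq(1)] by blast
      have "f * (f - q) = f - q" using less.prems q by (simp add: right_diff_distrib proj_idem)
      then have "Re (tr (f - q)) < Re (tr f)"
        using proj_tr_mono[OF less.prems(3) fq(1)] qA(3) by simp
      then have "k < n" unfolding k less.prems(1) by simp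
      from less.IH[OF this k A_diff[OF less.prems(2) qA(1)] fq(1)]
      obtain m p where p: "\<forall>j<m. minp (p j)" "\<forall>j<m. \<forall>k<m. j \<noteq> k \<longrightarrow> p j * p k = 0" "f - q = (\<Sum>j<m::nat. p j)"
        by blast
      have pp: "p j * p j = p j" if "j < m" for j using p(1) that by (auto simp: minp_def proj_idem)
      have sp: "star (p j) = p j" if "j < m" for j using p(1) that by (auto simp: minp_def proj_star)
      have "(f - q) * p j = p j" if "j < m" for j
      proof -
        have "(f - q) * p j = (\<Sum>k<m. if k = j then p j else 0)"
          unfolding p(3) sum_distrib_right using p(2) pp that by (intro sum.cong refl) auto
        then show ?thesis using that by simp
      qed
      \<comment> \<open>The projection \<open>q\<close> annihilates \<open>f - q\<close>, hence also
        every summand \<open>p j\<close>, which \<open>f - q\<close> reproduces.\<close>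
      then have "q * p j = q * ((f - q) * p j)" if "j < m" for j using that by simp
      then have qp: "q * p j = 0" if "j < m" for j
        using that fq(2) qA(2) by (simp add: right_diff_distrib left_diff_distrib proj_idem flip: mult.assoc)
      have pq: "p j * q = 0" if "j < m" for j
        using arg_cong[OF qp[OF that], of star] sp[OF that] proj_star[OF qA(2)] by simp
      have "f = (\<Sum>j<Suc m. (p(m := q)) j)" using p(3) by (simp add: algebra_simps)
      moreover have "\<forall>j<Suc m. minp ((p(m := q)) j)" using p(1) q(1) by (auto simp: less_Suc_eq)
      moreover have "\<forall>j<Suc m. \<forall>k<Suc m. j \<noteq> k \<longrightarrow> (p(m := q)) j * (p(m := q)) k = 0"
        using p(2) qp pq by (auto simp: less_Suc_eq)
      ultimately show ?thesis by blast
    qed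
  qed
qed

lemma proj_nonzero_vec:
  assumes "X \<in> M d" "X \<noteq> 0"
  shows "\<exists>v\<in>V d. X * v \<noteq> 0"
  using M_eq_vecI[of X d 0] assms by auto

text \<open>The compression of \<open>X\<close> has an eigenvector in the range of \<open>p\<close>.
  By \<open>A_ker\<close> the kernel of \<open>p * X * p - c *\<^sub>C p\<close> inside that range
  carries a nonzero projection of \<open>A\<close> below \<open>p\<close>, and minimality makes it
  \<open>p\<close> itself.\<close>

lemma schur:
  assumes p: "minp p" and X: "X \<in> A"
  shows "\<exists>c. p * X * p = c *\<^sub>C p"
proof -
  have pA: "p \<in> A" "proj d p" "p \<noteq> 0" using p by (auto simp: minp_def)
  have pM: "p \<in> M d" "X \<in> M d" using pA X A_M by auto
  define S where "S = {v \<in> V d. p * v = v}"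
  obtain v0 where v0: "v0 \<in> V d" "p * v0 \<noteq> 0" using proj_nonzero_vec pA pM by blast
  have "p * (p * v0) = p * v0" using proj_idem[OF pA(2)] by (simp flip: mult.assoc)
  then have S0: "\<exists>x\<in>S. x \<noteq> 0" using v0 pM by (intro bexI[of _ "p * v0"]) (auto simp: S_def)
  have S1: "csub S" "S \<subseteq> M d" unfolding S_def by (rule csub_proj_range) auto
  have T: "p * X * v \<in> S" if "v \<in> S" for v
    using that pM proj_idem[OF pA(2)] by (auto simp: S_def simp flip: mult.assoc)
  obtain v c where v: "v \<in> S" "v \<noteq> 0" "p * X * v = c *\<^sub>C v"
    using eigenvector_ex[OF S1 S0, of "\<lambda>v. p * X * v"] T by (auto simp: distrib_left)
  define Y where "Y = p * X * p - c *\<^sub>C p"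
  have YA: "Y \<in> A" unfolding Y_def by (intro A_diff A_times A_sc pA X)
  obtain q where q: "q\<in>A" "proj d q" "p * q = q" "Y * q = 0" "\<forall>v\<in>V d. p * v = v \<longrightarrow> Y * v = 0 \<longrightarrow> q * v = v"
    using A_ker[OF pA(2,1) YA] by blast
  have "Y * v = 0" using v by (simp add: Y_def S_def left_diff_distrib mult.assoc)
  then have "q * v = v" using q(5) v by (auto simp: S_def)
  then have "q \<noteq> 0" using v(2) by auto
  then have "q = p" using q p by (auto simp: minp_def)
  then have "Y * p = 0" using q by simp
  then have "p * X * p = c *\<^sub>C p"
    using proj_idem[OF pA(2)] by (simp add: Y_def left_diff_distrib mult.assoc)
  then show ?thesis by blast
qed

lemma tr_proj_nsq: "proj d p \<Longrightarrow> tr p = complex_of_real (nsq p)"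
  using ip_self[of p] by (simp add: ip_def proj_star proj_idem)

text \<open>For \<open>Y = p * X * q\<close>, Schur's lemma makes \<open>star Y * Y\<close> and
  \<open>Y * star Y\<close> multiples of \<open>q\<close> and \<open>p\<close>. Evaluating
  \<open>Y * star Y * Y\<close> in two ways shows that the factors agree, so one rescaling of
  \<open>Y\<close> serves both.\<close>

lemma partial_isometry:
  assumes p: "minp p" and q: "minp q" and X: "X \<in> A" "p * X * q \<noteq> 0"
  shows "\<exists>u\<in>A. star u * u = q \<and> u * star u = p"
proof -
  have pA: "p \<in> A" "proj d p" "p \<noteq> 0" using p by (auto simp: minp_def)
  have qA: "q \<in> A" "proj d q" "q \<noteq> 0" using q by (auto simp: minp_def)
  note pr = proj_star[OF pA(2)] proj_idem[OF pA(2)] proj_star[OF qA(2)] proj_idem[OF qA(2)]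
  define Y where "Y = p * X * q"
  have Y: "Y \<in> A" "Y \<noteq> 0" "p * Y = Y" "Y * q = Y"
    using X pr by (auto simp: Y_def A_times pA qA) (simp_all add: mult.assoc flip: mult.assoc[of p p] )
  obtain c where c: "star Y * Y = c *\<^sub>C q"
    using schur[OF q, of "star X * p * X"] by (auto simp: Y_def A_times A_star X pA pr mult.assoc)
       (metis mult.assoc pr(2))
  obtain c' where c': "Y * star Y = c' *\<^sub>C p"
    using schur[OF p, of "X * q * star X"] by (auto simp: Y_def A_times A_star X qA pr mult.assoc)
       (metis mult.assoc pr(4))
  have "c *\<^sub>C Y = Y * (star Y * Y)" by (simp add: c Y)
  also have "\<dots> = c' *\<^sub>C Y" by (simp add: c' Y flip: mult.assoc)
  finally have "(c - c') *\<^sub>C Y = 0" by (simp add: sc_diff_left)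
  then have cc: "c' = c" using Y(2) by (auto simp: sc_eq_0)
  have "c * complex_of_real (nsq q) = complex_of_real (nsq Y)"
    using arg_cong[OF c, of tr] by (simp add: tr_proj_nsq[OF qA(2)] ip_self ip_def flip: ip_def)
  moreover have nz: "nsq q > 0" "nsq Y > 0"
    using qA(3) Y(2) nsq_eq_0[of q] nsq_eq_0[of Y] nsq_ge_0[of q] nsq_ge_0[of Y] by linarith+
  ultimately have c_eq: "c = complex_of_real (nsq Y / nsq q)" by (simp add: field_simps)
  \<comment> \<open>Comparing traces has shown the common factor \<open>c\<close> to be a positive
    real; this is its inverse square root.\<close>
  define t where "t = 1 / sqrt (nsq Y / nsq q)"
  define u where "u = complex_of_real t *\<^sub>C Y"
  have "complex_of_real t * (complex_of_real t * c) = complex_of_real (t * (t * (nsq Y / nsq q)))"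
    unfolding c_eq by (simp only: of_real_mult)
  also have "t * (t * (nsq Y / nsq q)) = 1" using nz unfolding t_def by (simp add: field_simps)
  finally have t: "complex_of_real t * (complex_of_real t * c) = 1" by simp
  have "star u * u = q" "u * star u = p"
    using t by (simp_all add: u_def c c' cc mult.assoc)
  moreover have "u \<in> A" unfolding u_def by (intro A_sc Y)
  ultimately show ?thesis by blast
qed

text \<open>The relation \<open>R\<close> is equivalence of projections inside \<open>A\<close>. By
  \<open>partial_isometry\<close>, a nonzero corner between two minimal projections already makes
  them equivalent; \<open>rep j\<close> is the least index equivalent to \<open>j\<close>.\<close>

lemma matrix_units:
  assumes e: "e \<in> A" "proj d e"
  obtains m p rep u where
    "\<And>j. j < m \<Longrightarrow> minp (p j)" "\<And>j k. j < m \<Longrightarrow> k < m \<Longrightarrow> j \<noteq> k \<Longrightarrow> p j * p k = 0" "e = (\<Sum>j<m::nat. p j)"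
    "\<And>j. j < m \<Longrightarrow> rep j < m" "\<And>j. j < m \<Longrightarrow> u j \<in> A" "\<And>j. j < m \<Longrightarrow> star (u j) * u j = p (rep j)"
    "\<And>j. j < m \<Longrightarrow> u j * star (u j) = p j"
    "\<And>j k X. j < m \<Longrightarrow> k < m \<Longrightarrow> X \<in> A \<Longrightarrow> rep j \<noteq> rep k \<Longrightarrow> p j * X * p k = 0"
proof -
  obtain m p where p: "\<And>j. j < m \<Longrightarrow> minp (p j)" "\<And>j k. j < m \<Longrightarrow> k < m \<Longrightarrow> j \<noteq> k \<Longrightarrow> p j * p k = 0"
    "e = (\<Sum>j<m::nat. p j)"
    using minp_family[OF e] by blast
  have pA: "p j \<in> A" "proj d (p j)" "p j \<noteq> 0" if "j < m" for j using p(1)[OF that] by (auto simp: minp_def)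
  define R where "R j k \<longleftrightarrow> (\<exists>u\<in>A. star u * u = p k \<and> u * star u = p j)" for j k
  have R: "R j k" if "j < m" "k < m" "X \<in> A" "p j * X * p k \<noteq> 0" for j k X
    unfolding R_def using partial_isometry p(1) that by blast
  have refl: "R j j" if "j < m" for j
    unfolding R_def using pA[OF that] by (auto simp: proj_star proj_idem intro!: bexI[of _ "p j"])
  have sym: "R k j" if "R j k" for j k
    using that unfolding R_def by (metis A_star star_star)
  have trans: "R j l" if "j < m" "k < m" "l < m" "R j k" "R k l" for j k l
  proof -
    obtain u where u: "u \<in> A" "star u * u = p k" "u * star u = p j" using \<open>R j k\<close> R_def by blast
    obtain u' where u': "u' \<in> A" "star u' * u' = p l" "u' * star u' = p k" using \<open>R k l\<close> R_def by blast
    have pk: "p k * p k = p k" using pA(2)[OF that(2)] by (rule proj_idem)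
    \<comment> \<open>For transitivity a nonzero corner between \<open>p j\<close> and
      \<open>p l\<close> suffices, and \<open>u * u'\<close> provides one: multiplying back with the
      adjoints recovers \<open>p k\<close>.\<close>
    have "star u * (p j * (u * u') * p l) * star u' = (star u * u) * (star u * u) * (u' * star u') * (u' * star u')"
      unfolding u(3)[symmetric] u'(2)[symmetric] by (simp only: mult.assoc)
    also have "\<dots> = p k" unfolding u u' by (simp add: pk)
    finally have "p j * (u * u') * p l \<noteq> 0" using pA(3)[OF that(2)] by auto
    then show ?thesis using R that u u' A_times by blast
  qed
  define rep where "rep j = (LEAST k. k < m \<and> R j k)" for j
  have rep: "rep j < m" "R j (rep j)" if "j < m" for j
    using LeastI[of "\<lambda>k. k < m \<and> R j k" j] refl that unfolding rep_def by blast+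
  have rep_eq: "rep j = rep k" if "j < m" "k < m" "R j k" for j k
  proof -
    have "(l < m \<and> R j l) = (l < m \<and> R k l)" for l using that trans sym by blast
    then show ?thesis unfolding rep_def by presburger
  qed
  have "\<exists>u. \<forall>j. j < m \<longrightarrow> u j \<in> A \<and> star (u j) * u j = p (rep j) \<and> u j * star (u j) = p j"
    using rep(2) unfolding R_def by (intro choice) blast
  then obtain u where u: "\<And>j. j < m \<Longrightarrow> u j \<in> A" "\<And>j. j < m \<Longrightarrow> star (u j) * u j = p (rep j)"
    "\<And>j. j < m \<Longrightarrow> u j * star (u j) = p j" by blast
  have "p j * X * p k = 0" if "j < m" "k < m" "X \<in> A" "rep j \<noteq> rep k" for j k X
    using R rep_eq that by blast
  from that[OF p rep(1) u this] show ?thesis by blast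
qed

end

section \<open>Fixed points of an idempotent channel\<close>

locale kraus =
  fixes d n :: nat and K :: "nat \<Rightarrow> fmat"
  assumes K_M: "a < n \<Longrightarrow> K a \<in> M d"
    and K_tp: "(\<Sum>a<n. star (K a) * K a) = idm d"
begin

definition P :: "fmat \<Rightarrow> fmat" where "P X = (\<Sum>a<n. K a * X * star (K a))"
text \<open>The adjoint of \<open>P\<close> for the trace pairing, see \<open>tr_P\<close>; trace
  preservation of \<open>P\<close> is unitality of \<open>D\<close>.\<close>

definition D :: "fmat \<Rightarrow> fmat" where "D X = (\<Sum>a<n. star (K a) * X * K a)"

lemma P_M: "X \<in> M d \<Longrightarrow> P X \<in> M d" unfolding P_def by (intro M_sum M_times M_star K_M) auto
lemma D_M: "X \<in> M d \<Longrightarrow> D X \<in> M d" unfolding D_def by (intro M_sum M_times M_star K_M) auto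

lemma tr_P: "tr (P X * Y) = tr (X * D Y)"
proof -
  have "tr (K a * X * star (K a) * Y) = tr (X * (star (K a) * Y * K a))" for a
    using tr_comm[of "K a" "X * star (K a) * Y"] by (simp add: mult.assoc)
  then show ?thesis by (simp add: P_def D_def sum_distrib_left sum_distrib_right)
qed

text \<open>Take the complement of the projection \<open>f\<close> onto the common kernel of the
  matrices \<open>star (K a)\<close>.\<close>

lemma support_proj_ex:
  "\<exists>e. proj d e \<and> (\<forall>a<n. e * K a = K a) \<and> (\<forall>W\<in>M d. (\<forall>a<n. star (K a) * W = 0) \<longrightarrow> e * W = 0)"
proof -
  define S where "S = {v \<in> V d. \<forall>a<n. star (K a) * v = 0}"
  have S1: "csub S" unfolding S_def by (rule csubI) (auto simp: distrib_left)
  have S2: "S \<subseteq> V d" by (auto simp: S_def)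
  obtain f where f: "proj d f" "\<And>v. v \<in> V d \<Longrightarrow> f * v \<in> S" "\<And>v. v \<in> S \<Longrightarrow> f * v = v"
    by (rule subspace_proj[OF S1 S2]) blast
  have e: "proj d (idm d - f)"
    using f(1) by (simp add: proj_def algebra_simps)
  have Kf: "star (K a) * f = 0" if "a < n" for a
  proof (rule M_eq_vecI[of _ d])
    fix v assume "v \<in> V d"
    from f(2)[OF this] that show "star (K a) * f * v = 0 * v" by (simp add: S_def mult.assoc)
  qed (use K_M[OF that] f(1) in auto)
  have "f * K a = 0" if "a < n" for a
    using star_eq_timesD[OF Kf[OF that]] f(1) by (simp add: proj_star)
  then have 1: "(idm d - f) * K a = K a" if "a < n" for a
    using that K_M by (simp add: left_diff_distrib)
  have 2: "(idm d - f) * W = 0" if "W \<in> M d" "\<forall>a<n. star (K a) * W = 0" for W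
  proof -
    have "f * W = W"
    proof (rule M_eq_vecI[of _ d])
      fix v assume "v \<in> V d"
      then have "W * v \<in> S" using that by (auto simp: S_def simp flip: mult.assoc)
      then show "f * W * v = W * v" using f(3) by (simp add: mult.assoc)
    qed (use that f(1) in auto)
    then show ?thesis using that by (simp add: left_diff_distrib)
  qed
  show ?thesis using e 1 2 by blast
qed

end

text \<open>Here e is the projection onto the sum of the ranges of the Kraus operators, which is the
  support of the image of the channel.\<close>
locale idempotent_kraus = kraus +
  fixes e :: fmat
  assumes idem: "X \<in> M d \<Longrightarrow> P (P X) = P X"
    and e_proj: "proj d e"
    and e_K: "a < n \<Longrightarrow> e * K a = K a"
    and e_supp: "W \<in> M d \<Longrightarrow> (\<And>a. a < n \<Longrightarrow> star (K a) * W = 0) \<Longrightarrow> e * W = 0"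
begin

lemma e_M [simp]: "e \<in> M d" using e_proj by simp
lemma e_star [simp]: "star e = e" using e_proj by (rule proj_star)
lemma e_idem [simp]: "e * e = e" using e_proj by (rule proj_idem)
lemma e_idem2 [simp]: "e * (e * X) = e * X" using e_proj by (rule proj_idem2)
lemma K_star_e: "a < n \<Longrightarrow> star (K a) * e = star (K a)"
  using star_eq_timesD[OF e_K] by simp

text \<open>Idempotence passes to the adjoint because the trace pairing is nondegenerate: the
  difference \<open>Z\<close> is tested against its own adjoint.\<close>

lemma D_idem: assumes "X \<in> M d" shows "D (D X) = D X"
proof -
  define Z where "Z = D (D X) - D X"
  have Z: "star Z \<in> M d" using assms by (auto simp: Z_def intro!: D_M M_star M_diff simp del: star_diff)
  have "tr (star Z * D (D X)) = tr (star Z * D X)"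
    using idem[OF Z] by (simp flip: tr_P)
  moreover have "star Z * Z = star Z * D (D X) - star Z * D X"
    by (subst (2) Z_def) (simp only: right_diff_distrib)
  ultimately have "ip Z Z = 0" unfolding ip_def by simp
  then have "Z = 0" by (simp only: ip_eq_0)
  then show ?thesis unfolding Z_def by simp
qed

text \<open>By \<open>e_K\<close> this equals \<open>e * K a * e\<close>, the Kraus operator
  compressed to the support.\<close>

definition L :: "nat \<Rightarrow> fmat" where "L a = K a * e"

lemma L_M: "a < n \<Longrightarrow> L a \<in> M d" by (simp add: L_def K_M)
lemma L_e: "L a * e = L a" by (simp add: L_def mult.assoc)
lemma e_L: "a < n \<Longrightarrow> e * L a = L a" by (simp add: L_def e_K flip: mult.assoc)
lemma L_star_e: "a < n \<Longrightarrow> star (L a) * e = star (L a)" using star_eq_timesD[OF e_L] by simp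

definition E :: "fmat \<Rightarrow> fmat" where "E X = (\<Sum>a<n. star (L a) * X * L a)"

lemma E_D: "E X = e * D X * e"
  by (simp add: E_def D_def L_def sum_distrib_left sum_distrib_right mult.assoc)
lemma E_M: "X \<in> M d \<Longrightarrow> E X \<in> M d" by (simp add: E_D D_M)
lemma E_idm: "E (idm d) = e"
proof -
  have "(\<Sum>a<n. star (K a) * idm d * K a) = (\<Sum>a<n. star (K a) * K a)"
    by (intro sum.cong refl) (simp add: K_M)
  then show ?thesis by (simp add: E_D D_def K_tp)
qed
lemma E_e: "E e = e"
proof -
  have "E e = E (idm d)" unfolding E_def
    by (intro sum.cong refl) (simp add: L_star_e L_M)
  then show ?thesis by (simp add: E_idm)
qed
lemma L_tp: "(\<Sum>a<n. star (L a) * L a) = e"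
proof -
  have "E e = (\<Sum>a<n. star (L a) * L a)" unfolding E_def by (intro sum.cong refl) (simp add: L_star_e)
  then show ?thesis by (simp add: E_e)
qed

text \<open>The ranges of the Kraus operators lie under \<open>e\<close>, so \<open>D\<close> sees
  only the corner of its argument. This is what lets the compression \<open>E\<close> inherit
  idempotence from \<open>D\<close>.\<close>

lemma D_eXe: "D (e * X * e) = D X"
  unfolding D_def
proof (intro sum.cong refl)
  fix a assume "a \<in> {..<n}"
  then have a: "a < n" by simp
  have "star (K a) * (e * X * e) * K a = (star (K a) * e) * X * (e * K a)" by (simp only: mult.assoc)
  then show "star (K a) * (e * X * e) * K a = star (K a) * X * K a" by (simp add: e_K[OF a] K_star_e[OF a])
qed

lemma E_idem: "X \<in> M d \<Longrightarrow> E (E X) = E X"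
  unfolding E_D D_eXe by (simp add: D_idem)

lemma ePe: "e * P X * e = P X"
proof -
  have "e * (K a * X * star (K a)) * e = K a * X * star (K a)" if "a < n" for a
  proof -
    have "e * (K a * X * star (K a)) * e = (e * K a) * X * (star (K a) * e)" by (simp only: mult.assoc)
    then show ?thesis by (simp add: e_K[OF that] K_star_e[OF that])
  qed
  then show ?thesis by (simp add: P_def sum_distrib_left sum_distrib_right)
qed

lemma tr_eBe: assumes "e * B * e = B" shows "tr (B * D X) = tr (B * E X)"
proof -
  have "tr (B * D X) = tr (e * (B * e * D X))" by (subst assms[symmetric]) (simp add: mult.assoc)
  also have "\<dots> = tr (B * E X)" by (subst tr_comm) (simp add: E_D mult.assoc)
  finally show ?thesis .
qed

text \<open>Says that the invariant state P e is faithful on the support.\<close>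
lemma faithful:
  assumes W: "W \<in> M d" and 0: "\<And>b. b < n \<Longrightarrow> e * star (K b) * W = 0"
  shows "e * W = 0"
proof -
  \<comment> \<open>Writing \<open>P (idm d)\<close> as the image of its own corner makes every term
    of the Kraus expansion end in \<open>e * star (K b) * W\<close>, which vanishes by
    assumption.\<close>
  have PP: "P (idm d) = P (e * P (idm d) * e)" using idem[of "idm d"] by (simp add: ePe)
  have "star W * P (idm d) * W = (\<Sum>b<n. star W * K b * e * P (idm d) * (e * star (K b) * W))"
    by (subst PP, subst P_def) (simp add: sum_distrib_left sum_distrib_right mult.assoc)
  also have "\<dots> = 0" by (intro sum.neutral) (simp add: 0)
  finally have "tr (star W * P (idm d) * W) = 0" by simp
  moreover have "tr (star W * P (idm d) * W) = (\<Sum>b<n. ip (star (K b) * W) (star (K b) * W))"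
    unfolding P_def by (simp add: sum_distrib_left sum_distrib_right ip_def mult.assoc K_M)
  ultimately have "complex_of_real (\<Sum>b<n. nsq (star (K b) * W)) = 0" by (simp add: ip_self)
  then have "(\<Sum>b<n. nsq (star (K b) * W)) = 0" using of_real_eq_0_iff by blast
  then have "star (K b) * W = 0" if "b < n" for b
    using nsq_sum_0[of "{..<n}" "\<lambda>b. star (K b) * W" b] that by simp
  then show ?thesis using e_supp[OF W] by blast
qed

text \<open>The commutant is taken inside the corner of \<open>e\<close>, so that \<open>e\<close>
  is its unit and splits into its minimal projections.\<close>

definition A :: "fmat set" where
  "A = {X \<in> M d. e * X = X \<and> X * e = X \<and> (\<forall>a<n. X * L a = L a * X \<and> X * star (L a) = star (L a) * X)}"

text \<open>With G a = [L a, X] one has sum G* G = E (X* X) - X* X, whose trace against the invariant state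
  P e vanishes.\<close>
lemma fix_comm0:
  assumes X: "X \<in> M d" "e * X = X" "X * e = X" "E X = X" and a: "a < n"
  shows "X * L a = L a * X"
proof -
  define G where "G a = L a * X - X * L a" for a
  define Y where "Y = star X * X"
  have eX: "star X * e = star X" "e * star X = star X" using star_eq_timesD[OF X(2)] star_eq_timesD[OF X(3)] by simp_all
  have Es: "E (star X) = star X"
  proof -
    have "star (E X) = E (star X)" by (simp add: E_def mult.assoc)
    then show ?thesis using X(4) by simp
  qed
  have eY: "e * Y * e = Y" unfolding Y_def by (simp add: mult.assoc X(3)) (simp add: eX flip: mult.assoc)
  have "(\<Sum>a<n. star (G a) * G a) = (\<Sum>a<n. star X * (star (L a) * L a) * X - star X * (star (L a) * X * L a)
      - (star (L a) * star X * L a) * X + star (L a) * Y * L a)"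
    unfolding G_def Y_def by (intro sum.cong refl) (simp add: algebra_simps)
  also have "\<dots> = star X * e * X - star X * E X - E (star X) * X + E Y"
  proof -
    have "(\<Sum>a<n. star X * (star (L a) * L a) * X) = star X * (\<Sum>a<n. star (L a) * L a) * X"
      by (simp only: sum_distrib_left sum_distrib_right)
    then have "(\<Sum>a<n. star X * (star (L a) * L a) * X) = star X * e * X" by (simp only: L_tp)
    then show ?thesis
      by (simp only: sum.distrib sum_subtractf E_def sum_distrib_left[symmetric] sum_distrib_right[symmetric])
  qed
  also have "\<dots> = E Y - Y" by (simp add: X Es eX Y_def)
  finally have GG: "(\<Sum>a<n. star (G a) * G a) = E Y - Y" .
  \<comment> \<open>Expanding \<open>P e\<close> into the terms \<open>K b * e * star (K b)\<close>
    turns the trace against the invariant state into a sum of squared norms.\<close>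
  have "(\<Sum>a<n. \<Sum>b<n. ip (G a * K b * e) (G a * K b * e)) = tr (P e * (\<Sum>a<n. star (G a) * G a))"
  proof -
    have "ip (G a * K b * e) (G a * K b * e) = tr (K b * e * star (K b) * (star (G a) * G a))" for a b
    proof -
      have "ip (G a * K b * e) (G a * K b * e) = tr ((e * star (K b) * star (G a) * G a) * (K b * e))"
        by (simp add: ip_def mult.assoc)
      also have "\<dots> = tr (K b * e * star (K b) * (star (G a) * G a))"
        by (subst tr_comm) (simp add: mult.assoc)
      finally show ?thesis .
    qed
    then have "(\<Sum>b<n. ip (G a * K b * e) (G a * K b * e)) = tr (P e * (star (G a) * G a))" for a
      by (simp only: P_def sum_distrib_right tr_sum)
    then show ?thesis by (simp only: sum_distrib_left tr_sum)
  qed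
  also have "\<dots> = tr (P e * E Y) - tr (P e * Y)" unfolding GG by (simp add: right_diff_distrib)
  also have "tr (P e * E Y) = tr (P (P e) * Y)" by (rule trans[OF tr_eBe[OF ePe, symmetric] tr_P[symmetric]])
  also have "P (P e) = P e" by (rule idem) simp
  finally have "(\<Sum>a<n. \<Sum>b<n. ip (G a * K b * e) (G a * K b * e)) = 0" by simp
  then have "complex_of_real (\<Sum>a<n. \<Sum>b<n. nsq (G a * K b * e)) = 0" by (simp add: ip_self)
  then have *: "(\<Sum>a<n. \<Sum>b<n. nsq (G a * K b * e)) = 0" using of_real_eq_0_iff by blast
  have "(\<Sum>b<n. nsq (G a * K b * e)) = 0"
    using sum_nonneg_eq_0_iff[of "{..<n}" "\<lambda>a. \<Sum>b<n. nsq (G a * K b * e)"] * a by (simp add: sum_nonneg)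
  then have "G a * K b * e = 0" if "b < n" for b
    using nsq_sum_0[of "{..<n}" "\<lambda>b. G a * K b * e" b] that by simp
  from star_eq_timesD[OF this] have "e * star (K b) * star (G a) = 0" if "b < n" for b
    using that by (simp add: mult.assoc)
  \<comment> \<open>Faithfulness, applied to \<open>star (G a)\<close>, removes the factors
    \<open>K b\<close> from \<open>G a * K b * e = 0\<close>.\<close>
  then have "e * star (G a) = 0"
    by (intro faithful) (auto simp: G_def L_M X a)
  from star_eq_timesD[OF this] have "G a * e = 0" by simp
  moreover have "G a * e = G a" by (simp add: G_def left_diff_distrib mult.assoc X L_e)
  ultimately show ?thesis by (simp add: G_def)
qed

text \<open>Commutation with the adjoints of the \<open>L a\<close> is the adjoint of
  \<open>fix_comm0\<close> for \<open>star X\<close>, which is a fixed point as well.\<close>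

lemma fix_comm:
  assumes X: "X \<in> M d" "e * X = X" "X * e = X" "E X = X"
  shows "X \<in> A"
proof -
  have eX: "star X * e = star X" "e * star X = star X" using star_eq_timesD[OF X(2)] star_eq_timesD[OF X(3)] by simp_all
  have "star (E X) = E (star X)" by (simp add: E_def mult.assoc)
  then have Es: "E (star X) = star X" using X(4) by simp
  have "X * star (L a) = star (L a) * X" if "a < n" for a
    using star_eq_timesD[OF fix_comm0[OF M_star[OF X(1)] eX(2,1) Es that]] by simp
  then show ?thesis using X fix_comm0[OF X] by (auto simp: A_def)
qed

text \<open>By idempotence all values of \<open>E\<close> are fixed points. Together with
  \<open>E_left\<close> and \<open>E_right\<close> this makes \<open>E\<close> a conditional
  expectation onto \<open>A\<close>.\<close>

lemma E_A: "X \<in> M d \<Longrightarrow> E X \<in> A"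
  by (rule fix_comm) (auto simp: E_M E_idem, auto simp: E_D mult.assoc)

lemma A_e: "e \<in> A"
  using E_A[of e] by (simp add: E_e)

text \<open>Only the kernel axiom takes an argument: the range of \<open>p\<close> intersected with
  the kernel of \<open>X\<close> is invariant under every \<open>L a\<close> and its adjoint, since
  \<open>p\<close> and \<open>X\<close> commute with them, so the projection onto it lies in the
  commutant.\<close>

lemma A_star_algebra: "star_algebra d A"
proof
  fix X Y c assume X: "X \<in> A"
  show "X \<in> M d" using X by (simp add: A_def)
  show "c *\<^sub>C X \<in> A" using X by (auto simp: A_def)
  show "star X \<in> A"
  proof -
    have "star X * L a = L a * star X" "star X * star (L a) = star (L a) * star X" if "a < n" for a
      using X that star_eq_timesD[of X "star (L a)" "star (L a) * X"] star_eq_timesD[of X "L a" "L a * X"]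
      by (auto simp: A_def)
    moreover have "star X * e = star X" "e * star X = star X"
      using X star_eq_timesD[of e X X] star_eq_timesD[of X e X] by (auto simp: A_def)
    ultimately show ?thesis using X by (auto simp: A_def)
  qed
  assume Y: "Y \<in> A"
  show "X + Y \<in> A" using X Y by (auto simp: A_def algebra_simps)
  have "X * Y * L a = L a * (X * Y)" "X * Y * star (L a) = star (L a) * (X * Y)" if "a < n" for a
    using X Y that by (auto simp: A_def mult.assoc) (simp_all flip: mult.assoc)
  moreover have "e * (X * Y) = X * Y" "X * Y * e = X * Y"
    using X Y by (auto simp: A_def mult.assoc) (simp_all flip: mult.assoc)
  ultimately show "X * Y \<in> A" using X Y by (auto simp: A_def)
next
  fix p X assume p: "proj d p" "p \<in> A" and X: "X \<in> A"
  define S where "S = {v \<in> V d. p * v = v \<and> X * v = 0}"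
  have S1: "csub S" unfolding S_def by (rule csubI) (auto simp: distrib_left)
  have S2: "S \<subseteq> V d" by (auto simp: S_def)
  obtain q where q: "proj d q" "\<And>v. v \<in> V d \<Longrightarrow> q * v \<in> S" "\<And>v. v \<in> S \<Longrightarrow> q * v = v"
    by (rule subspace_proj[OF S1 S2]) blast
  have XM: "X \<in> M d" using X by (simp add: A_def)
  have pq: "p * q = q"
    by (rule M_eq_vecI[of _ d]) (use p q in \<open>auto simp: S_def mult.assoc\<close>)
  have Xq: "X * q = 0"
    by (rule M_eq_vecI[of _ d]) (use XM q in \<open>auto simp: S_def mult.assoc\<close>)
  have inv: "q * T * q = T * q" if T: "T \<in> M d" "p * T = T * p" "X * T = T * X" for T
  proof (rule M_eq_vecI[of _ d])
    fix v assume "v \<in> V d"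
    then have w: "q * v \<in> S" by (rule q(2))
    have "T * (q * v) \<in> S"
    proof -
      have "p * (T * (q * v)) = T * (p * (q * v))" "X * (T * (q * v)) = T * (X * (q * v))"
        using T by (simp_all flip: mult.assoc)
      then show ?thesis using w T(1) by (auto simp: S_def)
    qed
    then show "q * T * q * v = T * q * v" using q(3) by (simp add: mult.assoc)
  qed (use q(1) T(1) in auto)
  \<comment> \<open>Invariance of a subspace under an operator and under its adjoint together give
    commutation with the projection.\<close>
  have com: "q * L a = L a * q \<and> q * star (L a) = star (L a) * q" if a: "a < n" for a
  proof -
    have 1: "q * L a * q = L a * q" using inv[of "L a"] p X a L_M by (auto simp: A_def)
    have 2: "q * star (L a) * q = star (L a) * q" using inv[of "star (L a)"] p X a L_M by (auto simp: A_def)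
    from star_eq_timesD[OF 2] have "q * L a * q = q * L a" using q(1) by (simp add: proj_star mult.assoc)
    with 1 have 3: "L a * q = q * L a" by simp
    from star_eq_timesD[OF 3] have "q * star (L a) = star (L a) * q" using q(1) by (simp add: proj_star)
    with 3 show ?thesis by simp
  qed
  have "e * (p * q) = p * q" using p(2) by (simp add: A_def flip: mult.assoc)
  then have eq: "e * q = q" by (simp add: pq)
  from star_eq_timesD[OF this] have "q * e = q" using q(1) by (simp add: proj_star)
  with com eq q(1) have "q \<in> A" by (auto simp: A_def)
  then show "\<exists>q\<in>A. proj d q \<and> p * q = q \<and> X * q = 0 \<and> (\<forall>v\<in>V d. p * v = v \<longrightarrow> X * v = 0 \<longrightarrow> q * v = v)"
    using q pq Xq by (intro bexI[of _ q]) (auto simp: S_def)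
qed

text \<open>Elements of the commutant can be pulled out past the Kraus operators.\<close>

lemma E_left: assumes "Y \<in> A" shows "E (Y * X) = Y * E X"
  unfolding E_def sum_distrib_left
proof (intro sum.cong refl)
  fix a assume "a \<in> {..<n}"
  then have "star (L a) * Y = Y * star (L a)" using assms by (auto simp: A_def)
  then show "star (L a) * (Y * X) * L a = Y * (star (L a) * X * L a)" by (metis mult.assoc)
qed

lemma E_right: assumes "Y \<in> A" shows "E (X * Y) = E X * Y"
  unfolding E_def sum_distrib_right
proof (intro sum.cong refl)
  fix a assume "a \<in> {..<n}"
  then have "L a * Y = Y * L a" using assms by (auto simp: A_def)
  then show "star (L a) * (X * Y) * L a = star (L a) * X * L a * Y" by (metis mult.assoc)
qed

lemma E_sc: "E (c *\<^sub>C X) = c *\<^sub>C E X" by (simp add: E_def sc_sum)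
lemma E_sum: "E (\<Sum>i\<in>I. f i) = (\<Sum>i\<in>I. E (f i))"
  unfolding E_def by (simp add: sum_distrib_left sum_distrib_right sum.swap[of _ I])

end

text \<open>Block indices j, k < m belong to the same block of the decomposition iff rep j = rep k;
  then j is the index in the first tensor factor and s < N j that in the second.\<close>
definition block_data :: "nat \<Rightarrow> (fmat \<Rightarrow> fmat) \<Rightarrow> nat \<Rightarrow> (nat \<Rightarrow> nat) \<Rightarrow> (nat \<Rightarrow> nat) \<Rightarrow>
    (nat \<Rightarrow> nat \<Rightarrow> fmat) \<Rightarrow> (nat \<Rightarrow> nat \<Rightarrow> nat \<Rightarrow> complex) \<Rightarrow> bool" where
  "block_data d F m rep N w T \<longleftrightarrow>
    (\<forall>j<m. \<forall>k<m. rep j = rep k \<longrightarrow> N j = N k \<and> T j = T k) \<and>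
    (\<forall>j<m. rep j < m) \<and>
    (\<forall>j<m. \<forall>s<N j. w j s \<in> V d) \<and>
    (\<forall>j<m. \<forall>k<m. \<forall>s<N j. \<forall>t<N k. ip (w j s) (w k t) = (if j = k \<and> s = t then 1 else 0)) \<and>
    (\<forall>j<m. (\<Sum>s<N j. T j s s) = 1) \<and>
    (\<forall>j<m. \<forall>x. \<exists>c\<ge>0. (\<Sum>s<N j. \<Sum>t<N j. cnj (x s) * T j s t * x t) = complex_of_real c) \<and>
    (\<forall>B\<in>M d. F B = B \<longleftrightarrow> (\<exists>\<beta>. B = (\<Sum>j<m. \<Sum>k<m. if rep j = rep k then
        \<beta> j k *\<^sub>C (\<Sum>s<N j. \<Sum>t<N j. T j s t *\<^sub>C (w j s * star (w k t))) else 0)))"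

lemma block_data_cong:
  "(\<And>B. B \<in> M d \<Longrightarrow> F B = G B) \<Longrightarrow> block_data d F m rep N w T = block_data d G m rep N w T"
  unfolding block_data_def by (simp cong: ball_cong)

lemma isometry_source:
  assumes "star u * u = q" "proj d q" shows "u * q = u"
proof -
  have "ip (u - u * q) (u - u * q) = tr (star u * u - star u * u * q - q * (star u * u) + q * (star u * u) * q)"
    by (simp only: ip_def star_diff star_times proj_star[OF assms(2)]) (simp add: algebra_simps)
  also have "\<dots> = 0" unfolding assms(1) by (simp add: proj_idem[OF assms(2)])
  finally have "u - u * q = 0" by (simp only: ip_eq_0)
  then show ?thesis by simp
qed

lemma outer_eq_sc: "v \<in> V d \<Longrightarrow> x \<in> V d \<Longrightarrow> w \<in> V d \<Longrightarrow> v * (star w * x) * star y = ip w x *\<^sub>C (v * star y)"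
  using outer_apply[of v d w x] by (simp add: mult.assoc[symmetric])

context idempotent_kraus
begin

text \<open>One basis \<open>b\<close> is chosen per class representative and carried to the other
  members by \<open>u\<close>; hence \<open>N\<close> and \<open>T\<close> depend on
  \<open>rep j\<close> only. The vectors \<open>w j s\<close> span the support, and
  \<open>ePe\<close> shows that nothing of \<open>P B\<close> lies outside it.\<close>

lemma channel_range: "\<exists>m rep N w T. block_data d P m rep N w T"
proof -
  interpret star_algebra d A by (rule A_star_algebra)
  obtain m p rep u where
    minp: "\<And>j. j < m \<Longrightarrow> minp (p j)" and porth: "\<And>j k. j < m \<Longrightarrow> k < m \<Longrightarrow> j \<noteq> k \<Longrightarrow> p j * p k = 0"
    and esum: "e = (\<Sum>j<m::nat. p j)" and rep: "\<And>j. j < m \<Longrightarrow> rep j < m"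
    and uA: "\<And>j. j < m \<Longrightarrow> u j \<in> A" and uu: "\<And>j. j < m \<Longrightarrow> star (u j) * u j = p (rep j)"
    and uu': "\<And>j. j < m \<Longrightarrow> u j * star (u j) = p j"
    and sep: "\<And>j k X. j < m \<Longrightarrow> k < m \<Longrightarrow> X \<in> A \<Longrightarrow> rep j \<noteq> rep k \<Longrightarrow> p j * X * p k = 0"
    by (rule matrix_units[OF A_e e_proj]) blast
  have pA: "p j \<in> A" "proj d (p j)" "p j \<noteq> 0" "p j \<in> M d" if "j < m" for j
    using minp[OF that] by (auto simp: minp_def)
  note pstar = proj_star[OF pA(2)] and pidem = proj_idem[OF pA(2)] and pidem2 = proj_idem2[OF pA(2)]
  have "\<exists>n b. ortho n b \<and> (\<forall>i<n. b i \<in> V d) \<and> (\<forall>i<n. p r * b i = b i) \<and> p r = (\<Sum>i<n. b i * star (b i))" if "r < m" for r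
    by (rule proj_basis[OF pA(2)[OF that]]) blast
  then have "\<forall>r. \<exists>n b. r < m \<longrightarrow> ortho n b \<and> (\<forall>i<n. b i \<in> V d) \<and> (\<forall>i<n. p r * b i = b i) \<and> p r = (\<Sum>i<n. b i * star (b i))" by blast
  then obtain nn b where b0: "\<And>r. r < m \<Longrightarrow> ortho (nn r) (b r) \<and> (\<forall>i<nn r. b r i \<in> V d) \<and> (\<forall>i<nn r. p r * b r i = b r i) \<and> p r = (\<Sum>i<nn r. b r i * star (b r i))"
    by metis
  have b: "\<And>r. r < m \<Longrightarrow> ortho (nn r) (b r)" "\<And>r i. r < m \<Longrightarrow> i < nn r \<Longrightarrow> b r i \<in> V d"
    "\<And>r i. r < m \<Longrightarrow> i < nn r \<Longrightarrow> p r * b r i = b r i"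
    "\<And>r. r < m \<Longrightarrow> p r = (\<Sum>i<nn r. b r i * star (b r i))"
    using b0 by blast+
  define N where "N j = nn (rep j)" for j
  define w where "w j s = u j * b (rep j) s" for j s
  have up: "u j * p (rep j) = u j" if "j < m" for j
    by (rule isometry_source[OF uu[OF that] pA(2)[OF rep[OF that]]])
  have pu: "p j * u j = u j" if "j < m" for j
    using up[OF that] uu[OF that] uu'[OF that] by (metis mult.assoc)
  have uM: "u j \<in> M d" if "j < m" for j using uA[OF that] A_M by blast
  have wV: "w j s \<in> V d" if "j < m" "s < N j" for j s
    unfolding w_def using that by (intro V_times uM b) (auto simp: N_def rep)
  have pw: "p j * w j s = w j s" if "j < m" for j s
    using pu[OF that] by (simp add: w_def flip: mult.assoc)
  have uw: "star (u j) * w j s = b (rep j) s" if "j < m" "s < N j" for j s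
    using uu[OF that(1)] b(3)[OF rep[OF that(1)]] that(2) by (simp add: w_def N_def flip: mult.assoc)
  have orth: "ip (w j s) (w k t) = (if j = k \<and> s = t then 1 else 0)"
    if jk: "j < m" "k < m" "s < N j" "t < N k" for j s k t
  proof (cases "j = k")
    case True
    have "ip (w j s) (w k t) = ip (b (rep j) s) (star (u j) * w j t)"
      using True by (simp add: w_def ip_times)
    also have "\<dots> = ip (b (rep j) s) (b (rep j) t)" using uw[OF jk(1)] jk(4) True by simp
    also have "\<dots> = (if s = t then 1 else 0)"
      by (rule ortho_ip[OF b(1)[OF rep[OF jk(1)]]]) (use jk True in \<open>auto simp: N_def\<close>)
    finally show ?thesis using True by simp
  next
    case False
    have "ip (w j s) (w k t) = ip (p j * w j s) (p k * w k t)" using pw jk by simp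
    also have "\<dots> = ip (w j s) (p j * p k * w k t)" by (simp only: ip_times pstar[OF jk(1)] mult.assoc)
    finally show ?thesis using porth[OF jk(1,2) False] False by simp
  qed
  have pww: "p j = (\<Sum>s<N j. w j s * star (w j s))" if "j < m" for j
  proof -
    have "p j = u j * p (rep j) * star (u j)" using up[OF that] uu'[OF that] by simp
    also have "\<dots> = (\<Sum>s<N j. w j s * star (w j s))"
      unfolding b(4)[OF rep[OF that]] w_def N_def by (simp add: sum_distrib_left sum_distrib_right mult.assoc)
    finally show ?thesis .
  qed
  have ukj: "u k * star (u j) = (\<Sum>s<N j. w k s * star (w j s))" if "j < m" "k < m" "rep j = rep k" for j k
  proof -
    have "u k * star (u j) = u k * p (rep k) * star (u j)" using up[OF that(2)] by simp
    also have "\<dots> = (\<Sum>s<N j. w k s * star (w j s))"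
      unfolding b(4)[OF rep[OF that(2)]] w_def N_def that(3) by (simp add: sum_distrib_left sum_distrib_right mult.assoc)
    finally show ?thesis .
  qed
  \<comment> \<open>The index \<open>t\<close> comes first in the outer product because the pairing
    of \<open>P B\<close> with an outer product reads off the transposed entry.\<close>
  define Q where "Q r s t = (SOME c. E (b r t * star (b r s)) = c *\<^sub>C p r)" for r s t
  have Q: "E (b r t * star (b r s)) = Q r s t *\<^sub>C p r" if r: "r < m" "s < nn r" "t < nn r" for r s t
  proof -
    have X: "b r t * star (b r s) \<in> M d" using b(2) r by (intro V_outer) auto
    have "b r t * star (b r s) = p r * (b r t * star (b r s)) * p r"
      using b(3)[OF r(1,3)] star_eq_timesD[OF b(3)[OF r(1,2)]] pstar[OF r(1)] by (simp add: mult.assoc flip: mult.assoc[of "p r"])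
    then have "E (b r t * star (b r s)) = p r * E (b r t * star (b r s)) * p r"
      using E_left[OF pA(1)[OF r(1)]] E_right[OF pA(1)[OF r(1)]] by metis
    moreover obtain c where "p r * E (b r t * star (b r s)) * p r = c *\<^sub>C p r"
      using schur[OF minp[OF r(1)] E_A[OF X]] by blast
    ultimately have "E (b r t * star (b r s)) = c *\<^sub>C p r" by simp
    then show ?thesis unfolding Q_def by (rule someI)
  qed
  define T where "T j = Q (rep j)" for j
  let ?B = "\<lambda>\<beta>. \<Sum>j<m. \<Sum>k<m. if rep j = rep k then
    \<beta> j k *\<^sub>C (\<Sum>s<N j. \<Sum>t<N j. T j s t *\<^sub>C (w j s * star (w k t))) else 0"
  \<comment> \<open>Between different classes the commutant has only zero corners, which makes the
    range block diagonal; inside a class the partial isometry \<open>u k * star (u j)\<close> is all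
    that survives.\<close>
  have EX: "E (w k t * star (w j s)) = (if rep j = rep k then T j s t *\<^sub>C (u k * star (u j)) else 0)"
    if jk: "j < m" "k < m" "s < N j" "t < N k" for j s k t
  proof (cases "rep j = rep k")
    case True
    have "w k t * star (w j s) = u k * (b (rep j) t * star (b (rep j) s)) * star (u j)"
      using True by (simp add: w_def mult.assoc)
    then have "E (w k t * star (w j s)) = u k * E (b (rep j) t * star (b (rep j) s)) * star (u j)"
      by (simp only: E_left[OF uA[OF jk(2)]] E_right[OF A_star[OF uA[OF jk(1)]]])
    also have "E (b (rep j) t * star (b (rep j) s)) = T j s t *\<^sub>C p (rep j)"
      unfolding T_def by (rule Q) (use jk rep True in \<open>auto simp: N_def\<close>)
    finally show ?thesis using True up[OF jk(2)] by simp
  next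
    case False
    have X: "w k t * star (w j s) \<in> M d" using wV jk by (intro V_outer) auto
    have "w k t * star (w j s) = p k * (w k t * star (w j s)) * p j"
      using pw[OF jk(2)] star_eq_timesD[OF pw[OF jk(1), of s]] pstar[OF jk(1)] by (simp add: mult.assoc flip: mult.assoc[of "p k"])
    then have "E (w k t * star (w j s)) = p k * E (w k t * star (w j s)) * p j"
      using E_left[OF pA(1)[OF jk(2)]] E_right[OF pA(1)[OF jk(1)]] by metis
    then show ?thesis using sep[OF jk(2,1) E_A[OF X]] False by simp
  qed
  have entry: "ip (w j s) (P B * w k t) = (if rep j = rep k then T j s t * tr (B * (u k * star (u j))) else 0)"
    if B: "e * B * e = B" and jk: "j < m" "k < m" "s < N j" "t < N k" for B j s k t
  proof -
    have "ip (w j s) (P B * w k t) = tr (B * E (w k t * star (w j s)))"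
      unfolding tr_outer[symmetric] tr_P tr_eBe[OF B] ..
    then show ?thesis unfolding EX[OF jk] by simp
  qed
  have expand: "B = (\<Sum>j<m. \<Sum>k<m. \<Sum>s<N j. \<Sum>t<N k. ip (w j s) (B * w k t) *\<^sub>C (w j s * star (w k t)))"
    if B: "e * B * e = B" "B \<in> M d" for B
  proof -
    have "B = (\<Sum>j<m. \<Sum>k<m. p j * B * p k)"
      by (subst B(1)[symmetric]) (simp add: esum sum_distrib_left sum_distrib_right, rule sum.swap)
    also have "\<dots> = (\<Sum>j<m. \<Sum>k<m. \<Sum>s<N j. \<Sum>t<N k. w j s * (star (w j s) * (B * w k t)) * star (w k t))"
      by (intro sum.cong refl, subst pww, simp, subst pww, simp)
        (simp add: sum_distrib_left sum_distrib_right mult.assoc, rule sum.swap)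
    also have "\<dots> = (\<Sum>j<m. \<Sum>k<m. \<Sum>s<N j. \<Sum>t<N k. ip (w j s) (B * w k t) *\<^sub>C (w j s * star (w k t)))"
      by (intro sum.cong refl outer_eq_sc[of _ d] wV V_times B) auto
    finally show ?thesis .
  qed
  have form: "B = ?B \<beta>"
    if B: "e * B * e = B" "B \<in> M d"
      and en: "\<And>j s k t. j < m \<Longrightarrow> k < m \<Longrightarrow> s < N j \<Longrightarrow> t < N k \<Longrightarrow> ip (w j s) (B * w k t) = (if rep j = rep k then T j s t * \<beta> j k else 0)"
    for B \<beta>
    by (subst expand[OF B], intro sum.cong refl)
      (auto simp: en sc_sum N_def mult.commute intro!: sum.cong sum.neutral)
  \<comment> \<open>The diagonal outer products add up to \<open>p (rep j)\<close>, which
    \<open>E\<close> fixes.\<close>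
  have T1: "(\<Sum>s<N j. T j s s) = 1" if "j < m" for j
  proof -
    let ?r = "rep j"
    have r: "?r < m" using rep that by blast
    have "(\<Sum>s<N j. T j s s) *\<^sub>C p ?r = (\<Sum>s<nn ?r. E (b ?r s * star (b ?r s)))"
      unfolding sc_sum_left N_def T_def by (intro sum.cong refl) (simp add: Q r)
    also have "\<dots> = E (p ?r)" by (simp add: E_sum b(4)[OF r])
    also have "E (p ?r) = E (p ?r * idm d)" using pA(4)[OF r] by simp
    also have "\<dots> = p ?r * e" by (simp only: E_left[OF pA(1)[OF r]] E_idm)
    also have "\<dots> = p ?r" using pA(1)[OF r] by (simp add: A_def)
    finally have "((\<Sum>s<N j. T j s s) - 1) *\<^sub>C p ?r = 0" by (simp add: sc_diff_left)
    then show ?thesis using pA(3)[OF r] by (simp add: sc_eq_0)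
  qed
  \<comment> \<open>The image of the positive matrix \<open>y * star y\<close> is a multiple of a
    nonzero projection, and its trace is a sum of squared norms; this fixes the sign of the
    multiple.\<close>
  have Tpos: "\<exists>c\<ge>0. (\<Sum>s<N j. \<Sum>t<N j. cnj (x s) * T j s t * x t) = complex_of_real c" if "j < m" for j x
  proof -
    let ?r = "rep j"
    have r: "?r < m" using rep that by blast
    define y where "y = (\<Sum>t<nn ?r. x t *\<^sub>C b ?r t)"
    define c where "c = (\<Sum>s<N j. \<Sum>t<N j. cnj (x s) * T j s t * x t)"
    have "y * star y = (\<Sum>s<nn ?r. \<Sum>t<nn ?r. (cnj (x s) * x t) *\<^sub>C (b ?r t * star (b ?r s)))"
      unfolding y_def by (simp add: sum_distrib_left sum_distrib_right sc_sum mult.commute)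
    then have "E (y * star y) = (\<Sum>s<nn ?r. \<Sum>t<nn ?r. (cnj (x s) * x t) *\<^sub>C E (b ?r t * star (b ?r s)))"
      by (simp only: E_sum E_sc)
    also have "\<dots> = (\<Sum>s<nn ?r. \<Sum>t<nn ?r. (cnj (x s) * T j s t * x t) *\<^sub>C p ?r)"
      by (intro sum.cong refl) (simp add: Q r T_def mult_ac)
    also have "\<dots> = c *\<^sub>C p ?r" unfolding c_def N_def by (simp only: sc_sum_left)
    finally have "tr (E (y * star y)) = c * complex_of_real (nsq (p ?r))"
      by (simp add: tr_proj_nsq[OF pA(2)[OF r]])
    moreover have "tr (E (y * star y)) = (\<Sum>a<n. ip (star y * L a) (star y * L a))"
      by (simp add: E_def ip_def mult.assoc)
    ultimately have "c * complex_of_real (nsq (p ?r)) = complex_of_real (\<Sum>a<n. nsq (star y * L a))"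
      by (simp add: ip_self)
    then have "c = complex_of_real ((\<Sum>a<n. nsq (star y * L a)) / nsq (p ?r))"
      using pA(3)[OF r] by (simp add: field_simps)
    moreover have "(\<Sum>a<n. nsq (star y * L a)) / nsq (p ?r) \<ge> 0" by (simp add: sum_nonneg)
    ultimately show ?thesis unfolding c_def by blast
  qed
  have range: "P B = B \<longleftrightarrow> (\<exists>\<beta>. B = ?B \<beta>)" if B: "B \<in> M d" for B
  proof
    assume PB: "P B = B"
    have eB: "e * B * e = B" using ePe[of B] PB by simp
    have "ip (w j s) (B * w k t) = (if rep j = rep k then T j s t * tr (B * (u k * star (u j))) else 0)"
      if "j < m" "k < m" "s < N j" "t < N k" for j s k t using entry[OF eB that] PB by simp
    from form[OF eB B this] show "\<exists>\<beta>. B = ?B \<beta>" by (intro exI)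
  next
    assume "\<exists>\<beta>. B = ?B \<beta>"
    then obtain \<beta> where \<beta>: "B = ?B \<beta>" by blast
    have ew: "e * w j s = w j s" if "j < m" for j s
    proof -
      have "e * p j = p j" using pA(1)[OF that] by (simp add: A_def)
      then show ?thesis using pw[OF that] by (metis mult.assoc)
    qed
    have we: "star (w j s) * e = star (w j s)" if "j < m" for j s
      using star_eq_timesD[OF ew[OF that]] by simp
    have ewwe: "e * (w j s * star (w k t)) * e = w j s * star (w k t)" if "j < m" "k < m" for j s k t
      using ew[OF that(1)] we[OF that(2)] by (metis mult.assoc)
    have eB: "e * B * e = B"
      unfolding \<beta> by (simp add: sum_distrib_left sum_distrib_right if_distrib[of "\<lambda>x. e * x"] if_distrib[of "\<lambda>x. x * e"] ewwe cong: if_cong)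
    have enB: "ip (w j s) (B * w k t) = (if rep j = rep k then T j s t * \<beta> j k else 0)"
      if jk: "j < m" "k < m" "s < N j" "t < N k" for j s k t
    proof -
      have ips: "ip (w j s) (w j' s' * star (w k' t') * w k t) = (if j' = j then if k' = k then if s' = s then if t' = t then 1 else 0 else 0 else 0 else 0)"
        if "j' < m" "k' < m" "s' < N j'" "t' < N k'" for j' k' s' t'
        using that jk by (auto simp: outer_apply[of _ d] wV orth)
      have "ip (w j s) (B * w k t) = (\<Sum>j'<m. \<Sum>k'<m. if rep j' = rep k' then
        \<beta> j' k' * (\<Sum>s'<N j'. \<Sum>t'<N j'. T j' s' t' * ip (w j s) (w j' s' * star (w k' t') * w k t)) else 0)"
        unfolding \<beta> by (simp add: sum_distrib_right if_distrib[of "\<lambda>x. x * _"] if_distrib[of "ip _"] cong: if_cong)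
      also have "\<dots> = (\<Sum>j'<m. \<Sum>k'<m. if rep j' = rep k' then
        \<beta> j' k' * (\<Sum>s'<N j'. \<Sum>t'<N j'. T j' s' t' * (if j' = j then if k' = k then if s' = s then if t' = t then 1 else 0 else 0 else 0 else 0)) else 0)"
        by (intro sum.cong if_cong refl arg_cong2[where f = "(*)"] ips) (auto simp: N_def)
      also have "\<dots> = (\<Sum>j'<m. \<Sum>k'<m. if k' = k then (if j' = j then (if rep j = rep k then T j s t * \<beta> j k else 0) else 0) else 0)"
      proof (intro sum.cong refl)
        fix j' k' assume "j' \<in> {..<m}" "k' \<in> {..<m}"
        have "(\<Sum>s'<N j. \<Sum>t'<N j. T j s' t' * (if s' = s then if t' = t then 1 else 0 else 0)) =
            (\<Sum>s'<N j. if s' = s then (\<Sum>t'<N j. if t' = t then T j s' t' else 0) else 0)"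
          by (intro sum.cong refl) (auto simp: if_distrib[of "\<lambda>x. _ * x"] cong: if_cong)
        also have "\<dots> = T j s t" if "rep j = rep k" using jk that by (simp add: N_def)
        finally show "(if rep j' = rep k' then \<beta> j' k' * (\<Sum>s'<N j'. \<Sum>t'<N j'. T j' s' t' *
            (if j' = j then if k' = k then if s' = s then if t' = t then 1 else 0 else 0 else 0 else 0)) else 0) =
          (if k' = k then (if j' = j then (if rep j = rep k then T j s t * \<beta> j k else 0) else 0) else 0)"
          by (cases "j' = j"; cases "k' = k") auto
      qed
      also have "\<dots> = (if rep j = rep k then T j s t * \<beta> j k else 0)" using jk by simp
      finally show ?thesis .
    qed
    \<comment> \<open>Because \<open>T j\<close> has trace one, the coefficient of a block is
      recovered by pairing with the partial isometry between \<open>j\<close> and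
      \<open>k\<close>.\<close>
    have trB: "tr (B * (u k * star (u j))) = \<beta> j k" if jk: "j < m" "k < m" "rep j = rep k" for j k
    proof -
      have "tr (B * (u k * star (u j))) = (\<Sum>s<N j. ip (w j s) (B * w k s))"
        unfolding ukj[OF jk] sum_distrib_left tr_sum tr_outer ..
      also have "\<dots> = (\<Sum>s<N j. T j s s * \<beta> j k)"
        using jk by (intro sum.cong refl) (auto simp: enB N_def)
      also have "\<dots> = \<beta> j k" by (simp add: T1[OF jk(1)] flip: sum_distrib_right)
      finally show ?thesis .
    qed
    have "ip (w j s) (P B * w k t) = (if rep j = rep k then T j s t * \<beta> j k else 0)"
      if "j < m" "k < m" "s < N j" "t < N k" for j s k t
      using entry[OF eB that] trB that by simp
    from form[OF ePe P_M[OF B] this] show "P B = B" using \<beta> by simp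
  qed
  have "block_data d P m rep N w T"
    unfolding block_data_def by (intro conjI allI impI ballI range rep wV orth T1 Tpos) (simp_all add: N_def T_def)
  then show ?thesis by blast
qed

end

section \<open>Matrices of fixed size and Kraus operators\<close>

lift_definition fm :: "complex mat \<Rightarrow> fmat" is
  "\<lambda>A i j. if i < dim_row A \<and> j < dim_col A then A $$ (i,j) else 0"
proof -
  fix A :: "complex mat"
  show "\<exists>N. in_dim N (\<lambda>i j. if i < dim_row A \<and> j < dim_col A then A $$ (i,j) else 0)"
    by (rule exI[of _ "max (dim_row A) (dim_col A)"]) (auto simp: in_dim_def)
qed

text \<open>Truncation to the upper left corner: inverse to \<open>fm\<close> between
  \<open>M d\<close> and \<open>carrier_mat d d\<close>, and lossy outside
  \<open>M d\<close>.\<close>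

definition toM :: "nat \<Rightarrow> fmat \<Rightarrow> complex mat" where "toM d X = mat d d (\<lambda>(i,j). ent X i j)"

lemma toM_carrier [simp]: "toM d X \<in> carrier_mat d d" by (simp add: toM_def)
lemma toM_dim [simp]: "dim_row (toM d X) = d" "dim_col (toM d X) = d" by (simp_all add: toM_def)
lemma toM_index [simp]: "i < d \<Longrightarrow> j < d \<Longrightarrow> toM d X $$ (i,j) = ent X i j" by (simp add: toM_def)
lemma ent_fm: "ent (fm A) i j = (if i < dim_row A \<and> j < dim_col A then A $$ (i,j) else 0)"
  by (simp add: fm.rep_eq)
lemma fm_M [simp]: "A \<in> carrier_mat d d \<Longrightarrow> fm A \<in> M d" by (rule M_I) (auto simp: ent_fm)
lemma fm_toM [simp]: "X \<in> M d \<Longrightarrow> fm (toM d X) = X"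
  by (rule M_eqI[of _ d]) (auto simp: ent_fm)
lemma toM_fm [simp]: "A \<in> carrier_mat d d \<Longrightarrow> toM d (fm A) = A"
  by (rule eq_matI) (auto simp: ent_fm)
lemma fm_eq: "A \<in> carrier_mat d d \<Longrightarrow> B \<in> carrier_mat d d \<Longrightarrow> fm A = fm B \<longleftrightarrow> A = B"
  by (metis toM_fm)
lemma fm_add: "A \<in> carrier_mat d d \<Longrightarrow> B \<in> carrier_mat d d \<Longrightarrow> fm (A + B) = fm A + fm B"
  by (rule fmat_eqI) (auto simp: ent_fm)
lemma fm_smult: "fm (c \<cdot>\<^sub>m A) = c *\<^sub>C fm A"
  by (rule fmat_eqI) (auto simp: ent_fm)
lemma fm_zero [simp]: "fm (0\<^sub>m d d) = 0"
  by (rule fmat_eqI) (auto simp: ent_fm)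
lemma fm_one: "fm (1\<^sub>m d) = idm d"
  by (rule fmat_eqI) (auto simp: ent_fm ent_idm)
lemma fm_madj: "fm (madj A) = star (fm A)"
  by (rule fmat_eqI) (auto simp: ent_fm madj_def)
lemma fm_mult: "A \<in> carrier_mat d d \<Longrightarrow> B \<in> carrier_mat d d \<Longrightarrow> fm (A * B) = fm A * fm B"
proof (rule M_eqI[of _ d])
  fix i j assume *: "A \<in> carrier_mat d d" "B \<in> carrier_mat d d" "i < d" "j < d"
  then show "ent (fm (A * B)) i j = ent (fm A * fm B) i j"
    by (auto simp: ent_times[of _ d] ent_fm scalar_prod_def atLeast0LessThan intro!: sum.cong)
qed auto
lemma mtrace_fm: "A \<in> carrier_mat d d \<Longrightarrow> mtrace A = tr (fm A)"
  by (auto simp: mtrace_def tr_eq[of _ d] ent_fm intro!: sum.cong)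
lemma toM_add: "toM d (X + Y) = toM d X + toM d Y" by (rule eq_matI) auto
lemma toM_sc: "toM d (c *\<^sub>C X) = c \<cdot>\<^sub>m toM d X" by (rule eq_matI) auto

section \<open>Positive semidefinite matrices and their rank-one pieces\<close>

definition ppos :: "nat \<Rightarrow> fmat \<Rightarrow> bool" where
  "ppos d X \<longleftrightarrow> X \<in> M d \<and> (\<forall>v\<in>V d. \<exists>c\<ge>0. ip v (X * v) = complex_of_real c)"

lemma ppos_form: "ppos d X \<Longrightarrow> v \<in> V d \<Longrightarrow> \<exists>c\<ge>0. ip v (X * v) = complex_of_real c"
  unfolding ppos_def by (elim conjE bspec)

definition colv :: "nat \<Rightarrow> (nat \<Rightarrow> complex) \<Rightarrow> fmat" where "colv d f = (\<Sum>i<d. f i *\<^sub>C mu i 0)"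

lemma colv_V [simp]: "colv d f \<in> V d" unfolding colv_def by (intro V_sum V_sc V_mu) auto
lemma ent_colv: "ent (colv d f) i j = (if i < d \<and> j = 0 then f i else 0)"
proof -
  have "ent (colv d f) i j = (\<Sum>k<d. if k = i then if j = 0 then f k else 0 else 0)"
    unfolding colv_def ent_sum by (intro sum.cong) auto
  then show ?thesis by simp
qed
lemma colv_ent: "v \<in> V d \<Longrightarrow> colv d (\<lambda>i. ent v i 0) = v"
  by (rule fmat_eqI) (auto simp: ent_colv V_ent)

lemma ip_mu_mult: assumes "X \<in> M d" "i < d" "j < d" shows "ip (mu i 0) (X * mu j 0) = ent X i j"
proof -
  have "ent (X * mu j 0) i 0 = (\<Sum>k<d. if k = j then ent X i k else 0)"
    unfolding ent_times[OF assms(1)] ent_mu by (intro sum.cong refl) simp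
  then show ?thesis using assms by (simp add: ip_mu)
qed

lemma ip_colv: assumes "X \<in> M d"
  shows "ip (colv d f) (X * colv d g) = (\<Sum>i<d. \<Sum>j<d. cnj (f i) * ent X i j * g j)"
  unfolding colv_def sum_distrib_left ip_simps sc_simps
  by (subst sum.swap, intro sum.cong refl) (simp add: ip_mu_mult[OF assms] sum_distrib_left mult_ac)

lemma psd_iff: "psd d A \<longleftrightarrow> A \<in> carrier_mat d d \<and> ppos d (fm A)"
proof (cases "A \<in> carrier_mat d d")
  case True
  have eq: "(\<Sum>i<d. \<Sum>j<d. cnj (f i) * A $$ (i,j) * f j) = ip (colv d f) (fm A * colv d f)" for f
    unfolding ip_colv[OF fm_M[OF True]] by (intro sum.cong refl) (use True in \<open>auto simp: ent_fm\<close>)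
  have *: "(Im z = 0 \<and> 0 \<le> Re z) = (\<exists>c\<ge>0. z = complex_of_real c)" for z
    by (auto simp: complex_eq_iff)
  have "(\<forall>f. \<exists>c\<ge>0. ip (colv d f) (fm A * colv d f) = complex_of_real c) = (\<forall>v\<in>V d. \<exists>c\<ge>0. ip v (fm A * v) = complex_of_real c)"
    by (metis colv_V colv_ent)
  then show ?thesis using True unfolding psd_def eq * ppos_def by auto
qed (auto simp: psd_def)

text \<open>Polarization: evaluating the form at \<open>Z * w\<close> plus \<open>w\<close> and at
  \<open>Z * w\<close> plus \<open>\<i> *\<^sub>C w\<close> forces the squared norm of
  \<open>Z * w\<close> to vanish.\<close>

lemma form_zero:
  assumes Z: "Z \<in> M d" and 0: "\<And>v. v \<in> V d \<Longrightarrow> ip v (Z * v) = 0"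
  shows "Z = 0"
proof -
  have "Z * w = 0" if w: "w \<in> V d" for w
  proof -
    let ?v = "Z * w"
    have v: "?v \<in> V d" using Z w by simp
    have a: "ip ?v (Z * w) + ip w (Z * ?v) = 0"
      using 0[of "?v + w"] 0[OF v] 0[OF w] v w by (simp add: distrib_left add.commute)
    have "\<i> * ip ?v (Z * w) - \<i> * ip w (Z * ?v) = 0"
      using 0[of "?v + \<i> *\<^sub>C w"] 0[OF v] 0[OF w] v w by (simp add: distrib_left)
    then have "ip ?v (Z * w) - ip w (Z * ?v) = 0" by (simp flip: right_diff_distrib)
    with a have "ip ?v ?v = 0" by (auto simp: complex_eq_iff)
    then show ?thesis by (simp only: ip_eq_0)
  qed
  then show ?thesis using M_eq_vecI[OF Z M_zero] by simp
qed

lemma ppos_star: assumes "ppos d X" shows "star X = X"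
proof -
  have X: "X \<in> M d" using assms by (simp add: ppos_def)
  have "ip v ((X - star X) * v) = 0" if "v \<in> V d" for v
  proof -
    obtain c where c: "ip v (X * v) = complex_of_real c" using ppos_form[OF assms \<open>v \<in> V d\<close>] by blast
    have "ip v (star X * v) = cnj (ip v (X * v))" by (simp add: ip_times[symmetric] ip_cnj)
    then show ?thesis using c by (simp add: left_diff_distrib)
  qed
  then have "X - star X = 0" by (rule form_zero[OF M_diff[OF X M_star[OF X]]])
  then show ?thesis by simp
qed

lemma ppos_diag: assumes "ppos d X" "i < d" shows "\<exists>c\<ge>0. ent X i i = complex_of_real c"
  using assms ip_mu_mult[of X d i i] V_mu[of i d] unfolding ppos_def by metis

lemma ppos_diag_0: assumes "ppos d X" "\<And>i. i < d \<Longrightarrow> ent X i i = 0" shows "X = 0"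
proof -
  have X: "X \<in> M d" using assms by (simp add: ppos_def)
  show ?thesis
  proof (rule M_eqI[OF X M_zero])
    fix i j assume ij: "i < d" "j < d"
    define z where "z = ent X i j"
    have zj: "ent X j i = cnj z" using arg_cong[OF ppos_star[OF assms(1)], of "\<lambda>X. ent X j i"] by (simp add: z_def)
    \<comment> \<open>As the diagonal vanishes, the form at this vector is minus twice the squared
      modulus of the entry \<open>z\<close>, which positivity allows only for
      \<open>z = 0\<close>.\<close>
    define v where "v = mu i 0 + (- cnj z) *\<^sub>C mu j 0"
    have "v \<in> V d" using ij by (simp add: v_def)
    then obtain c where c: "c \<ge> 0" "ip v (X * v) = complex_of_real c" using ppos_form[OF assms(1)] by blast
    have "ip v (X * v) = - (2 * (z * cnj z))"
      using ij assms(2) zj by (simp add: v_def distrib_left ip_mu_mult[OF X] z_def[symmetric] algebra_simps)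
    also have "z * cnj z = complex_of_real ((cmod z)\<^sup>2)" by (rule complex_norm_square[symmetric])
    finally have "complex_of_real c = complex_of_real (- (2 * (cmod z)\<^sup>2))" using c(2) by simp
    then have "c = - (2 * (cmod z)\<^sup>2)" using of_real_eq_iff by blast
    then have "z = 0" using c(1) by simp
    then show "ent X i j = ent 0 i j" by (simp add: z_def)
  qed
qed

lemma ppos_schur_complement:
  assumes "ppos d X" "k < d" "ent X k k \<noteq> 0"
  shows "ppos d (X - (1 / ent X k k) *\<^sub>C (X * mu k 0 * star (X * mu k 0)))"
proof -
  have X: "X \<in> M d" using assms by (simp add: ppos_def)
  have sX: "star X = X" by (rule ppos_star[OF assms(1)])
  obtain a where a: "a \<ge> 0" "ent X k k = complex_of_real a" using ppos_diag[OF assms(1,2)] by blast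
  have a0: "a > 0" using a assms(3) by auto
  define x where "x = mu k 0"
  define y where "y = X * x"
  have xy: "x \<in> V d" "y \<in> V d" using assms(2) X by (auto simp: x_def y_def)
  have "\<exists>c\<ge>0. ip v ((X - (1 / ent X k k) *\<^sub>C (y * star y)) * v) = complex_of_real c" if v: "v \<in> V d" for v
  proof -
    \<comment> \<open>Completing the square: this \<open>t\<close> minimizes the form of
      \<open>X\<close> along \<open>v - t *\<^sub>C x\<close>, and the minimum is the form of the
      Schur complement at \<open>v\<close>.\<close>
    define t where "t = ip y v / complex_of_real a"
    have 1: "ip x (X * v) = ip y v" unfolding y_def ip_times sX ..
    have 2: "ip v (X * x) = cnj (ip y v)" unfolding y_def[symmetric] by (simp add: ip_cnj)
    have 3: "ip x (X * x) = complex_of_real a" using ip_mu_mult[OF X assms(2,2)] a by (simp add: x_def)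
    have "ip (v - t *\<^sub>C x) (X * (v - t *\<^sub>C x)) = ip v (X * v) - t * cnj (ip y v)"
      using a0 by (simp add: right_diff_distrib 1 2 3 t_def field_simps)
    also have "\<dots> = ip v ((X - (1 / ent X k k) *\<^sub>C (y * star y)) * v)"
      by (simp add: left_diff_distrib outer_apply[OF xy(2,2) v] a(2) t_def ip_cnj)
    finally show ?thesis using ppos_form[OF assms(1) V_diff[OF v V_sc[OF xy(1)]], of t] by simp
  qed
  then show ?thesis using xy X by (auto simp: ppos_def x_def[symmetric] y_def[symmetric] simp del: star_times)
qed

text \<open>Cholesky elimination. Each Schur complement splits off one rank-one term and has fewer
  nonzero diagonal entries; when none is left, \<open>ppos_diag_0\<close> applies.\<close>

lemma ppos_decomp:
  assumes "ppos d X"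
  shows "\<exists>(n::nat) v. (\<forall>a<n. v a \<in> V d) \<and> X = (\<Sum>a<n. v a * star (v a))"
  using assms
proof (induction "card {k. k < d \<and> ent X k k \<noteq> 0}" arbitrary: X rule: less_induct)
  case less
  show ?case
  proof (cases "\<forall>k<d. ent X k k = 0")
    case True
    then show ?thesis using ppos_diag_0[OF less.prems] by (intro exI[of _ 0]) auto
  next
    case False
    then obtain k where k: "k < d" "ent X k k \<noteq> 0" by blast
    have X: "X \<in> M d" using less.prems by (simp add: ppos_def)
    obtain a where a: "a \<ge> 0" "ent X k k = complex_of_real a" using ppos_diag[OF less.prems k(1)] by blast
    have a0: "a > 0" using a k(2) by auto
    define y where "y = X * mu k 0"
    define X' where "X' = X - (1 / ent X k k) *\<^sub>C (y * star y)"
    have X': "ppos d X'" unfolding X'_def y_def by (rule ppos_schur_complement[OF less.prems k])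
    have yV: "y \<in> V d" using X k by (simp add: y_def)
    have yy: "ent (y * star y) l l = complex_of_real ((cmod (ent y l 0))\<^sup>2)" for l
    proof -
      have "ent (y * star y) l l = (\<Sum>i<Suc d. ent y l i * cnj (ent y l i))"
        by (subst ent_times[of _ "Suc d"]) (use yV in \<open>auto intro: M_mono[of _ d]\<close>)
      also have "\<dots> = (\<Sum>i<Suc d. if i = 0 then ent y l 0 * cnj (ent y l 0) else 0)"
        by (intro sum.cong refl) (auto simp: V_ent[OF yV])
      also have "\<dots> = ent y l 0 * cnj (ent y l 0)" by (simp add: sum.delta del: sum.lessThan_Suc)
      finally show ?thesis by (simp only: complex_norm_square)
    qed
    have yk: "ent y k 0 = complex_of_real a" using ip_mu_mult[OF X k(1,1)] by (simp add: ip_mu y_def a)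
    have "ent X' k k = 0" unfolding X'_def using a0 by (simp add: yy yk a power2_eq_square)
    \<comment> \<open>A vanishing diagonal entry stays zero: the new one is at most 0 by its formula
      and at least 0 by positivity.\<close>
    moreover have "ent X' l l = 0" if l: "l < d" "ent X l l = 0" for l
    proof -
      obtain c where c: "c \<ge> 0" "ent X' l l = complex_of_real c" using ppos_diag[OF X' l(1)] by blast
      have "ent X' l l = complex_of_real (- ((cmod (ent y l 0))\<^sup>2 / a))"
        using l(2) by (simp add: X'_def yy a)
      then have "c = - ((cmod (ent y l 0))\<^sup>2 / a)" using c(2) of_real_eq_iff by metis
      then have "c \<le> 0" using a0 by simp
      with c show ?thesis by simp
    qed
    ultimately have "{l. l < d \<and> ent X' l l \<noteq> 0} \<subset> {l. l < d \<and> ent X l l \<noteq> 0}" using k by blast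
    then have "card {l. l < d \<and> ent X' l l \<noteq> 0} < card {l. l < d \<and> ent X l l \<noteq> 0}" by (intro psubset_card_mono) auto
    from less.hyps[OF this X'] obtain n :: nat and v where v: "\<forall>a<n. v a \<in> V d" "X' = (\<Sum>a<n. v a * star (v a))" by blast
    define z where "z = complex_of_real (1 / sqrt a) *\<^sub>C y"
    have "complex_of_real (1 / sqrt a) * complex_of_real (1 / sqrt a) = complex_of_real (1 / a)"
      using a0 by (simp only: of_real_mult[symmetric]) simp
    then have "z * star z = (1 / ent X k k) *\<^sub>C (y * star y)"
      by (simp add: z_def a)
    then have "X = X' + z * star z" by (simp add: X'_def)
    then have "X = (\<Sum>i<Suc n. (v(n := z)) i * star ((v(n := z)) i))" using v(2) by simp
    moreover have "\<forall>i<Suc n. (v(n := z)) i \<in> V d" using v(1) yV by (auto simp: less_Suc_eq z_def)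
    ultimately show ?thesis by blast
  qed
qed

lemma ppos_outer: "y \<in> V d \<Longrightarrow> ppos d (y * star y)"
proof -
  assume y: "y \<in> V d"
  have "ip v (y * star y * v) = complex_of_real ((cmod (ip y v))\<^sup>2)" if "v \<in> V d" for v
  proof -
    have "ip v (y * star y * v) = ip y v * cnj (ip y v)"
      by (simp add: outer_apply[OF y y that] ip_cnj)
    then show ?thesis by (simp only: complex_norm_square)
  qed
  then show ?thesis using y unfolding ppos_def by (meson V_outer zero_le_power2)
qed

section \<open>Linear maps on \<open>M d\<close> and their Kraus form\<close>

definition lft :: "nat \<Rightarrow> (complex mat \<Rightarrow> complex mat) \<Rightarrow> fmat \<Rightarrow> fmat" where
  "lft d \<phi> X = fm (\<phi> (toM d X))"

lemma lin_map_carrier: "lin_map d \<phi> \<Longrightarrow> A \<in> carrier_mat d d \<Longrightarrow> \<phi> A \<in> carrier_mat d d"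
  by (simp add: lin_map_def)
lemma lft_M: "lin_map d \<phi> \<Longrightarrow> lft d \<phi> X \<in> M d"
  unfolding lft_def by (rule fm_M[OF lin_map_carrier[OF _ toM_carrier]])
lemma lft_add: "lin_map d \<phi> \<Longrightarrow> lft d \<phi> (X + Y) = lft d \<phi> X + lft d \<phi> Y"
  unfolding lft_def toM_add by (subst fm_add[of _ d, symmetric]) (auto simp: lin_map_def)
lemma lft_sc: "lin_map d \<phi> \<Longrightarrow> lft d \<phi> (c *\<^sub>C X) = c *\<^sub>C lft d \<phi> X"
  unfolding lft_def toM_sc by (subst fm_smult[symmetric]) (auto simp: lin_map_def)
lemma lft_zero: "lin_map d \<phi> \<Longrightarrow> lft d \<phi> 0 = 0"
  using lft_sc[of d \<phi> 0 0] by simp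
lemma lft_sum: "lin_map d \<phi> \<Longrightarrow> lft d \<phi> (\<Sum>i\<in>I. f i) = (\<Sum>i\<in>I. lft d \<phi> (f i))"
  by (induction I rule: infinite_finite_induct) (auto simp: lft_zero lft_add)
lemma lft_diff: "lin_map d \<phi> \<Longrightarrow> lft d \<phi> (X - Y) = lft d \<phi> X - lft d \<phi> Y"
  using lft_add[of d \<phi> "X - Y" Y] by simp
lemma lft_expand: "lin_map d \<phi> \<Longrightarrow> X \<in> M d \<Longrightarrow> lft d \<phi> X = (\<Sum>a<d. \<Sum>b<d. ent X a b *\<^sub>C lft d \<phi> (mu a b))"
  by (subst M_expand) (auto simp: lft_sum lft_sc)
lemma lft_comp: "lin_map d \<psi> \<Longrightarrow> lft d (\<lambda>A. \<phi> (\<psi> A)) X = lft d \<phi> (lft d \<psi> X)"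
  by (simp add: lft_def lin_map_carrier)
lemma lft_fm: "A \<in> carrier_mat d d \<Longrightarrow> lft d \<phi> (fm A) = fm (\<phi> A)"
  by (simp add: lft_def)
lemma lft_ent: "lin_map d \<phi> \<Longrightarrow> A \<in> carrier_mat d d \<Longrightarrow> i < d \<Longrightarrow> j < d \<Longrightarrow> ent (lft d \<phi> (fm A)) i j = \<phi> A $$ (i,j)"
  using lin_map_carrier[of d \<phi> A] by (simp add: lft_fm ent_fm)

lemma ent_outer: assumes "y \<in> V d" "z \<in> V d" shows "ent (y * star z) i j = ent y i 0 * cnj (ent z j 0)"
proof -
  have "ent (y * star z) i j = (\<Sum>k<Suc d. if k = 0 then ent y i 0 * cnj (ent z j 0) else 0)"
    unfolding ent_times[OF M_mono[OF V_M[OF assms(1)], of "Suc d", simplified]]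
    by (intro sum.cong refl) (auto simp: V_ent[OF assms(1)])
  then show ?thesis by (simp add: sum.delta del: sum.lessThan_Suc)
qed

lemma enc_less: "i < m \<Longrightarrow> a < k \<Longrightarrow> i * k + a < m * (k::nat)"
proof -
  assume "i < m" "a < k"
  then have "i * k + a < Suc i * k" "Suc i * k \<le> m * k" by (auto intro: mult_le_mono1 simp del: mult_Suc simp: Suc_leI) (simp add: mult_Suc)
  then show ?thesis by linarith
qed
lemma enc_eq: "a < k \<Longrightarrow> b < k \<Longrightarrow> i * k + a = j * k + b \<longleftrightarrow> i = j \<and> a = (b::nat)"
  by (metis add_diff_cancel_left' div_mult_self3 div_less add.right_neutral mod_less mod_mult_self3 less_nat_zero_code)

lemma ent_mult_mu: assumes "X \<in> M d" "a < d" shows "ent (X * mu a 0) r 0 = ent X r a"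
proof -
  have "ent (X * mu a 0) r 0 = (\<Sum>k<d. if k = a then ent X r k else 0)"
    unfolding ent_times[OF assms(1)] ent_mu by (intro sum.cong refl) simp
  then show ?thesis using assms by simp
qed

lemma ent_KmuK: assumes "K \<in> M d" "a < d" "b < d"
  shows "ent (K * mu a b * star K) r c = ent K r a * cnj (ent K c b)"
proof -
  have "K * mu a b * star K = (K * mu a 0) * star (K * mu b 0)"
    by (subst mu_outer) (simp add: mult.assoc)
  then show ?thesis using assms by (simp add: ent_outer[of _ d] ent_mult_mu del: star_times)
qed

text \<open>Choi's argument: the channel tensor identity maps the positive matrix
  \<open>Om * star Om\<close> to a positive one, and the vectors of a rank-one decomposition of the
  image, reshaped into square matrices, are the Kraus operators.\<close>

lemma kraus_ex:
  assumes "quantum_channel d \<psi>"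
  shows "\<exists>n K. kraus d n K \<and> (\<forall>X\<in>M d. lft d \<psi> X = kraus.P n K X)"
proof -
  have lin: "lin_map d \<psi>" and cp: "completely_positive d \<psi>" and tp: "trace_preserving d \<psi>"
    using assms by (auto simp: quantum_channel_def)
  \<comment> \<open>The unnormalized maximally entangled vector: with pairs \<open>(i, a)\<close>
    encoded as \<open>i * d + a\<close>, it is 1 exactly on the pairs \<open>(i, i)\<close>.\<close>
  define Om where "Om = colv (d*d) (\<lambda>r. if r div d = r mod d then 1 else 0)"
  define X0 where "X0 = toM (d*d) (Om * star Om)"
  have OmV: "Om \<in> V (d*d)" by (simp add: Om_def)
  have "psd (d*d) X0" unfolding psd_iff X0_def using ppos_outer[OF OmV] OmV by (simp add: ppos_def)
  then have "psd (d*d) (ampl d d \<psi> X0)" using cp by (simp add: completely_positive_def)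
  then obtain n :: nat and v where v: "\<And>\<alpha>. \<alpha> < n \<Longrightarrow> v \<alpha> \<in> V (d*d)"
    and C: "fm (ampl d d \<psi> X0) = (\<Sum>\<alpha><n. v \<alpha> * star (v \<alpha>))"
    unfolding psd_iff using ppos_decomp by blast
  have X0: "mat d d (\<lambda>(i,j). X0 $$ (i*d+a, j*d+b)) = toM d (mu a b)" if "a < d" "b < d" for a b
    by (rule eq_matI) (use that OmV in \<open>auto simp: X0_def enc_less ent_outer[of _ "d*d"] Om_def ent_colv\<close>)
  define K where "K \<alpha> = fm (mat d d (\<lambda>(r,a). ent (v \<alpha>) (r*d+a) 0))" for \<alpha>
  have KM: "K \<alpha> \<in> M d" for \<alpha> unfolding K_def by (rule fm_M) simp
  have K: "ent (K \<alpha>) r a = ent (v \<alpha>) (r*d+a) 0" if "r < d" "a < d" for \<alpha> r a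
    using that by (simp add: K_def ent_fm)
  have mu: "lft d \<psi> (mu a b) = (\<Sum>\<alpha><n. K \<alpha> * mu a b * star (K \<alpha>))" if ab: "a < d" "b < d" for a b
  proof (rule M_eqI[OF lft_M[OF lin]])
    show "(\<Sum>\<alpha><n. K \<alpha> * mu a b * star (K \<alpha>)) \<in> M d" using ab by (intro M_sum M_times M_star KM mu_M)
    fix r c assume rc: "r < d" "c < d"
    have "\<psi> (toM d (mu a b)) \<in> carrier_mat d d" by (rule lin_map_carrier[OF lin toM_carrier])
    then have "ent (lft d \<psi> (mu a b)) r c = \<psi> (toM d (mu a b)) $$ (r, c)"
      using rc by (simp add: lft_def ent_fm)
    also have "\<dots> = ent (fm (ampl d d \<psi> X0)) (r*d+a) (c*d+b)"
      using rc ab by (simp add: ent_fm ampl_def enc_less X0)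
    also have "\<dots> = (\<Sum>\<alpha><n. ent (K \<alpha>) r a * cnj (ent (K \<alpha>) c b))"
      unfolding C ent_sum using rc ab by (intro sum.cong refl) (simp add: ent_outer[OF v v] K)
    also have "\<dots> = ent (\<Sum>\<alpha><n. K \<alpha> * mu a b * star (K \<alpha>)) r c"
      unfolding ent_sum by (intro sum.cong refl ent_KmuK[OF KM ab, symmetric])
    finally show "ent (lft d \<psi> (mu a b)) r c = ent (\<Sum>\<alpha><n. K \<alpha> * mu a b * star (K \<alpha>)) r c" .
  qed
  have P: "lft d \<psi> X = (\<Sum>\<alpha><n. K \<alpha> * X * star (K \<alpha>))" if X: "X \<in> M d" for X
  proof -
    have "lft d \<psi> X = (\<Sum>a<d. \<Sum>b<d. \<Sum>\<alpha><n. ent X a b *\<^sub>C (K \<alpha> * mu a b * star (K \<alpha>)))"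
      unfolding lft_expand[OF lin X] by (intro sum.cong refl) (simp add: mu sc_sum)
    also have "\<dots> = (\<Sum>a<d. \<Sum>\<alpha><n. \<Sum>b<d. ent X a b *\<^sub>C (K \<alpha> * mu a b * star (K \<alpha>)))"
      by (rule sum.cong[OF refl]) (rule sum.swap)
    also have "\<dots> = (\<Sum>\<alpha><n. \<Sum>a<d. \<Sum>b<d. ent X a b *\<^sub>C (K \<alpha> * mu a b * star (K \<alpha>)))"
      by (rule sum.swap)
    also have "\<dots> = (\<Sum>\<alpha><n. K \<alpha> * (\<Sum>a<d. \<Sum>b<d. ent X a b *\<^sub>C mu a b) * star (K \<alpha>))"
      by (simp add: sum_distrib_left sum_distrib_right)
    finally show ?thesis by (simp add: M_expand[OF X, symmetric])
  qed
  have trP: "tr (lft d \<psi> X) = tr X" if "X \<in> M d" for X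
    using tp that mtrace_fm[of "\<psi> (toM d X)" d] mtrace_fm[of "toM d X" d] lin_map_carrier[OF lin]
    by (simp add: lft_def trace_preserving_def)
  \<comment> \<open>The defect of the completeness relation; by trace preservation its pairing with
    every matrix vanishes, in particular with its own adjoint.\<close>
  define Z where "Z = (\<Sum>\<alpha><n. star (K \<alpha>) * K \<alpha>) - idm d"
  have ZM: "star Z \<in> M d" unfolding Z_def by (intro M_star M_diff M_sum M_times KM idm_M)
  have "tr (K \<alpha> * X * star (K \<alpha>)) = tr (X * (star (K \<alpha>) * K \<alpha>))" for \<alpha> X
    using tr_comm[of "K \<alpha>" "X * star (K \<alpha>)"] by (simp add: mult.assoc)
  then have "tr (star Z * (\<Sum>\<alpha><n. star (K \<alpha>) * K \<alpha>)) = tr (star Z * idm d)"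
    using trP[OF ZM] ZM by (simp only: P[OF ZM] tr_sum sum_distrib_left idm_right)
  then have "ip Z Z = 0"
    unfolding ip_def by (subst (2) Z_def) (simp only: right_diff_distrib tr_diff, simp)
  then have "Z = 0" by (simp only: ip_eq_0)
  then have kr: "kraus d n K" using KM by unfold_locales (simp_all add: Z_def)
  show ?thesis using kr P by (intro exI[of _ n] exI[of _ K] conjI ballI) (simp_all add: kraus.P_def[OF kr])
qed

section \<open>Limits of powers of a channel\<close>

text \<open>Only the entries below \<open>d\<close> of the limit are constrained, exactly as in
  \<open>power_limit_point\<close>; the dimension of the matrix \<open>\<psi> A\<close> is left open
  and has to be supplied where it matters.\<close>

definition conv :: "nat \<Rightarrow> (nat \<Rightarrow> complex mat \<Rightarrow> complex mat) \<Rightarrow> (complex mat \<Rightarrow> complex mat) \<Rightarrow> bool" where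
  "conv d f \<psi> \<longleftrightarrow> (\<forall>A\<in>carrier_mat d d. \<forall>i<d. \<forall>j<d. (\<lambda>n. f n A $$ (i,j)) \<longlonglongrightarrow> \<psi> A $$ (i,j))"

lemma convD: "conv d f \<psi> \<Longrightarrow> A \<in> carrier_mat d d \<Longrightarrow> i < d \<Longrightarrow> j < d \<Longrightarrow> (\<lambda>n. f n A $$ (i,j)) \<longlonglongrightarrow> \<psi> A $$ (i,j)"
  by (simp add: conv_def)

lemma conv_subseq: "conv d f \<psi> \<Longrightarrow> strict_mono r \<Longrightarrow> conv d (\<lambda>n. f (r n)) \<psi>"
  unfolding conv_def using LIMSEQ_subseq_LIMSEQ[of "\<lambda>n. f n _ $$ (_,_)", unfolded comp_def] by blast

lemma conv_unique:
  assumes "conv d f \<psi>" "conv d f \<chi>" "A \<in> carrier_mat d d" "\<psi> A \<in> carrier_mat d d" "\<chi> A \<in> carrier_mat d d"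
  shows "\<psi> A = \<chi> A"
proof (rule eq_matI)
  fix i j assume "i < dim_row (\<chi> A)" "j < dim_col (\<chi> A)"
  then have "i < d" "j < d" using assms(5) by auto
  then show "\<psi> A $$ (i,j) = \<chi> A $$ (i,j)"
    by (intro LIMSEQ_unique[OF convD[OF assms(1,3)] convD[OF assms(2,3)]])
qed (use assms in auto)

lemma qc_lin: "quantum_channel d \<phi> \<Longrightarrow> lin_map d \<phi>" by (simp add: quantum_channel_def)

lemma qc_carrier: "quantum_channel d \<phi> \<Longrightarrow> A \<in> carrier_mat d d \<Longrightarrow> \<phi> A \<in> carrier_mat d d"
  by (simp add: quantum_channel_def lin_map_def)

lemma ampl_id: assumes "X \<in> carrier_mat (d*k) (d*k)" shows "ampl d k (\<lambda>A. A) X = X"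
proof (rule eq_matI)
  fix r c assume "r < dim_row X" "c < dim_col X"
  then have *: "r < d * k" "c < d * k" using assms by auto
  then have "r div k < d" "c div k < d" by (auto simp: less_mult_imp_div_less)
  then show "ampl d k (\<lambda>A. A) X $$ (r,c) = X $$ (r,c)" using * by (simp add: ampl_def)
qed (use assms in \<open>auto simp: ampl_def\<close>)

lemma ampl_comp:
  assumes "\<And>A. A \<in> carrier_mat d d \<Longrightarrow> g A \<in> carrier_mat d d"
  shows "ampl d k (\<lambda>A. f (g A)) X = ampl d k f (ampl d k g X)"
proof (rule eq_matI)
  fix r c assume "r < dim_row (ampl d k f (ampl d k g X))" "c < dim_col (ampl d k f (ampl d k g X))"
  then have rc: "r < d * k" "c < d * k" by (auto simp: ampl_def)
  then have "k > 0" by (cases k) auto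
  then have k: "r mod k < k" "c mod k < k" by simp_all
  have car: "g (mat d d (\<lambda>(i,j). X $$ (i*k + r mod k, j*k + c mod k))) \<in> carrier_mat d d"
    by (intro assms) simp
  have "mat d d (\<lambda>(i,j). ampl d k g X $$ (i*k + r mod k, j*k + c mod k)) = g (mat d d (\<lambda>(i,j). X $$ (i*k + r mod k, j*k + c mod k)))"
    by (rule eq_matI) (use car k in \<open>auto simp: ampl_def enc_less\<close>)
  then show "ampl d k (\<lambda>A. f (g A)) X $$ (r,c) = ampl d k f (ampl d k g X) $$ (r,c)"
    using rc by (simp add: ampl_def[of d k f] ampl_def[of d k "\<lambda>A. f (g A)"])
qed (auto simp: ampl_def)

lemma qc_id: "quantum_channel d (\<lambda>A. A)"
  unfolding quantum_channel_def lin_map_def completely_positive_def trace_preserving_def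
  by (auto simp: psd_def ampl_id)

lemma qc_comp: "quantum_channel d f \<Longrightarrow> quantum_channel d g \<Longrightarrow> quantum_channel d (\<lambda>A. f (g A))"
  unfolding quantum_channel_def completely_positive_def trace_preserving_def
  by (auto simp: lin_map_def ampl_comp)

lemma qc_pow: "quantum_channel d \<phi> \<Longrightarrow> quantum_channel d (\<phi> ^^ n)"
proof (induction n)
  case 0
  then show ?case using qc_id by (simp add: id_def)
next
  case (Suc n)
  then show ?case using qc_comp[OF Suc.prems Suc.IH[OF Suc.prems]] by (simp add: comp_def)
qed

text \<open>In Kraus form the entry is a sum of products of entries of the
  \<open>K \<alpha>\<close>. The completeness relation bounds the sums of squares by 1, and the
  inequality between geometric and arithmetic mean does the rest.\<close>

lemma qc_bound:
  assumes "quantum_channel d \<psi>" "a < d" "b < d" "i < d" "j < d"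
  shows "cmod (ent (lft d \<psi> (mu a b)) i j) \<le> 1"
proof -
  obtain n K where kr: "kraus d n K" and P: "\<And>X. X \<in> M d \<Longrightarrow> lft d \<psi> X = kraus.P n K X"
    using kraus_ex[OF assms(1)] by blast
  have KM: "K \<alpha> \<in> M d" if "\<alpha> < n" for \<alpha> using kraus.K_M[OF kr that] .
  have le1: "(\<Sum>\<alpha><n. (cmod (ent (K \<alpha>) i a))\<^sup>2) \<le> 1" if "i < d" "a < d" for i a
  proof -
    have "ent (\<Sum>\<alpha><n. star (K \<alpha>) * K \<alpha>) a a = (\<Sum>\<alpha><n. \<Sum>k<d. complex_of_real ((cmod (ent (K \<alpha>) k a))\<^sup>2))"
      unfolding ent_sum
    proof (intro sum.cong refl)
      fix \<alpha> assume "\<alpha> \<in> {..<n}"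
      then have "star (K \<alpha>) \<in> M d" using KM by simp
      from ent_times[OF this] show "ent (star (K \<alpha>) * K \<alpha>) a a = (\<Sum>k<d. complex_of_real ((cmod (ent (K \<alpha>) k a))\<^sup>2))"
        by (simp only: complex_norm_square ent_star mult.commute)
    qed
    then have "complex_of_real (\<Sum>\<alpha><n. \<Sum>k<d. (cmod (ent (K \<alpha>) k a))\<^sup>2) = complex_of_real 1"
      using that by (simp add: kraus.K_tp[OF kr] ent_idm)
    then have "(\<Sum>\<alpha><n. \<Sum>k<d. (cmod (ent (K \<alpha>) k a))\<^sup>2) = 1" using of_real_eq_iff by blast
    moreover have "(\<Sum>\<alpha><n. (cmod (ent (K \<alpha>) i a))\<^sup>2) \<le> (\<Sum>\<alpha><n. \<Sum>k<d. (cmod (ent (K \<alpha>) k a))\<^sup>2)"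
      by (intro sum_mono member_le_sum) (use that in auto)
    ultimately show ?thesis by simp
  qed
  have "ent (lft d \<psi> (mu a b)) i j = (\<Sum>\<alpha><n. ent (K \<alpha>) i a * cnj (ent (K \<alpha>) j b))"
    using assms KM by (simp add: P kraus.P_def[OF kr] ent_KmuK[of _ d])
  also have "cmod \<dots> \<le> (\<Sum>\<alpha><n. cmod (ent (K \<alpha>) i a * cnj (ent (K \<alpha>) j b)))" by (rule norm_sum)
  also have "\<dots> \<le> (\<Sum>\<alpha><n. ((cmod (ent (K \<alpha>) i a))\<^sup>2 + (cmod (ent (K \<alpha>) j b))\<^sup>2) / 2)"
  proof (intro sum_mono)
    fix \<alpha>
    have "0 \<le> (cmod (ent (K \<alpha>) i a) - cmod (ent (K \<alpha>) j b))\<^sup>2" by simp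
    then show "cmod (ent (K \<alpha>) i a * cnj (ent (K \<alpha>) j b)) \<le> ((cmod (ent (K \<alpha>) i a))\<^sup>2 + (cmod (ent (K \<alpha>) j b))\<^sup>2) / 2"
      by (simp add: norm_mult power2_diff)
  qed
  also have "\<dots> = ((\<Sum>\<alpha><n. (cmod (ent (K \<alpha>) i a))\<^sup>2) + (\<Sum>\<alpha><n. (cmod (ent (K \<alpha>) j b))\<^sup>2)) / 2"
    by (simp only: sum_divide_distrib[symmetric] sum.distrib)
  also have "\<dots> \<le> 1" using le1[OF assms(4,2)] le1[OF assms(5,3)] by simp
  finally show ?thesis .
qed

section \<open>Sequential compactness of the set of channels\<close>

lemma bounded_complex_subseq:
  assumes "\<And>n. cmod (f n) \<le> B"
  shows "\<exists>r. strict_mono (r :: nat \<Rightarrow> nat) \<and> (\<exists>l. (\<lambda>n. f (r n)) \<longlonglongrightarrow> l)"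
proof -
  obtain r where r: "strict_mono r" "monoseq (\<lambda>n. Re (f (r n)))" using seq_monosub[of "\<lambda>n. Re (f n)"] by blast
  obtain r' where r': "strict_mono r'" "monoseq (\<lambda>n. Im (f (r (r' n))))" using seq_monosub[of "\<lambda>n. Im (f (r n))"] by blast
  have "Bseq (\<lambda>n. Re (f (r n)))" using assms abs_Re_le_cmod order_trans by (intro BseqI'[of _ B]) (auto, blast)
  then obtain x where x: "(\<lambda>n. Re (f (r n))) \<longlonglongrightarrow> x" using Bseq_monoseq_convergent[OF _ r(2)] by (auto simp: convergent_def)
  have "Bseq (\<lambda>n. Im (f (r (r' n))))" using assms abs_Im_le_cmod order_trans by (intro BseqI'[of _ B]) (auto, blast)
  then obtain y where y: "(\<lambda>n. Im (f (r (r' n)))) \<longlonglongrightarrow> y" using Bseq_monoseq_convergent[OF _ r'(2)] by (auto simp: convergent_def)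
  have x': "(\<lambda>n. Re (f (r (r' n)))) \<longlonglongrightarrow> x" using LIMSEQ_subseq_LIMSEQ[OF x r'(1)] by (simp add: comp_def)
  have "(\<lambda>n. f (r (r' n))) \<longlonglongrightarrow> Complex x y" using x' y by (simp add: tendsto_complex_iff)
  moreover have "strict_mono (\<lambda>n. r (r' n))" using r r' by (simp add: strict_mono_def)
  ultimately show ?thesis by (intro exI[of _ "\<lambda>n. r (r' n)"]) auto
qed

lemma bounded_family_subseq:
  assumes "finite I" "\<And>n i. i \<in> I \<Longrightarrow> cmod (f n i) \<le> B"
  shows "\<exists>r. strict_mono (r :: nat \<Rightarrow> nat) \<and> (\<forall>i\<in>I. \<exists>l. (\<lambda>n. f (r n) i) \<longlonglongrightarrow> l)"
  using assms
proof (induction I rule: finite_induct)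
  case empty
  show ?case by (intro exI[of _ "\<lambda>n. n"]) (simp add: strict_mono_def)
next
  case (insert i I)
  then obtain r where r: "strict_mono r" "\<forall>i\<in>I. \<exists>l. (\<lambda>n. f (r n) i) \<longlonglongrightarrow> l" by blast
  obtain r' l where r': "strict_mono r'" "(\<lambda>n. f (r (r' n)) i) \<longlonglongrightarrow> l"
    using bounded_complex_subseq[of "\<lambda>n. f (r n) i" B] insert.prems by blast
  have "\<exists>l. (\<lambda>n. f (r (r' n)) i') \<longlonglongrightarrow> l" if "i' \<in> I" for i'
    using r(2) that LIMSEQ_subseq_LIMSEQ[OF _ r'(1)] by (fastforce simp: comp_def)
  moreover have "strict_mono (\<lambda>n. r (r' n))" using r r' by (simp add: strict_mono_def)
  ultimately show ?case using r'(2) by (intro exI[of _ "\<lambda>n. r (r' n)"]) auto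
qed

lemma lin_entry:
  assumes "lin_map d f" "B \<in> carrier_mat d d" "i < d" "j < d"
  shows "f B $$ (i,j) = (\<Sum>a<d. \<Sum>b<d. B $$ (a,b) * ent (lft d f (mu a b)) i j)"
proof -
  have "f B $$ (i,j) = ent (lft d f (fm B)) i j" using assms by (simp add: lft_ent)
  also have "\<dots> = (\<Sum>a<d. \<Sum>b<d. B $$ (a,b) * ent (lft d f (mu a b)) i j)"
    unfolding lft_expand[OF assms(1) fm_M[OF assms(2)]] ent_sum ent_sc
    using assms(2) by (intro sum.cong refl) (simp add: ent_fm)
  finally show ?thesis .
qed

text \<open>Linearity, positivity of a quadratic form and preservation of the trace are closed under
  entrywise limits; \<open>car\<close> supplies the dimension that convergence leaves open.\<close>

lemma conv_qc:
  assumes f: "\<And>n. quantum_channel d (f n)" and c: "conv d f \<psi>"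
    and car: "\<And>A. A \<in> carrier_mat d d \<Longrightarrow> \<psi> A \<in> carrier_mat d d"
  shows "quantum_channel d \<psi>"
proof -
  have fl: "lin_map d (f n)" for n using f qc_lin by blast
  have fc: "f n A \<in> carrier_mat d d" if "A \<in> carrier_mat d d" for n A using qc_carrier[OF f that] .
  have "lin_map d \<psi>" unfolding lin_map_def
  proof (intro conjI ballI allI)
    fix A B :: "complex mat" assume AB: "A \<in> carrier_mat d d" "B \<in> carrier_mat d d"
    show "\<psi> (A + B) = \<psi> A + \<psi> B"
    proof (rule eq_matI)
      fix i j assume "i < dim_row (\<psi> A + \<psi> B)" "j < dim_col (\<psi> A + \<psi> B)"
      then have ij: "i < d" "j < d" using car[OF AB(2)] by auto
      have "f n (A + B) = f n A + f n B" for n using fl[of n] AB by (simp add: lin_map_def)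
      then have "f n (A + B) $$ (i,j) = f n A $$ (i,j) + f n B $$ (i,j)" for n
        using fc[OF AB(2), of n] ij by simp
      then have "(\<lambda>n. f n A $$ (i,j) + f n B $$ (i,j)) \<longlonglongrightarrow> \<psi> (A + B) $$ (i,j)"
        using convD[OF c, of "A + B" i j] AB ij by simp
      moreover have "(\<lambda>n. f n A $$ (i,j) + f n B $$ (i,j)) \<longlonglongrightarrow> \<psi> A $$ (i,j) + \<psi> B $$ (i,j)"
        by (intro tendsto_add convD[OF c] AB ij)
      ultimately show "\<psi> (A + B) $$ (i,j) = (\<psi> A + \<psi> B) $$ (i,j)"
        using LIMSEQ_unique car[OF AB(1)] car[OF AB(2)] ij by auto
    qed (use AB car[of A] car[of B] car[of "A + B"] in auto)
  next
    fix A :: "complex mat" and c' assume A: "A \<in> carrier_mat d d"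
    show "\<psi> (c' \<cdot>\<^sub>m A) = c' \<cdot>\<^sub>m \<psi> A"
    proof (rule eq_matI)
      fix i j assume "i < dim_row (c' \<cdot>\<^sub>m \<psi> A)" "j < dim_col (c' \<cdot>\<^sub>m \<psi> A)"
      then have ij: "i < d" "j < d" using car[OF A] by auto
      have "f n (c' \<cdot>\<^sub>m A) = c' \<cdot>\<^sub>m f n A" for n using fl[of n] A by (simp add: lin_map_def)
      then have "f n (c' \<cdot>\<^sub>m A) $$ (i,j) = c' * f n A $$ (i,j)" for n
        using fc[OF A, of n] ij by simp
      then have "(\<lambda>n. c' * f n A $$ (i,j)) \<longlonglongrightarrow> \<psi> (c' \<cdot>\<^sub>m A) $$ (i,j)"
        using convD[OF c, of "c' \<cdot>\<^sub>m A" i j] A ij by simp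
      moreover have "(\<lambda>n. c' * f n A $$ (i,j)) \<longlonglongrightarrow> c' * \<psi> A $$ (i,j)"
        by (intro tendsto_mult tendsto_const convD[OF c] A ij)
      ultimately show "\<psi> (c' \<cdot>\<^sub>m A) $$ (i,j) = (c' \<cdot>\<^sub>m \<psi> A) $$ (i,j)"
        using LIMSEQ_unique car[OF A] ij by auto
    qed (use car[of A] car[of "c' \<cdot>\<^sub>m A"] A in auto)
  qed (rule car)
  moreover have "completely_positive d \<psi>" unfolding completely_positive_def
  proof (intro allI impI)
    fix k X assume X: "psd (d * k) X"
    have lim: "(\<lambda>n. ampl d k (f n) X $$ (r,c)) \<longlonglongrightarrow> ampl d k \<psi> X $$ (r,c)" if rc: "r < d*k" "c < d*k" for r c
    proof -
      have "r div k < d" "c div k < d" using rc by (auto simp: less_mult_imp_div_less)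
      then have "(\<lambda>n. f n (mat d d (\<lambda>(i,j). X $$ (i*k + r mod k, j*k + c mod k))) $$ (r div k, c div k)) \<longlonglongrightarrow>
        \<psi> (mat d d (\<lambda>(i,j). X $$ (i*k + r mod k, j*k + c mod k))) $$ (r div k, c div k)"
        by (intro convD[OF \<open>conv d f \<psi>\<close>]) auto
      then show ?thesis using rc by (simp add: ampl_def)
    qed
    show "psd (d * k) (ampl d k \<psi> X)" unfolding psd_def
    proof (intro conjI allI)
      show "ampl d k \<psi> X \<in> carrier_mat (d*k) (d*k)" by (simp add: ampl_def)
      fix v :: "nat \<Rightarrow> complex"
      let ?F = "\<lambda>n. \<Sum>i<d*k. \<Sum>j<d*k. cnj (v i) * ampl d k (f n) X $$ (i,j) * v j"
      let ?L = "\<Sum>i<d*k. \<Sum>j<d*k. cnj (v i) * ampl d k \<psi> X $$ (i,j) * v j"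
      have L: "?F \<longlonglongrightarrow> ?L" by (intro tendsto_sum tendsto_mult tendsto_const lim) auto
      have ps: "psd (d*k) (ampl d k (f n) X)" for n
        using f[of n] X by (simp add: quantum_channel_def completely_positive_def)
      then have F: "Im (?F n) = 0" "Re (?F n) \<ge> 0" for n unfolding psd_def by blast+
      have "(\<lambda>n. Im (?F n)) \<longlonglongrightarrow> Im ?L" by (rule tendsto_Im[OF L])
      then show "Im ?L = 0" unfolding F(1) by (rule LIMSEQ_unique[OF _ tendsto_const])
      have "(\<lambda>n. Re (?F n)) \<longlonglongrightarrow> Re ?L" by (rule tendsto_Re[OF L])
      then show "Re ?L \<ge> 0" by (rule LIMSEQ_le_const) (use F(2) in blast)
    qed
  qed
  moreover have "trace_preserving d \<psi>" unfolding trace_preserving_def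
  proof
    fix A :: "complex mat" assume A: "A \<in> carrier_mat d d"
    have "mtrace (f n A) = mtrace A" for n using f[of n] A by (simp add: quantum_channel_def trace_preserving_def)
    then have "(\<Sum>i<d. f n A $$ (i,i)) = mtrace A" for n
      using mtrace_def[of "f n A"] carrier_matD(1)[OF fc[OF A, of n]] by simp
    moreover have "(\<lambda>n. \<Sum>i<d. f n A $$ (i,i)) \<longlonglongrightarrow> (\<Sum>i<d. \<psi> A $$ (i,i))"
      by (intro tendsto_sum convD[OF c] A) auto
    ultimately have "(\<lambda>n. mtrace A) \<longlonglongrightarrow> (\<Sum>i<d. \<psi> A $$ (i,i))" by simp
    then have "mtrace A = (\<Sum>i<d. \<psi> A $$ (i,i))" by (rule LIMSEQ_unique[OF tendsto_const])
    then show "mtrace (\<psi> A) = mtrace A" using car[OF A] by (simp add: mtrace_def)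
  qed
  ultimately show ?thesis by (simp add: quantum_channel_def)
qed

text \<open>A channel is determined by its entries on matrix units, a finite family bounded by 1
  uniformly over all channels; the limits of the entries define the limit map by linearity.\<close>

lemma qc_compact:
  assumes f: "\<And>n. quantum_channel d (f n)"
  shows "\<exists>r \<psi>. strict_mono (r :: nat \<Rightarrow> nat) \<and> quantum_channel d \<psi> \<and> conv d (\<lambda>n. f (r n)) \<psi>"
proof -
  define F where "F n i = (case i of (a,b,i,j) \<Rightarrow> ent (lft d (f n) (mu a b)) i j)" for n i
  obtain r where r: "strict_mono r" "\<And>i. i \<in> {..<d} \<times> {..<d} \<times> {..<d} \<times> {..<d} \<Longrightarrow> \<exists>l. (\<lambda>n. F (r n) i) \<longlonglongrightarrow> l"
    using bounded_family_subseq[of "{..<d} \<times> {..<d} \<times> {..<d} \<times> {..<d}" F 1]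
    by (auto simp: F_def qc_bound[OF f] split: prod.splits)
  then obtain l where l: "\<And>i. i \<in> {..<d} \<times> {..<d} \<times> {..<d} \<times> {..<d} \<Longrightarrow> (\<lambda>n. F (r n) i) \<longlonglongrightarrow> l i"
    by metis
  define \<psi> where "\<psi> (A :: complex mat) = mat d d (\<lambda>(i,j). \<Sum>a<d. \<Sum>b<d. A $$ (a,b) * l (a,b,i,j))" for A
  have c: "conv d (\<lambda>n. f (r n)) \<psi>" unfolding conv_def
  proof (intro ballI allI impI)
    fix A :: "complex mat" and i j assume A: "A \<in> carrier_mat d d" and ij: "i < d" "j < d"
    have "(\<lambda>n. \<Sum>a<d. \<Sum>b<d. A $$ (a,b) * F (r n) (a,b,i,j)) \<longlonglongrightarrow> (\<Sum>a<d. \<Sum>b<d. A $$ (a,b) * l (a,b,i,j))"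
      by (intro tendsto_sum tendsto_mult tendsto_const l) (use ij in auto)
    then show "(\<lambda>n. f (r n) A $$ (i,j)) \<longlonglongrightarrow> \<psi> A $$ (i,j)"
      using ij by (simp add: \<psi>_def lin_entry[OF qc_lin[OF f] A ij] F_def)
  qed
  have "quantum_channel d \<psi>"
    by (rule conv_qc[OF f c]) (simp add: \<psi>_def)
  with r(1) c show ?thesis by blast
qed

text \<open>Joint continuity of composition: by linearity an entry of the composite is a finite sum
  of products of entries of \<open>g n A\<close> with entries of \<open>f n\<close> on matrix
  units.\<close>

lemma conv_comp:
  assumes f: "\<And>n. quantum_channel d (f n)" and g: "\<And>n. quantum_channel d (g n)"
    and \<psi>: "quantum_channel d \<psi>" and \<chi>: "quantum_channel d \<chi>"
    and c: "conv d f \<psi>" "conv d g \<chi>"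
  shows "conv d (\<lambda>n A. f n (g n A)) (\<lambda>A. \<psi> (\<chi> A))"
  unfolding conv_def
proof (intro ballI allI impI)
  fix A :: "complex mat" and i j assume A: "A \<in> carrier_mat d d" and ij: "i < d" "j < d"
  have "ent (lft d h (mu a b)) i j = h (toM d (mu a b)) $$ (i,j)" if "quantum_channel d h" for h a b
    using qc_carrier[OF that toM_carrier, of "mu a b"] ij by (simp add: lft_def ent_fm)
  then have "(\<lambda>n. ent (lft d (f n) (mu a b)) i j) \<longlonglongrightarrow> ent (lft d \<psi> (mu a b)) i j" for a b
    using convD[OF c(1) toM_carrier ij, of "mu a b"] f \<psi> by simp
  then have "(\<lambda>n. \<Sum>a<d. \<Sum>b<d. g n A $$ (a,b) * ent (lft d (f n) (mu a b)) i j) \<longlonglongrightarrow>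
    (\<Sum>a<d. \<Sum>b<d. \<chi> A $$ (a,b) * ent (lft d \<psi> (mu a b)) i j)"
    by (intro tendsto_sum tendsto_mult convD[OF c(2)] A) auto
  then show "(\<lambda>n. f n (g n A) $$ (i,j)) \<longlonglongrightarrow> \<psi> (\<chi> A) $$ (i,j)"
    unfolding lin_entry[OF qc_lin[OF f] qc_carrier[OF g A] ij] lin_entry[OF qc_lin[OF \<psi>] qc_carrier[OF \<chi> A] ij] .
qed

text \<open>If the exponents grow fast enough, powers with exponents a(n+1) - 2 a(n) accumulate at an
  inverse Q of the limit point on the asymptotic subspace.\<close>
lemma limit_point_inverse:
  assumes \<phi>: "quantum_channel d \<phi>" and s: "strict_mono s" and \<psi>: "quantum_channel d \<psi>"
    and c: "conv d (\<lambda>n. \<phi> ^^ s n) \<psi>"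
  obtains Q t where "quantum_channel d Q" "strict_mono (t :: nat \<Rightarrow> nat)" "conv d (\<lambda>n. \<phi> ^^ t n) (\<lambda>A. \<psi> (Q A))"
    "\<And>A. A \<in> carrier_mat d d \<Longrightarrow> \<psi> (Q (\<psi> (Q A))) = \<psi> (Q A)"
proof -
  \<comment> \<open>Since \<open>s n\<close> is at least \<open>n\<close>, this recursion makes
    \<open>a (Suc n)\<close> at least \<open>3 * a n + 1\<close>. The truncated subtractions in
    \<open>b\<close> and \<open>t\<close> are then genuine, and \<open>t\<close> is strictly
    increasing.\<close>
  define g where "g = rec_nat 0 (\<lambda>n x. 3 * s x + 1 + x)"
  have g: "g (Suc n) = 3 * s (g n) + 1 + g n" for n by (simp add: g_def)
  have gm: "strict_mono g" by (rule strict_mono_Suc_iff[THEN iffD2]) (simp add: g)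
  define a where "a n = s (g n)" for n
  have a: "a (Suc n) \<ge> 3 * a n + 1" for n
    using seq_suble[OF s, of "g (Suc n)"] unfolding a_def by (simp add: g)
  have am: "strict_mono a" using s gm by (simp add: a_def strict_mono_def)
  have ca: "conv d (\<lambda>n. \<phi> ^^ a n) \<psi>" using conv_subseq[OF c gm] by (simp add: a_def)
  obtain r Q where r: "strict_mono r" and Q: "quantum_channel d Q"
    and cb: "conv d (\<lambda>n. \<phi> ^^ (a (Suc (r n)) - 2 * a (r n))) Q"
    using qc_compact[of d "\<lambda>n. \<phi> ^^ (a (Suc n) - 2 * a n)"] qc_pow[OF \<phi>] by blast
  define b where "b n = a (Suc (r n)) - 2 * a (r n)" for n
  define t where "t n = a (Suc (r n)) - a (r n)" for n
  have cb: "conv d (\<lambda>n. \<phi> ^^ b n) Q" using cb by (simp add: b_def)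
  have car: "conv d (\<lambda>n. \<phi> ^^ a (r n)) \<psi>" using conv_subseq[OF ca r] .
  have "strict_mono (\<lambda>n. Suc (r n))" using r by (simp add: strict_mono_def)
  from conv_subseq[OF ca this] have cas: "conv d (\<lambda>n. \<phi> ^^ a (Suc (r n))) \<psi>" .
  have t1: "t n = b n + a (r n)" and t2: "t n = a (r n) + b n" and t3: "a (Suc (r n)) = t n + a (r n)" for n
    using a[of "r n"] by (auto simp: t_def b_def)
  have tm: "strict_mono t" unfolding strict_mono_Suc_iff
  proof
    fix n
    have "a (Suc (r n)) \<le> a (r (Suc n))"
      using r am by (simp add: strict_mono_less_eq Suc_leI strict_mono_less)
    then show "t n < t (Suc n)" using a[of "r (Suc n)"] unfolding t_def by linarith
  qed
  note pw = qc_pow[OF \<phi>]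
  \<comment> \<open>Reading \<open>t\<close> as \<open>b + a\<close> and as \<open>a + b\<close>
    shows that \<open>Q\<close> and \<open>\<psi>\<close> commute; adding \<open>a\<close> once more
    returns to the exponents of \<open>\<psi>\<close>, which gives
    \<open>Q (\<psi> (\<psi> A)) = \<psi> A\<close>.\<close>
  have ct1: "conv d (\<lambda>n. \<phi> ^^ t n) (\<lambda>A. Q (\<psi> A))"
    using conv_comp[OF pw pw Q \<psi> cb car] by (simp add: t1 funpow_add comp_def)
  have ct2: "conv d (\<lambda>n. \<phi> ^^ t n) (\<lambda>A. \<psi> (Q A))"
    using conv_comp[OF pw pw \<psi> Q car cb] by (simp add: t2 funpow_add comp_def)
  have ct3: "conv d (\<lambda>n. \<phi> ^^ a (Suc (r n))) (\<lambda>A. Q (\<psi> (\<psi> A)))"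
    using conv_comp[OF pw pw qc_comp[OF Q \<psi>] \<psi> ct1 car] by (simp add: t3 funpow_add comp_def)
  note cr = qc_carrier[OF Q] qc_carrier[OF \<psi>]
  have com: "Q (\<psi> A) = \<psi> (Q A)" if "A \<in> carrier_mat d d" for A
    using conv_unique[OF ct1 ct2 that] cr that by simp
  have inv: "Q (\<psi> (\<psi> A)) = \<psi> A" if "A \<in> carrier_mat d d" for A
    using conv_unique[OF ct3 cas that] cr that by simp
  have "\<psi> (Q (\<psi> (Q A))) = \<psi> (Q A)" if "A \<in> carrier_mat d d" for A
    using com[of "\<psi> (Q A)"] inv[of "Q A"] cr that by simp
  with that[OF Q tm ct2] show ?thesis by blast
qed

section \<open>The phase subspace\<close>

lemma lft_pow:
  assumes "quantum_channel d \<phi>" "X \<in> M d"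
  shows "lft d (\<phi> ^^ n) X = (lft d \<phi> ^^ n) X"
proof (induction n)
  case (Suc n)
  have "lft d (\<phi> ^^ Suc n) X = lft d \<phi> (lft d (\<phi> ^^ n) X)"
    using lft_comp[OF qc_lin[OF qc_pow[OF assms(1)]], of \<phi> n X] by (simp add: comp_def)
  also have "\<dots> = (lft d \<phi> ^^ Suc n) X" using Suc by simp
  finally show ?case .
qed (use assms in \<open>simp add: lft_def\<close>)

lemma conv_ent:
  assumes f: "\<And>n. quantum_channel d (f n)" and P: "quantum_channel d P" and c: "conv d f P"
  shows "(\<lambda>n. ent (lft d (f n) X) i j) \<longlonglongrightarrow> ent (lft d P X) i j"
proof (cases "i < d \<and> j < d")
  case True
  then have ij: "i < d" "j < d" by auto
  have e: "ent (lft d h X) i j = h (toM d X) $$ (i,j)" if "quantum_channel d h" for h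
    using qc_carrier[OF that toM_carrier, of X] ij by (simp add: lft_def ent_fm)
  show ?thesis unfolding e[OF f] e[OF P] by (rule convD[OF c toM_carrier ij])
next
  case False
  have "ent (lft d h X) i j = 0" if "quantum_channel d h" for h
    using M_ent[OF lft_M[OF qc_lin[OF that]]] False by (meson not_le)
  then show ?thesis using f P by simp
qed

definition phases :: "nat \<Rightarrow> (complex mat \<Rightarrow> complex mat) \<Rightarrow> fmat set" where
  "phases d \<phi> = {X \<in> M d. X \<noteq> 0 \<and> (\<exists>c. cmod c = 1 \<and> lft d \<phi> X = c *\<^sub>C X)}"

lemma phase_point_iff:
  assumes "lin_map d \<phi>"
  shows "phase_point d \<phi> Z \<longleftrightarrow> Z \<in> carrier_mat d d \<and> fm Z \<in> phases d \<phi>"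
proof (cases "Z \<in> carrier_mat d d")
  case True
  have 1: "(Z \<noteq> 0\<^sub>m d d) = (fm Z \<noteq> 0)" using fm_eq[OF True, of "0\<^sub>m d d"] by simp
  have 2: "(\<phi> Z = c \<cdot>\<^sub>m Z) = (lft d \<phi> (fm Z) = c *\<^sub>C fm Z)" for c
    using fm_eq[OF lin_map_carrier[OF assms True], of "c \<cdot>\<^sub>m Z"] True by (simp add: lft_fm fm_smult)
  have "(\<exists>\<theta>::real. lft d \<phi> (fm Z) = exp (\<i> * complex_of_real \<theta>) *\<^sub>C fm Z) \<longleftrightarrow>
    (\<exists>c. cmod c = 1 \<and> lft d \<phi> (fm Z) = c *\<^sub>C fm Z)"
  proof
    assume "\<exists>c. cmod c = 1 \<and> lft d \<phi> (fm Z) = c *\<^sub>C fm Z"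
    then obtain c where c: "cmod c = 1" "lft d \<phi> (fm Z) = c *\<^sub>C fm Z" by blast
    then have "c = exp (\<i> * complex_of_real (Arg c))"
      using rcis_cmod_Arg[of c] by (simp add: rcis_def cis_conv_exp)
    with c(2) show "\<exists>\<theta>::real. lft d \<phi> (fm Z) = exp (\<i> * complex_of_real \<theta>) *\<^sub>C fm Z" by metis
  next
    assume "\<exists>\<theta>::real. lft d \<phi> (fm Z) = exp (\<i> * complex_of_real \<theta>) *\<^sub>C fm Z"
    then obtain \<theta> :: real where "lft d \<phi> (fm Z) = exp (\<i> * complex_of_real \<theta>) *\<^sub>C fm Z" by blast
    then show "\<exists>c. cmod c = 1 \<and> lft d \<phi> (fm Z) = c *\<^sub>C fm Z"
      by (intro exI[of _ "exp (\<i> * complex_of_real \<theta>)"]) simp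
  qed
  then show ?thesis unfolding phase_point_def phases_def 1 2 using True by simp
qed (simp add: phase_point_def)

definition phspan :: "nat \<Rightarrow> (complex mat \<Rightarrow> complex mat) \<Rightarrow> fmat set" where
  "phspan d \<phi> = {X. \<exists>(n::nat) c Z. (\<forall>i<n. Z i \<in> phases d \<phi>) \<and> X = (\<Sum>i<n. c i *\<^sub>C Z i)}"

lemma phase_subspace_iff:
  assumes "lin_map d \<phi>"
  shows "A \<in> phase_subspace d \<phi> \<longleftrightarrow> A \<in> carrier_mat d d \<and> fm A \<in> phspan d \<phi>"
proof
  assume "A \<in> phase_subspace d \<phi>"
  then obtain n c Z where Z: "\<forall>i<(n::nat). phase_point d \<phi> (Z i)" and A: "A = mat d d (\<lambda>rc. \<Sum>i<n. c i * Z i $$ rc)"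
    by (auto simp: phase_subspace_def)
  have Zc: "Z i \<in> carrier_mat d d" "fm (Z i) \<in> phases d \<phi>" if "i < n" for i using Z that phase_point_iff[OF assms] by auto
  have "fm A = (\<Sum>i<n. c i *\<^sub>C fm (Z i))"
  proof (rule M_eqI[of _ d])
    show "fm A \<in> M d" by (rule fm_M) (simp add: A)
    show "(\<Sum>i<n. c i *\<^sub>C fm (Z i)) \<in> M d" using Zc by (intro M_sum M_sc fm_M) auto
    fix i j assume "i < d" "j < d"
    then show "ent (fm A) i j = ent (\<Sum>i<n. c i *\<^sub>C fm (Z i)) i j"
      using carrier_matD[OF Zc(1)] by (simp add: ent_fm A)
  qed
  then show "A \<in> carrier_mat d d \<and> fm A \<in> phspan d \<phi>" using Zc A unfolding phspan_def
    by (auto intro!: exI[of _ n] exI[of _ c] exI[of _ "\<lambda>i. fm (Z i)"])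
next
  assume A: "A \<in> carrier_mat d d \<and> fm A \<in> phspan d \<phi>"
  then obtain n c Z where Z: "\<forall>i<(n::nat). Z i \<in> phases d \<phi>" and fA: "fm A = (\<Sum>i<n. c i *\<^sub>C Z i)"
    by (auto simp: phspan_def)
  have ZM: "Z i \<in> M d" if "i < n" for i using Z that by (auto simp: phases_def)
  have "A = mat d d (\<lambda>rc. \<Sum>i<n. c i * toM d (Z i) $$ rc)"
  proof (rule eq_matI)
    fix i j assume "i < dim_row (mat d d (\<lambda>rc. \<Sum>i<n. c i * toM d (Z i) $$ rc))" "j < dim_col (mat d d (\<lambda>rc. \<Sum>i<n. c i * toM d (Z i) $$ rc))"
    then have ij: "i < d" "j < d" by auto
    then have "A $$ (i,j) = ent (fm A) i j" using A carrier_matD[of A d d] by (simp add: ent_fm)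
    then show "A $$ (i,j) = mat d d (\<lambda>rc. \<Sum>i<n. c i * toM d (Z i) $$ rc) $$ (i,j)"
      using ij by (simp add: fA)
  qed (use A in auto)
  moreover have "\<forall>i<n. phase_point d \<phi> (toM d (Z i))"
    unfolding phase_point_iff[OF assms] using Z ZM by auto
  ultimately show "A \<in> phase_subspace d \<phi>" unfolding phase_subspace_def
    by (intro CollectI exI[of _ n] exI[of _ c] exI[of _ "\<lambda>i. toM d (Z i)"] conjI)
qed

lemma sum_lessThan_add: "(\<Sum>i<m+n. f i) = (\<Sum>i<m. f i) + (\<Sum>i<n. f (m + i))"
  for f :: "nat \<Rightarrow> 'a::comm_monoid_add"
  by (induction n) (simp_all add: add.assoc)

lemma phspan_csub: "csub (phspan d \<phi>)"
proof (rule csubI)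
  show "0 \<in> phspan d \<phi>" unfolding phspan_def by (auto intro!: exI[of _ 0])
next
  fix X Y assume "X \<in> phspan d \<phi>" "Y \<in> phspan d \<phi>"
  then obtain n c Z n' c' Z' where Z: "\<forall>i<(n::nat). Z i \<in> phases d \<phi>" "X = (\<Sum>i<n. c i *\<^sub>C Z i)"
    and Z': "\<forall>i<(n'::nat). Z' i \<in> phases d \<phi>" "Y = (\<Sum>i<n'. c' i *\<^sub>C Z' i)"
    unfolding phspan_def by blast
  have "X + Y = (\<Sum>i<n+n'. (if i < n then c i else c' (i - n)) *\<^sub>C (if i < n then Z i else Z' (i - n)))"
    unfolding sum_lessThan_add Z(2) Z'(2) by simp
  moreover have "\<forall>i<n+n'. (if i < n then Z i else Z' (i - n)) \<in> phases d \<phi>"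
    using Z(1) Z'(1) by auto
  ultimately show "X + Y \<in> phspan d \<phi>" unfolding phspan_def
    by (intro CollectI exI[of _ "n+n'"] exI[of _ "\<lambda>i. if i < n then c i else c' (i - n)"] exI[of _ "\<lambda>i. if i < n then Z i else Z' (i - n)"] conjI)
next
  fix e X assume "X \<in> phspan d \<phi>"
  then obtain n c Z where Z: "\<forall>i<(n::nat). Z i \<in> phases d \<phi>" "X = (\<Sum>i<n. c i *\<^sub>C Z i)"
    unfolding phspan_def by blast
  have "e *\<^sub>C X = (\<Sum>i<n. (e * c i) *\<^sub>C Z i)" unfolding Z(2) sc_sum by simp
  then show "e *\<^sub>C X \<in> phspan d \<phi>" unfolding phspan_def using Z(1)
    by (intro CollectI exI[of _ n] exI[of _ "\<lambda>i. e * c i"] exI[of _ Z] conjI)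
qed

lemma phases_phspan: "X \<in> phases d \<phi> \<Longrightarrow> X \<in> phspan d \<phi>"
  unfolding phspan_def by (intro CollectI exI[of _ 1] exI[of _ "\<lambda>_. 1"] exI[of _ "\<lambda>_. X"]) auto

text \<open>The exponents \<open>t\<close> are kept as a parameter since all spectral information is
  drawn from them: on the range of \<open>P\<close> the powers of \<open>\<phi>\<close> with these
  exponents tend to the identity.\<close>

locale asymptotic =
  fixes d :: nat and \<phi> P :: "complex mat \<Rightarrow> complex mat" and t :: "nat \<Rightarrow> nat"
  assumes qc: "quantum_channel d \<phi>" and qcP: "quantum_channel d P"
    and t: "strict_mono t" and cv: "conv d (\<lambda>n. \<phi> ^^ t n) P"
    and idP: "A \<in> carrier_mat d d \<Longrightarrow> P (P A) = P A"
begin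

abbreviation F where "F \<equiv> lft d \<phi>"
abbreviation R where "R \<equiv> lft d P"

lemmas F_lin = lft_add[OF qc_lin[OF qc]] lft_sc[OF qc_lin[OF qc]] lft_sum[OF qc_lin[OF qc]] lft_diff[OF qc_lin[OF qc]]
lemmas R_lin = lft_add[OF qc_lin[OF qcP]] lft_sc[OF qc_lin[OF qcP]] lft_sum[OF qc_lin[OF qcP]] lft_diff[OF qc_lin[OF qcP]]
lemmas F_M = lft_M[OF qc_lin[OF qc]]

lemma R_idem: "R (R X) = R X"
  using idP[of "toM d X"] qc_carrier[OF qcP, of "toM d X"] by (simp add: lft_def)

lemma lim: "X \<in> M d \<Longrightarrow> (\<lambda>n. ent ((F ^^ t n) X) i j) \<longlonglongrightarrow> ent (R X) i j"
  using conv_ent[OF qc_pow[OF qc] qcP cv, of X i j] by (simp add: lft_pow[OF qc])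

text \<open>The map \<open>P\<close> is a limit of powers of \<open>\<phi>\<close>, and composition
  with \<open>\<phi>\<close> is continuous on either side.\<close>

lemma RF: assumes X: "X \<in> M d" shows "R (F X) = F (R X)"
proof -
  have "conv d (\<lambda>n A. \<phi> ((\<phi> ^^ t n) A)) (\<lambda>A. \<phi> (P A))"
    using conv_comp[OF qc qc_pow[OF qc] qc qcP _ cv] by (simp add: conv_def)
  moreover have "conv d (\<lambda>n A. (\<phi> ^^ t n) (\<phi> A)) (\<lambda>A. P (\<phi> A))"
    using conv_comp[OF qc_pow[OF qc] qc qcP qc cv] by (simp add: conv_def)
  ultimately have "P (\<phi> (toM d X)) = \<phi> (P (toM d X))"
    using qc_carrier[OF qc] qc_carrier[OF qcP]
    by (intro conv_unique[of d "\<lambda>n A. (\<phi> ^^ t n) (\<phi> A)" "\<lambda>A. P (\<phi> A)" "\<lambda>A. \<phi> (P A)"]) (simp_all add: funpow_swap1)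
  then show ?thesis using qc_carrier[OF qc, of "toM d X"] qc_carrier[OF qcP, of "toM d X"] by (simp add: lft_def)
qed

lemma F_pow_eig: "F X = c *\<^sub>C X \<Longrightarrow> (F ^^ n) X = c ^ n *\<^sub>C X"
  by (induction n) (simp_all add: F_lin mult.commute)

lemma nonzero_entry: "X \<noteq> 0 \<Longrightarrow> \<exists>i j. ent X i j \<noteq> 0"
  by (metis ent_zero fmat_eqI)

lemma t_ge: "n \<le> t n" by (rule seq_suble[OF t])

text \<open>On a fixed point of \<open>P\<close> the numbers \<open>c ^ t n\<close> tend to 1, which
  excludes both smaller and larger moduli.\<close>

lemma eig_unimodular:
  assumes X: "X \<in> M d" "X \<noteq> 0" "R X = X" "F X = c *\<^sub>C X"
  shows "cmod c = 1"
proof -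
  obtain i j where z: "ent X i j \<noteq> 0" using nonzero_entry X(2) by blast
  have "(\<lambda>n. ent ((F ^^ t n) X) i j) \<longlonglongrightarrow> ent X i j" using lim[OF X(1), of i j] X(3) by simp
  then have "(\<lambda>n. c ^ t n * ent X i j) \<longlonglongrightarrow> ent X i j" by (simp add: F_pow_eig[OF X(4)])
  then have "(\<lambda>n. c ^ t n * ent X i j / ent X i j) \<longlonglongrightarrow> ent X i j / ent X i j" by (intro tendsto_divide tendsto_const z)
  then have "(\<lambda>n. c ^ t n) \<longlonglongrightarrow> 1" using z by simp
  then have 1: "(\<lambda>n. cmod c ^ t n) \<longlonglongrightarrow> 1" using tendsto_norm[of "\<lambda>n. c ^ t n" 1 sequentially] by (simp add: norm_power)
  have small: "(\<lambda>n. x ^ t n) \<longlonglongrightarrow> 0" if "0 \<le> x" "x < 1" for x :: real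
    using LIMSEQ_subseq_LIMSEQ[OF LIMSEQ_power_zero[of x] t] that by (simp add: comp_def)
  show ?thesis
  proof (rule ccontr)
    assume "cmod c \<noteq> 1"
    then consider "cmod c < 1" | "cmod c > 1" by linarith
    then show False
    proof cases
      case 1
      then show False using LIMSEQ_unique[OF small[of "cmod c"] \<open>(\<lambda>n. cmod c ^ t n) \<longlonglongrightarrow> 1\<close>] by simp
    next
      case 2
      then have "0 < cmod c" by linarith
      then have "1 / cmod c < 1" using 2 divide_less_eq_1_pos[of "cmod c" 1] by blast
      then have "(\<lambda>n. cmod c ^ t n * (1 / cmod c) ^ t n) \<longlonglongrightarrow> 1 * 0"
        by (intro tendsto_mult 1 small) simp_all
      moreover have "cmod c ^ n * (1 / cmod c) ^ n = 1" for n
        using \<open>0 < cmod c\<close> by (auto simp add: power_one_over)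
      ultimately show False by (simp add: LIMSEQ_const_iff)
    qed
  qed
qed

text \<open>The powers \<open>c ^ t n\<close> converge to some \<open>l\<close> of modulus one, so
  \<open>Z\<close> is an eigenvector of \<open>P\<close> for \<open>l\<close>; idempotence leaves
  only \<open>l = 1\<close>.\<close>

lemma phases_fixed: assumes "Z \<in> phases d \<phi>" shows "R Z = Z"
proof -
  obtain c where Z: "Z \<in> M d" "Z \<noteq> 0" "cmod c = 1" "F Z = c *\<^sub>C Z" using assms by (auto simp: phases_def)
  obtain i j where z: "ent Z i j \<noteq> 0" using nonzero_entry Z(2) by blast
  define l where "l = ent (R Z) i j / ent Z i j"
  have L: "(\<lambda>n. c ^ t n * ent Z k m) \<longlonglongrightarrow> ent (R Z) k m" for k m
    using lim[OF Z(1), of k m] by (simp add: F_pow_eig[OF Z(4)])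
  have "(\<lambda>n. c ^ t n * ent Z i j / ent Z i j) \<longlonglongrightarrow> l" unfolding l_def by (intro tendsto_divide tendsto_const z L)
  then have cl: "(\<lambda>n. c ^ t n) \<longlonglongrightarrow> l" using z by simp
  have "ent (R Z) k m = l * ent Z k m" for k m
    by (rule LIMSEQ_unique[OF L]) (intro tendsto_mult cl tendsto_const)
  then have RZ: "R Z = l *\<^sub>C Z" by (intro fmat_eqI) simp
  have "(\<lambda>n. cmod (c ^ t n)) \<longlonglongrightarrow> cmod l" by (rule tendsto_norm[OF cl])
  then have "cmod l = 1" using Z(3) by (simp add: norm_power LIMSEQ_const_iff)
  then have l0: "l \<noteq> 0" by auto
  have "l *\<^sub>C l *\<^sub>C Z = l *\<^sub>C Z" using R_idem[of Z] by (simp add: RZ R_lin)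
  then have "(l * l - l) *\<^sub>C Z = 0" by (simp add: sc_diff_left)
  then have "l * l = l" using Z(2) by (simp add: sc_eq_0)
  then have "l = 1" using l0 by simp
  then show ?thesis using RZ by simp
qed

lemma phspan_fixed: assumes "X \<in> phspan d \<phi>" shows "X \<in> M d" "R X = X"
proof -
  obtain n c Z where Z: "\<forall>i<(n::nat). Z i \<in> phases d \<phi>" "X = (\<Sum>i<n. c i *\<^sub>C Z i)"
    using assms unfolding phspan_def by blast
  then show "X \<in> M d" by (auto simp: phases_def)
  show "R X = X" unfolding Z(2) R_lin using Z(1) phases_fixed by (intro sum.cong refl) auto
qed

text \<open>A Jordan chain for an eigenvalue of modulus one makes the powers grow linearly, whereas
  those with exponents \<open>t\<close> converge.\<close>

lemma no_jordan_block:
  assumes x: "x \<in> M d" and y: "y \<in> M d" "R y = y" "F y = c *\<^sub>C y" and xy: "F x = c *\<^sub>C x + y"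
  shows "y = 0"
proof (rule ccontr)
  assume "y \<noteq> 0"
  then obtain i j where z: "ent y i j \<noteq> 0" using nonzero_entry by blast
  have c1: "cmod c = 1" by (rule eig_unimodular[OF y(1) \<open>y \<noteq> 0\<close> y(2,3)])
  \<comment> \<open>Multiplication by \<open>c\<close> keeps the formula free of the exponent
    \<open>n - 1\<close>.\<close>
  have pow: "c *\<^sub>C (F ^^ n) x = c ^ Suc n *\<^sub>C x + (of_nat n * c ^ n) *\<^sub>C y" for n
  proof (induction n)
    case (Suc n)
    have "c *\<^sub>C (F ^^ Suc n) x = F (c *\<^sub>C (F ^^ n) x)" by (simp add: F_lin)
    also have "\<dots> = c ^ Suc n *\<^sub>C (c *\<^sub>C x + y) + (of_nat n * c ^ n) *\<^sub>C c *\<^sub>C y"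
      unfolding Suc F_lin xy y(3) ..
    also have "\<dots> = c ^ Suc (Suc n) *\<^sub>C x + (of_nat (Suc n) * c ^ Suc n) *\<^sub>C y"
      by (simp add: sc_add sc_add_left algebra_simps)
    finally show ?case .
  qed simp
  obtain B where B: "\<And>n. cmod (ent ((F ^^ t n) x) i j) \<le> B"
    using convergent_imp_Bseq[OF convergentI[OF lim[OF x, of i j]]] by (auto elim!: BseqE)
  have "real n * cmod (ent y i j) \<le> B + cmod (ent x i j)" for n
  proof -
    have "c * ent ((F ^^ t n) x) i j = c ^ Suc (t n) * ent x i j + of_nat (t n) * c ^ t n * ent y i j"
      using arg_cong[OF pow[of "t n"], of "\<lambda>X. ent X i j"] by simp
    then have "of_nat (t n) * c ^ t n * ent y i j = c * ent ((F ^^ t n) x) i j - c ^ Suc (t n) * ent x i j" by simp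
    then have "cmod (of_nat (t n) * c ^ t n * ent y i j) \<le> cmod (c * ent ((F ^^ t n) x) i j) + cmod (c ^ Suc (t n) * ent x i j)"
      using norm_triangle_ineq4 by metis
    then have "real (t n) * cmod (ent y i j) \<le> B + cmod (ent x i j)"
      using B[of n] c1 by (simp add: norm_mult norm_power)
    moreover have "real n * cmod (ent y i j) \<le> real (t n) * cmod (ent y i j)"
      using t_ge[of n] by (intro mult_right_mono) auto
    ultimately show ?thesis by linarith
  qed
  moreover obtain n :: nat where "real n * cmod (ent y i j) > B + cmod (ent x i j)"
    using reals_Archimedean3[of "cmod (ent y i j)"] z by auto
  ultimately show False by (metis not_le)
qed

text \<open>Otherwise the map induced on the quotient of the range by the span of the phase points has an
  eigenvector, which lifts to an eigenvector or to a Jordan block.\<close>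
lemma fixed_phspan: assumes "X \<in> M d" "R X = X" shows "X \<in> phspan d \<phi>"
proof -
  define S where "S = phspan d \<phi>"
  have S: "csub S" "S \<subseteq> M d" using phspan_csub phspan_fixed by (auto simp: S_def)
  obtain n b where b: "ortho n b" "\<And>i. i < n \<Longrightarrow> b i \<in> S" "\<And>x. x \<in> S \<Longrightarrow> x = (\<Sum>i<n. ip (b i) x *\<^sub>C b i)"
    using csub_ortho_basis[OF S] by blast
  define pr where "pr x = (\<Sum>i<n. ip (b i) x *\<^sub>C b i)" for x
  have prS: "pr x \<in> S" for x unfolding pr_def by (intro csub_sum csub_sc S b) auto
  have prip: "ip (b i) (x - pr x) = 0" if "i < n" for i x
    unfolding pr_def ip_simps(3) ortho_coeff[OF b(1) that] by simp
  have prorth: "ip y (x - pr x) = 0" if "y \<in> S" for y x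
    by (subst b(3)[OF that]) (simp only: ip_simps(6,10), simp add: prip del: ip_simps(3))
  \<comment> \<open>The orthogonal complement of \<open>S\<close> inside the range of
    \<open>P\<close> stands in for the quotient, and \<open>T\<close> below for the induced
    map.\<close>
  define S' where "S' = {x \<in> M d. R x = x \<and> (\<forall>y\<in>S. ip y x = 0)}"
  have SR: "R x = x" "x \<in> M d" if "x \<in> S" for x using that phspan_fixed by (auto simp: S_def)
  have S': "csub S'" "S' \<subseteq> M d" unfolding S'_def by (auto intro!: csubI simp: R_lin lft_zero[OF qc_lin[OF qcP]])
  show ?thesis
  proof (rule ccontr)
    assume "X \<notin> phspan d \<phi>"
    then have "X - pr X \<noteq> 0" using prS[of X] by (auto simp: S_def)
    moreover have "X - pr X \<in> S'" unfolding S'_def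
      by (intro CollectI conjI ballI prorth M_diff) (simp_all add: assms SR[OF prS] R_lin)
    ultimately have ne: "\<exists>x\<in>S'. x \<noteq> 0" by blast
    define T where "T x = F x - pr (F x)" for x
    have FS: "R (F x) = F x" if "x \<in> S'" for x using that RF by (simp add: S'_def)
    have T: "T x \<in> S'" if "x \<in> S'" for x
      unfolding S'_def T_def
      by (intro CollectI conjI ballI prorth M_diff F_M) (simp_all add: FS[OF that] SR[OF prS] R_lin)
    have Tadd: "T (x + y) = T x + T y" for x y
      unfolding T_def pr_def F_lin ip_simps by (simp add: sc_add_left sum.distrib)
    have Tsc: "T (c *\<^sub>C x) = c *\<^sub>C T x" for c x
      unfolding T_def pr_def F_lin ip_simps by (simp add: sc_diff sc_sum)
    obtain x c where x: "x \<in> S'" "x \<noteq> 0" "T x = c *\<^sub>C x"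
      using eigenvector_ex[OF S' ne T Tadd Tsc] by blast
    have xM: "x \<in> M d" "R x = x" "\<And>y. y \<in> S \<Longrightarrow> ip y x = 0" using x(1) by (auto simp: S'_def)
    have Fx: "F x = c *\<^sub>C x + pr (F x)" using x(3) by (simp add: T_def algebra_simps)
    obtain k e Z where Z: "\<forall>i<(k::nat). Z i \<in> phases d \<phi>" "pr (F x) = (\<Sum>i<k. e i *\<^sub>C Z i)"
      using prS[of "F x"] unfolding S_def phspan_def by blast
    have "\<exists>m. F (Z i) = m *\<^sub>C Z i" if "i < k" for i using Z(1) that by (auto simp: phases_def)
    then obtain m where m: "\<And>i. i < k \<Longrightarrow> F (Z i) = m i *\<^sub>C Z i" by metis
    have ZM: "Z i \<in> M d" "Z i \<in> S" if "i < k" for i using Z(1) that phases_phspan by (auto simp: phases_def S_def)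
    \<comment> \<open>The error \<open>pr (F x)\<close> is split by eigenvalue. The part for
      eigenvalues other than \<open>c\<close> is removed by subtracting \<open>z\<close>, obtained
      by dividing by \<open>m i - c\<close>; the part \<open>y\<close> for \<open>c\<close> itself
      would be a Jordan block.\<close>
    define y where "y = (\<Sum>i<k. (if m i = c then e i else 0) *\<^sub>C Z i)"
    define z where "z = (\<Sum>i<k. (if m i = c then 0 else e i / (m i - c)) *\<^sub>C Z i)"
    have yS: "y \<in> S" unfolding y_def by (intro csub_sum csub_sc S ZM) auto
    have zS: "z \<in> S" unfolding z_def by (intro csub_sum csub_sc S ZM) auto
    have Fy: "F y = c *\<^sub>C y"
      unfolding y_def F_lin sc_sum by (intro sum.cong refl) (auto simp: m mult.commute)
    have "F z - c *\<^sub>C z = (\<Sum>i<k. ((if m i = c then 0 else e i / (m i - c)) * (m i - c)) *\<^sub>C Z i)"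
      unfolding z_def F_lin sc_sum sum_subtractf[symmetric]
      by (intro sum.cong refl) (auto simp: m sc_diff_left[symmetric] algebra_simps)
    also have "\<dots> = pr (F x) - y"
      unfolding Z(2) y_def sum_subtractf[symmetric] by (intro sum.cong refl) auto
    finally have Fz: "F z = c *\<^sub>C z + pr (F x) - y" by (simp add: algebra_simps)
    have "F (x - z) = F x - F z" by (simp only: F_lin)
    also have "\<dots> = (c *\<^sub>C x + pr (F x)) - (c *\<^sub>C z + pr (F x) - y)"
      by (rule arg_cong2[OF Fx Fz])
    also have "\<dots> = c *\<^sub>C (x - z) + y" by (simp add: sc_diff)
    finally have Fxz: "F (x - z) = c *\<^sub>C (x - z) + y" .
    have xzM: "x - z \<in> M d" using xM SR[OF zS] by simp
    have "y = 0" by (rule no_jordan_block[OF xzM SR(2,1)[OF yS] Fy Fxz])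
    then have eig: "F (x - z) = c *\<^sub>C (x - z)" using Fxz by simp
    have "x \<in> S"
    proof (cases "x - z = 0")
      case True
      then show ?thesis using zS by simp
    next
      case False
      have "R (x - z) = x - z" using xM SR[OF zS] by (simp add: R_lin)
      from eig_unimodular[OF xzM False this eig] have "x - z \<in> phases d \<phi>"
        using xzM False eig by (auto simp: phases_def)
      then have "x - z \<in> S" unfolding S_def by (rule phases_phspan)
      from csub_add[OF S(1) this zS] show ?thesis by simp
    qed
    then have "ip x x = 0" by (rule xM(3))
    then show False using x(2) by simp
  qed
qed

text \<open>It holds for the idempotent obtained from any limit point, so its range does not depend
  on that choice.\<close>

lemma phase_subspace_fixed: "phase_subspace d \<phi> = {A \<in> carrier_mat d d. P A = A}"
proof (rule Set.set_eqI)
  fix A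
  have "A \<in> phase_subspace d \<phi> \<longleftrightarrow> A \<in> carrier_mat d d \<and> R (fm A) = fm A"
    unfolding phase_subspace_iff[OF qc_lin[OF qc]] using phspan_fixed(2) fixed_phspan[OF fm_M] by blast
  also have "\<dots> \<longleftrightarrow> A \<in> carrier_mat d d \<and> P A = A"
    using fm_eq[of "P A" d A] qc_carrier[OF qcP, of A] by (auto simp: lft_fm)
  finally show "A \<in> phase_subspace d \<phi> \<longleftrightarrow> A \<in> {A \<in> carrier_mat d d. P A = A}" by simp
qed

end

section \<open>Block structures\<close>

text \<open>An orthonormal basis of the orthogonal complement is appended; that the total length is
  \<open>d\<close> follows by taking the trace of the resolution of the identity.\<close>

lemma ortho_complete:
  assumes "ortho k g" "\<And>i. i < k \<Longrightarrow> g i \<in> V d"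
  shows "\<exists>h. ortho d h \<and> (\<forall>i<d. h i \<in> V d) \<and> (\<forall>i<k. h i = g i) \<and> k \<le> d \<and>
    (\<Sum>i<d. h i * star (h i)) = idm d"
proof -
  define S where "S = {v \<in> V d. \<forall>i<k. ip (g i) v = 0}"
  have S: "csub S" "S \<subseteq> M d" unfolding S_def by (auto intro!: csubI)
  obtain n b where b: "ortho n b" "\<And>i. i < n \<Longrightarrow> b i \<in> S" "\<And>x. x \<in> S \<Longrightarrow> x = (\<Sum>i<n. ip (b i) x *\<^sub>C b i)"
    by (rule csub_ortho_basis[OF S]) blast
  define h where "h i = (if i < k then g i else b (i - k))" for i
  have bS: "b i \<in> V d" "\<And>j. j < k \<Longrightarrow> ip (g j) (b i) = 0" if "i < n" for i
    using b(2)[OF that] by (auto simp: S_def)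
  have gb: "ip (b i) (g j) = 0" if "i < n" "j < k" for i j
    using ip_cnj[of "g j" "b i"] bS(2)[OF that] by simp
  have hV: "h i \<in> V d" if "i < k + n" for i
    using that assms(2) bS(1)[of "i - k"] by (auto simp: h_def)
  have ho: "ortho (k + n) h" unfolding ortho_def
  proof (intro allI impI)
    fix i j assume ij: "i < k + n" "j < k + n"
    have 1: "ip (g i) (g j) = (if i = j then 1 else 0)" if "i < k" "j < k" using ortho_ip[OF assms(1) that] .
    have 2: "ip (b (i-k)) (b (j-k)) = (if i = j then 1 else 0)" if "\<not> i < k" "\<not> j < k"
      using ortho_ip[OF b(1), of "i-k" "j-k"] that ij by auto
    show "ip (h i) (h j) = (if i = j then 1 else 0)"
      using ij 1 2 gb[of "i-k" j] bS(2)[of "j-k" i] by (auto simp: h_def)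
  qed
  have split: "(\<Sum>i<k+n. f (h i)) = (\<Sum>i<k. f (g i)) + (\<Sum>i<n. f (b i))" for f :: "fmat \<Rightarrow> fmat"
    unfolding sum_lessThan_add by (simp add: h_def)
  have sumid: "(\<Sum>i<k+n. h i * star (h i)) = idm d"
  proof (rule M_eq_vecI[of _ d])
    show "(\<Sum>i<k+n. h i * star (h i)) \<in> M d" using hV by (intro M_sum V_outer) auto
    fix v assume v: "v \<in> V d"
    define y where "y = v - (\<Sum>i<k. ip (g i) v *\<^sub>C g i)"
    have "ip (g i) y = 0" if "i < k" for i
      unfolding y_def ip_simps(3) ortho_coeff[OF assms(1) that] by simp
    moreover have "y \<in> V d" unfolding y_def using v assms(2) by (intro V_diff V_sum V_sc) auto
    ultimately have yS: "y \<in> S" by (simp add: S_def)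
    have "ip (b i) y = ip (b i) v" if "i < n" for i
      unfolding y_def ip_simps using gb[OF that] by simp
    then have "y = (\<Sum>i<n. ip (b i) v *\<^sub>C b i)" using b(3)[OF yS] by simp
    then have "v = (\<Sum>i<k. ip (g i) v *\<^sub>C g i) + (\<Sum>i<n. ip (b i) v *\<^sub>C b i)" by (simp add: y_def algebra_simps)
    also have "\<dots> = (\<Sum>i<k+n. ip (h i) v *\<^sub>C h i)" by (rule split[symmetric])
    also have "\<dots> = (\<Sum>i<k+n. h i * star (h i)) * v"
      unfolding sum_distrib_right using hV v by (intro sum.cong refl) (simp add: outer_apply[of _ d])
    finally show "(\<Sum>i<k+n. h i * star (h i)) * v = idm d * v" using v by simp
  qed simp
  have "of_nat (k + n) = (\<Sum>i<k+n. ip (h i) (h i))" using ho by (simp add: ortho_ip)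
  also have "\<dots> = tr (\<Sum>i<k+n. h i * star (h i))" unfolding tr_sum ip_def by (intro sum.cong refl tr_comm)
  finally have "(of_nat (k + n) :: complex) = of_nat d" unfolding sumid tr_idm .
  then have kn: "k + n = d" by (simp only: of_nat_eq_iff)
  show ?thesis
    by (rule exI[of _ h]) (use ho hV sumid kn in \<open>auto simp: h_def\<close>)
qed

section \<open>Index arithmetic of blocks\<close>

definition bsize :: "nat \<times> nat \<times> complex mat \<Rightarrow> nat" where "bsize = (\<lambda>(a,b,_). a * b)"

lemma block_off_bsize: "block_off bl i = sum_list (map bsize (take i bl))"
  by (simp add: block_off_def bsize_def)

lemma block_off_mono:
  assumes "i < j" "j < length bl" shows "block_off bl i + bsize (bl ! i) \<le> block_off bl j"
  using assms
proof (induction j)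
  case (Suc j)
  have "block_off bl (Suc j) = block_off bl j + bsize (bl ! j)"
    using Suc.prems by (simp add: block_off_bsize take_Suc_conv_app_nth)
  then show ?case using Suc by (cases "i = j") auto
qed simp

lemma block_off_le: "i < length bl \<Longrightarrow> block_off bl i + bsize (bl ! i) \<le> sum_list (map bsize bl)"
proof -
  assume i: "i < length bl"
  have "sum_list (map bsize bl) = sum_list (map bsize (take i bl @ bl ! i # drop (Suc i) bl))"
    using id_take_nth_drop[OF i] by simp
  then show ?thesis by (simp add: block_off_bsize)
qed

lemma block_off_inj:
  assumes "i < length bl" "j < length bl" "x < bsize (bl ! i)" "y < bsize (bl ! j)"
    "block_off bl i + x = block_off bl j + y"
  shows "i = j \<and> x = y"
proof -
  have "\<not> i < j" using block_off_mono[of i j bl] assms by auto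
  moreover have "\<not> j < i" using block_off_mono[of j i bl] assms by auto
  ultimately show ?thesis using assms by auto
qed

lemma block_off_surj:
  "r < sum_list (map bsize bl) \<Longrightarrow> \<exists>i<length bl. \<exists>x<bsize (bl ! i). r = block_off bl i + x"
proof (induction bl arbitrary: r)
  case (Cons b bl)
  show ?case
  proof (cases "r < bsize b")
    case True
    then show ?thesis by (intro exI[of _ 0]) (auto simp: block_off_bsize)
  next
    case False
    then have "r - bsize b < sum_list (map bsize bl)" using Cons.prems by auto
    from Cons.IH[OF this] obtain i x
      where ix: "i < length bl" "x < bsize (bl ! i)" "r - bsize b = block_off bl i + x" by blast
    then have "r = block_off (b # bl) (Suc i) + x" using False by (simp add: block_off_bsize)
    then show ?thesis using ix by (intro exI[of _ "Suc i"]) auto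
  qed
qed simp

lemma sum_range_shift:
  fixes f :: "nat \<Rightarrow> 'a::comm_monoid_add"
  assumes "off + n \<le> d"
  shows "(\<Sum>r<d. if off \<le> r \<and> r < off + n then f r else 0) = (\<Sum>x<n. f (off + x))"
proof -
  have "(\<Sum>r<d. if off \<le> r \<and> r < off + n then f r else 0) = (\<Sum>r\<in>{off..<off+n}. f r)"
    by (rule sum.mono_neutral_cong_right) (use assms in auto)
  also have "\<dots> = (\<Sum>x<n. f (off + x))"
    by (rule sum.reindex_bij_witness[of _ "\<lambda>x. off + x" "\<lambda>r. r - off"]) auto
  finally show ?thesis .
qed

lemma sum_prod_split: "(\<Sum>x<m*n. f x) = (\<Sum>a<m. \<Sum>s<n. f (a*n+s))"
    for f :: "nat \<Rightarrow> 'a::comm_monoid_add"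
proof (induction m)
  case (Suc m)
  have "(\<Sum>x<Suc m * n. f x) = (\<Sum>x<m*n+n. f x)" by (simp add: add.commute)
  then show ?case using Suc by (simp only: sum_lessThan_add sum.lessThan_Suc)
qed simp

lemma sum_swap3:
  fixes f :: "_ \<Rightarrow> _ \<Rightarrow> _ \<Rightarrow> 'a::comm_monoid_add"
  shows "(\<Sum>r\<in>A. \<Sum>c\<in>B. \<Sum>i\<in>I. f r c i) = (\<Sum>i\<in>I. \<Sum>r\<in>A. \<Sum>c\<in>B. f r c i)"
proof -
  have "(\<Sum>r\<in>A. \<Sum>c\<in>B. \<Sum>i\<in>I. f r c i) = (\<Sum>r\<in>A. \<Sum>i\<in>I. \<Sum>c\<in>B. f r c i)"
    by (rule sum.cong[OF refl]) (rule sum.swap)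
  then show ?thesis by (simp only: sum.swap[of _ I A])
qed

text \<open>Expanding in the columns \<open>g r\<close> of \<open>U\<close> confines block
  \<open>i\<close> to the interval of its positions; writing the offset there as
  \<open>a * d2 i + s\<close> separates the two factors of \<open>kron\<close>.\<close>

lemma fm_block_embed:
  assumes U: "U \<in> carrier_mat d d" and tot: "sum_list (map bsize bl) \<le> d"
    and bl: "\<And>i. i < length bl \<Longrightarrow> bl ! i = (d1 i, d2 i, \<rho> i)"
    and A: "\<And>i. i < length bl \<Longrightarrow> A i \<in> carrier_mat (d1 i) (d1 i)"
    and \<rho>: "\<And>i. i < length bl \<Longrightarrow> \<rho> i \<in> carrier_mat (d2 i) (d2 i)"
    and g: "\<And>r. r < d \<Longrightarrow> g r = fm U * mu r 0"
  shows "fm (U * block_embed d bl A * madj U) =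
    (\<Sum>i<length bl. \<Sum>a<d1 i. \<Sum>b<d1 i. A i $$ (a,b) *\<^sub>C (\<Sum>s<d2 i. \<Sum>t<d2 i. \<rho> i $$ (s,t) *\<^sub>C
      (g (block_off bl i + (a * d2 i + s)) * star (g (block_off bl i + (b * d2 i + t))))))"
proof -
  define B where "B = block_embed d bl A"
  define X where "X r c = g r * star (g c)" for r c
  define off where "off i = block_off bl i" for i
  let ?K = "\<lambda>i r c. if off i \<le> r \<and> r < off i + d1 i * d2 i then
      if off i \<le> c \<and> c < off i + d1 i * d2 i then kron (A i) (\<rho> i) $$ (r - off i, c - off i) *\<^sub>C X r c else 0 else 0"
  let ?q = "\<lambda>i a b s t. (A i $$ (a,b) * \<rho> i $$ (s,t)) *\<^sub>C X (off i + (a * d2 i + s)) (off i + (b * d2 i + t))"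
  let ?W = "\<lambda>i a b. \<Sum>s<d2 i. \<Sum>t<d2 i. \<rho> i $$ (s,t) *\<^sub>C X (off i + (a * d2 i + s)) (off i + (b * d2 i + t))"
  have Bc: "B \<in> carrier_mat d d" by (simp add: B_def block_embed_def)
  have mU: "madj U \<in> carrier_mat d d" using U by (simp add: madj_def)
  have le: "off i + d1 i * d2 i \<le> d" if "i < length bl" for i
    using block_off_le[OF that] tot that bl by (simp add: off_def bsize_def)
  have entB: "ent (fm B) r c = (\<Sum>i<length bl. if off i \<le> r \<and> r < off i + d1 i * d2 i then
      if off i \<le> c \<and> c < off i + d1 i * d2 i then kron (A i) (\<rho> i) $$ (r - off i, c - off i) else 0 else 0)"
    if "r < d" "c < d" for r c
    using that by (auto simp: ent_fm B_def block_embed_def bl off_def intro!: sum.cong)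
  have "fm (U * B * madj U) = fm U * fm B * star (fm U)"
    using U Bc mU by (simp add: fm_mult[of _ d] fm_madj mult.assoc)
  also have "\<dots> = (\<Sum>r<d. \<Sum>c<d. ent (fm B) r c *\<^sub>C X r c)"
  proof -
    have "fm U * fm B * star (fm U) = fm U * (\<Sum>r<d. \<Sum>c<d. ent (fm B) r c *\<^sub>C mu r c) * star (fm U)"
      using M_expand[OF fm_M[OF Bc]] by simp
    also have "\<dots> = (\<Sum>r<d. \<Sum>c<d. ent (fm B) r c *\<^sub>C (fm U * mu r 0 * star (fm U * mu c 0)))"
      unfolding sum_distrib_left sum_distrib_right by (subst mu_outer) (simp add: mult.assoc)
    also have "\<dots> = (\<Sum>r<d. \<Sum>c<d. ent (fm B) r c *\<^sub>C X r c)"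
      unfolding X_def by (intro sum.cong refl) (simp add: g)
    finally show ?thesis .
  qed
  also have "\<dots> = (\<Sum>r<d. \<Sum>c<d. \<Sum>i<length bl. ?K i r c)"
    by (intro sum.cong refl) (auto simp: entB sc_sum_left intro!: sum.cong)
  also have "\<dots> = (\<Sum>i<length bl. \<Sum>r<d. \<Sum>c<d. ?K i r c)"
    by (rule sum_swap3)
  also have "\<dots> = (\<Sum>i<length bl. \<Sum>a<d1 i. \<Sum>b<d1 i. A i $$ (a,b) *\<^sub>C ?W i a b)"
  proof (rule sum.cong[OF refl])
    fix i assume "i \<in> {..<length bl}"
    then have i: "i < length bl" by simp
    have "(\<Sum>r<d. \<Sum>c<d. ?K i r c)
      = (\<Sum>r<d. if off i \<le> r \<and> r < off i + d1 i * d2 i then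
      (\<Sum>y<d1 i * d2 i. kron (A i) (\<rho> i) $$ (r - off i, off i + y - off i) *\<^sub>C X r (off i + y)) else 0)"
    proof (intro sum.cong refl)
      fix r
      show "(\<Sum>c<d. ?K i r c)
        = (if off i \<le> r \<and> r < off i + d1 i * d2 i then
          (\<Sum>y<d1 i * d2 i. kron (A i) (\<rho> i) $$ (r - off i, off i + y - off i) *\<^sub>C X r (off i + y)) else 0)"
        by (cases "off i \<le> r \<and> r < off i + d1 i * d2 i") (simp_all only: if_True if_False simp_thms sum_range_shift[OF le[OF i]] sum.neutral_const)
    qed
    also have "\<dots> = (\<Sum>x<d1 i * d2 i. \<Sum>y<d1 i * d2 i. kron (A i) (\<rho> i) $$ (x, y) *\<^sub>C X (off i + x) (off i + y))"
      by (simp add: sum_range_shift[OF le[OF i]])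
    also have "\<dots> = (\<Sum>a<d1 i. \<Sum>s<d2 i. \<Sum>b<d1 i. \<Sum>t<d2 i. ?q i a b s t)"
      unfolding sum_prod_split using A[OF i] \<rho>[OF i]
      by (intro sum.cong refl) (simp add: kron_def enc_less)
    also have "\<dots> = (\<Sum>a<d1 i. \<Sum>b<d1 i. \<Sum>s<d2 i. \<Sum>t<d2 i. ?q i a b s t)"
      by (rule sum.cong[OF refl]) (rule sum.swap)
    also have "\<dots> = (\<Sum>a<d1 i. \<Sum>b<d1 i. A i $$ (a,b) *\<^sub>C ?W i a b)"
      by (simp add: sc_sum)
    finally show "(\<Sum>r<d. \<Sum>c<d. ?K i r c)
      = (\<Sum>a<d1 i. \<Sum>b<d1 i. A i $$ (a,b) *\<^sub>C ?W i a b)" .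
  qed
  finally show ?thesis by (simp only: B_def X_def off_def)
qed

lemma idempotent_channel_range:
  assumes qcP: "quantum_channel d P" and idP: "\<And>A. A \<in> carrier_mat d d \<Longrightarrow> P (P A) = P A"
  shows "\<exists>m rep N w T. block_data d (lft d P) m rep N w T"
proof -
  obtain n K where kr: "kraus d n K" and P: "\<And>X. X \<in> M d \<Longrightarrow> lft d P X = kraus.P n K X"
    using kraus_ex[OF qcP] by blast
  interpret kraus d n K by (rule kr)
  obtain e where e: "proj d e" "\<forall>a<n. e * K a = K a" "\<forall>W\<in>M d. (\<forall>a<n. star (K a) * W = 0) \<longrightarrow> e * W = 0"
    using support_proj_ex by blast
  interpret ik: idempotent_kraus d n K e
  proof
    fix X assume X: "X \<in> M d"
    have "lft d P (lft d P X) = lft d P X"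
      using idP[of "toM d X"] qc_carrier[OF qcP, of "toM d X"] by (simp add: lft_def)
    then show "kraus.P n K (kraus.P n K X) = kraus.P n K X" using P X P_M by simp
  qed (use e in auto)
  obtain m rep N w T where "block_data d (kraus.P n K) m rep N w T" using ik.channel_range by blast
  then have "block_data d (lft d P) m rep N w T"
    by (rule block_data_cong[THEN iffD2, rotated]) (rule P)
  then show ?thesis by blast
qed

lemma sum_over_list: "distinct xs \<Longrightarrow> (\<Sum>x\<in>set xs. f x) = (\<Sum>i<length xs. f (xs ! i))"
  for f :: "_ \<Rightarrow> 'a::comm_monoid_add"
  by (rule sum.reindex_bij_betw[symmetric]) (rule bij_betw_nth; simp)

text \<open>Passes from the flat indexing of \<open>block_data\<close>, where pairs in the same
  class contribute, to a list of blocks with their members.\<close>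

lemma sum_equiv_classes:
  fixes f :: "nat \<Rightarrow> nat \<Rightarrow> 'a::comm_monoid_add" and rep :: "nat \<Rightarrow> nat"
  assumes rs: "distinct rs" "set rs = rep ` {..<m}"
    and ms: "\<And>i. i < length rs \<Longrightarrow> distinct (ms i) \<and> set (ms i) = {j. j < m \<and> rep j = rs ! i}"
  shows "(\<Sum>j<m. \<Sum>k<m. if rep j = rep k then f j k else 0) =
    (\<Sum>i<length rs. \<Sum>a<length (ms i). \<Sum>b<length (ms i). f (ms i ! a) (ms i ! b))"
proof -
  have "(\<Sum>j<m. \<Sum>k<m. if rep j = rep k then f j k else 0) =
    (\<Sum>r\<in>rep ` {..<m}. \<Sum>j\<in>{x\<in>{..<m}. rep x = r}. \<Sum>k<m. if rep j = rep k then f j k else 0)"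
    by (rule sum.image_gen) simp
  also have "\<dots> = (\<Sum>i<length rs. \<Sum>j\<in>{x\<in>{..<m}. rep x = rs ! i}. \<Sum>k<m. if rep j = rep k then f j k else 0)"
    unfolding rs(2)[symmetric] by (rule sum_over_list[OF rs(1)])
  also have "\<dots> = (\<Sum>i<length rs. \<Sum>j\<in>set (ms i). \<Sum>k\<in>set (ms i). f j k)"
  proof (rule sum.cong[OF refl], rule sum.cong)
    fix i j assume i: "i \<in> {..<length rs}" and j: "j \<in> set (ms i)"
    show "(\<Sum>k<m. if rep j = rep k then f j k else 0) = (\<Sum>k\<in>set (ms i). f j k)"
      by (rule sum.mono_neutral_cong_right) (use i j ms in auto)
  qed (use ms in auto)
  also have "\<dots> = (\<Sum>i<length rs. \<Sum>a<length (ms i). \<Sum>b<length (ms i). f (ms i ! a) (ms i ! b))"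
  proof (rule sum.cong[OF refl])
    fix i assume "i \<in> {..<length rs}"
    then have d: "distinct (ms i)" using ms by auto
    show "(\<Sum>j\<in>set (ms i). \<Sum>k\<in>set (ms i). f j k) =
      (\<Sum>a<length (ms i). \<Sum>b<length (ms i). f (ms i ! a) (ms i ! b))"
      by (simp only: sum_over_list[OF d])
  qed
  finally show ?thesis .
qed

lemma block_embed_carrier: "block_embed d bl A \<in> carrier_mat d d"
  by (simp add: block_embed_def)

text \<open>Each class of indices under \<open>rep\<close> becomes one block: the class size is
  \<open>d1\<close>, the common \<open>N\<close> is \<open>d2\<close> and the common
  \<open>T\<close> is rho. The vectors \<open>w j s\<close>, listed block by block, are completed to
  an orthonormal basis that forms the columns of \<open>U\<close>.\<close>

lemma phase_structure_exists:
  assumes as: "asymptotic d \<phi> P t"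
  shows "\<exists>U bl. phase_structure d \<phi> U bl"
proof -
  interpret asymptotic d \<phi> P t by (rule as)
  obtain m rep N w T where bd: "block_data d (lft d P) m rep N w T"
    using idempotent_channel_range[OF qcP idP] by blast
  note bd = bd[unfolded block_data_def]
  have NT: "\<And>j k. j < m \<Longrightarrow> k < m \<Longrightarrow> rep j = rep k \<Longrightarrow> N j = N k \<and> T j = T k"
    using bd[THEN conjunct1] by blast
  have repm: "\<And>j. j < m \<Longrightarrow> rep j < m"
    using bd[THEN conjunct2, THEN conjunct1] by blast
  have wV: "\<And>j s. j < m \<Longrightarrow> s < N j \<Longrightarrow> w j s \<in> V d"
    using bd[THEN conjunct2, THEN conjunct2, THEN conjunct1] by blast
  have worth: "\<And>j s k t. j < m \<Longrightarrow> k < m \<Longrightarrow> s < N j \<Longrightarrow> t < N k \<Longrightarrow> ip (w j s) (w k t) = (if j = k \<and> s = t then 1 else 0)"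
    using bd[THEN conjunct2, THEN conjunct2, THEN conjunct2, THEN conjunct1] by simp
  have T1: "\<And>j. j < m \<Longrightarrow> (\<Sum>s<N j. T j s s) = (1::complex)"
    using bd[THEN conjunct2, THEN conjunct2, THEN conjunct2, THEN conjunct2, THEN conjunct1] by blast
  have Tpos: "\<And>j x. j < m \<Longrightarrow> \<exists>c\<ge>0. (\<Sum>s<N j. \<Sum>t<N j. cnj (x s) * T j s t * x t) = complex_of_real c"
    using bd[THEN conjunct2, THEN conjunct2, THEN conjunct2, THEN conjunct2, THEN conjunct2, THEN conjunct1] by blast
  have range: "\<And>B. B \<in> M d \<Longrightarrow> lft d P B = B \<longleftrightarrow> (\<exists>\<beta>. B = (\<Sum>j<m. \<Sum>k<m. if rep j = rep k then
        \<beta> j k *\<^sub>C (\<Sum>s<N j. \<Sum>t<N j. T j s t *\<^sub>C (w j s * star (w k t))) else 0))"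
    using bd[THEN conjunct2, THEN conjunct2, THEN conjunct2, THEN conjunct2, THEN conjunct2, THEN conjunct2] by blast
  define rs where "rs = sorted_list_of_set (rep ` {..<m})"
  define ms where "ms i = sorted_list_of_set {j. j < m \<and> rep j = rs ! i}" for i
  have rs: "distinct rs" "set rs = rep ` {..<m}" by (simp_all add: rs_def)
  have ms: "distinct (ms i) \<and> set (ms i) = {j. j < m \<and> rep j = rs ! i}" for i by (simp add: ms_def)
  define n where "n = length rs"
  define d1 where "d1 i = length (ms i)" for i
  define d2 where "d2 i = N (ms i ! 0)" for i
  define \<rho> where "\<rho> i = mat (d2 i) (d2 i) (\<lambda>(s,t). T (ms i ! 0) s t)" for i
  define bl where "bl = map (\<lambda>i. (d1 i, d2 i, \<rho> i)) [0..<n]"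
  have bl: "length bl = n" "\<And>i. i < n \<Longrightarrow> bl ! i = (d1 i, d2 i, \<rho> i)" by (simp_all add: bl_def)
  have bs: "bsize (bl ! i) = d1 i * d2 i" if "i < n" for i using bl(2)[OF that] by (simp add: bsize_def)
  have msn: "ms i ! a < m" "rep (ms i ! a) = rs ! i" if "a < d1 i" for i a
    using nth_mem[of a "ms i"] that ms[of i] by (auto simp: d1_def)
  have d1pos: "d1 i > 0" if "i < n" for i
  proof -
    have "rs ! i \<in> rep ` {..<m}" using that rs(2) by (auto simp: n_def)
    then have "set (ms i) \<noteq> {}" using ms[of i] by auto
    then show ?thesis by (auto simp: d1_def)
  qed
  have NTi: "N (ms i ! a) = d2 i" "T (ms i ! a) = T (ms i ! 0)" if "i < n" "a < d1 i" for i a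
    using NT[OF msn(1)[OF that(2)] msn(1)[OF d1pos[OF that(1)]]] msn(2)[OF that(2)] msn(2)[OF d1pos[OF that(1)]]
    by (auto simp: d2_def)
  have ms_inj: "i = i' \<and> a = a'" if "i < n" "i' < n" "a < d1 i" "a' < d1 i'" "ms i ! a = ms i' ! a'" for i i' a a'
  proof -
    have "rs ! i = rs ! i'" using msn(2)[OF that(3)] msn(2)[OF that(4)] that(5) by simp
    then have "i = i'" using rs(1) that(1,2) by (simp add: nth_eq_iff_index_eq n_def)
    then show ?thesis using that(3,4,5) ms[of i] by (auto simp: nth_eq_iff_index_eq d1_def)
  qed
  define v where "v i x = w (ms i ! (x div d2 i)) (x mod d2 i)" for i x
  have dm: "x div d2 i < d1 i \<and> x mod d2 i < d2 i" if "x < d1 i * d2 i" for i x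
  proof -
    have "d2 i > 0" using that by (cases "d2 i") auto
    then show ?thesis using that by (simp add: less_mult_imp_div_less)
  qed
  have vV: "v i x \<in> V d" if "i < n" "x < d1 i * d2 i" for i x
    unfolding v_def using dm[OF that(2)] msn(1) NTi(1)[OF that(1)] by (intro wV) auto
  have vorth: "ip (v i x) (v j y) = (if i = j \<and> x = y then 1 else 0)"
    if "i < n" "j < n" "x < d1 i * d2 i" "y < d1 j * d2 j" for i j x y
  proof -
    have "ip (v i x) (v j y) = (if ms i ! (x div d2 i) = ms j ! (y div d2 j) \<and> x mod d2 i = y mod d2 j then 1 else 0)"
      unfolding v_def using dm[OF that(3)] dm[OF that(4)] msn(1) NTi(1)[OF that(1)] NTi(1)[OF that(2)] by (intro worth) auto
    moreover have "(ms i ! (x div d2 i) = ms j ! (y div d2 j) \<and> x mod d2 i = y mod d2 j) \<longleftrightarrow> (i = j \<and> x = y)"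
      using ms_inj[OF that(1,2), of "x div d2 i" "y div d2 j"] dm[OF that(3)] dm[OF that(4)] by (metis div_mult_mod_eq)
    ultimately show ?thesis by simp
  qed
  define tot where "tot = sum_list (map bsize bl)"
  have "\<forall>r. \<exists>i x. r < tot \<longrightarrow> i < n \<and> x < d1 i * d2 i \<and> r = block_off bl i + x"
    using block_off_surj[of _ bl] bs bl(1) unfolding tot_def by metis
  \<comment> \<open>\<open>I r\<close> and \<open>X r\<close> decode the position \<open>r\<close>
    into its block and the offset inside it.\<close>
  then obtain I X where IX: "\<And>r. r < tot \<Longrightarrow> I r < n \<and> X r < d1 (I r) * d2 (I r) \<and> r = block_off bl (I r) + X r"
    by metis
  define g0 where "g0 r = v (I r) (X r)" for r
  have o0: "ortho tot g0" unfolding ortho_def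
  proof (intro allI impI)
    fix r c assume rc: "r < tot" "c < tot"
    have "(I r = I c \<and> X r = X c) \<longleftrightarrow> r = c" using IX[OF rc(1)] IX[OF rc(2)] by metis
    then show "ip (g0 r) (g0 c) = (if r = c then 1 else 0)"
      unfolding g0_def using vorth IX[OF rc(1)] IX[OF rc(2)] by simp
  qed
  have V0: "g0 r \<in> V d" if "r < tot" for r unfolding g0_def using IX[OF that] vV by blast
  obtain g where g': "ortho d g \<and> (\<forall>i<d. g i \<in> V d) \<and> (\<forall>i<tot. g i = g0 i) \<and> tot \<le> d \<and>
    (\<Sum>i<d. g i * star (g i)) = idm d"
    using ortho_complete[OF o0 V0] by blast
  have g: "ortho d g" "\<And>i. i < d \<Longrightarrow> g i \<in> V d" "\<And>i. i < tot \<Longrightarrow> g i = g0 i" "tot \<le> d"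
    "(\<Sum>i<d. g i * star (g i)) = idm d"
    using g' by simp_all
  have g_off: "g (block_off bl i + x) = v i x" if "i < n" "x < d1 i * d2 i" for i x
  proof -
    have lt: "block_off bl i + x < tot"
      using block_off_le[of i bl] that bl(1) bs unfolding tot_def by fastforce
    have "I (block_off bl i + x) = i \<and> X (block_off bl i + x) = x"
      using block_off_inj[of "I (block_off bl i + x)" bl i] IX[OF lt] that bs bl(1) by metis
    then show ?thesis using g(3)[OF lt] by (simp add: g0_def)
  qed
  \<comment> \<open>Sends the standard basis to \<open>g\<close>; its columns follow the order of
    \<open>block_off\<close>, with the completion at the end.\<close>
  define FU where "FU = (\<Sum>r<d. g r * star (mu r 0))"
  have FUM: "FU \<in> M d" unfolding FU_def using g(2) by (intro M_sum V_outer V_mu) auto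
  define U where "U = toM d FU"
  let ?W = "\<lambda>i a b. \<Sum>s<N (ms i ! a). \<Sum>t<N (ms i ! a). T (ms i ! a) s t *\<^sub>C (w (ms i ! a) s * star (w (ms i ! b) t))"
  let ?G = "\<lambda>i a b. \<Sum>s<d2 i. \<Sum>t<d2 i. \<rho> i $$ (s,t) *\<^sub>C
    (g (block_off bl i + (a * d2 i + s)) * star (g (block_off bl i + (b * d2 i + t))))"
  let ?Y = "\<lambda>\<beta>. \<Sum>i<n. \<Sum>a<d1 i. \<Sum>b<d1 i. \<beta> (ms i ! a) (ms i ! b) *\<^sub>C ?W i a b"
  let ?S = "{U * block_embed d bl A * madj U | A. \<forall>i<length bl. A i \<in> carrier_mat (fst (bl ! i)) (fst (bl ! i))}"
  have Uc: "U \<in> carrier_mat d d" and fU: "fm U = FU" using FUM by (simp_all add: U_def)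
  have gU: "g r = fm U * mu r 0" if "r < d" for r
  proof -
    have "fm U * mu r 0 = (\<Sum>r'<d. if r' = r then g r else 0)"
      unfolding fU FU_def sum_distrib_right
    proof (intro sum.cong refl)
      fix r' assume "r' \<in> {..<d}"
      then have "g r' * star (mu r' 0) * mu r 0 = ip (mu r' 0) (mu r 0) *\<^sub>C g r'"
        using g(2) that by (intro outer_apply[of _ d]) auto
      then show "g r' * star (mu r' 0) * mu r 0 = (if r' = r then g r else 0)" by (simp add: ip_mu)
    qed
    then show ?thesis using that by simp
  qed
  have mU: "madj U \<in> carrier_mat d d" using Uc by (simp add: madj_def)
  have "fm (U * madj U) = FU * star FU" using Uc mU by (simp add: fm_mult[of _ d] fm_madj fU)
  also have "\<dots> = (\<Sum>r<d. FU * mu r 0 * star (g r))" by (subst (2) FU_def) (simp add: sum_distrib_left mult.assoc)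
  also have "\<dots> = idm d" unfolding g(5)[symmetric] using gU by (intro sum.cong refl) (simp add: fU)
  finally have UU: "U * madj U = 1\<^sub>m d" using fm_eq[of "U * madj U" d "1\<^sub>m d"] Uc mU by (simp add: fm_one)
  have \<rho>c: "\<rho> i \<in> carrier_mat (d2 i) (d2 i)" for i by (simp add: \<rho>_def)
  have dens: "density (d2 i) (\<rho> i)" if i: "i < n" for i
  proof -
    have j: "ms i ! 0 < m" using msn(1) d1pos[OF i] by blast
    have "psd (d2 i) (\<rho> i)" unfolding psd_def
    proof (intro conjI allI)
      fix x :: "nat \<Rightarrow> complex"
      have eq: "(\<Sum>s<d2 i. \<Sum>t<d2 i. cnj (x s) * \<rho> i $$ (s,t) * x t) = (\<Sum>s<N (ms i ! 0). \<Sum>t<N (ms i ! 0). cnj (x s) * T (ms i ! 0) s t * x t)"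
        by (simp add: \<rho>_def d2_def)
      from Tpos[OF j, of x] obtain c where "c \<ge> 0" "(\<Sum>s<d2 i. \<Sum>t<d2 i. cnj (x s) * \<rho> i $$ (s,t) * x t) = complex_of_real c"
        unfolding eq by blast
      then show "Im (\<Sum>s<d2 i. \<Sum>t<d2 i. cnj (x s) * \<rho> i $$ (s,t) * x t) = 0"
        "0 \<le> Re (\<Sum>s<d2 i. \<Sum>t<d2 i. cnj (x s) * \<rho> i $$ (s,t) * x t)" by simp_all
    qed (rule \<rho>c)
    moreover have "mtrace (\<rho> i) = 1" using T1[OF j] by (simp add: mtrace_def \<rho>_def d2_def)
    ultimately show ?thesis by (simp add: density_def)
  qed
  have emb: "fm (U * block_embed d bl A * madj U) = (\<Sum>i<n. \<Sum>a<d1 i. \<Sum>b<d1 i. A i $$ (a,b) *\<^sub>C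
      ?W i a b)"
    if A: "\<And>i. i < n \<Longrightarrow> A i \<in> carrier_mat (d1 i) (d1 i)" for A
  proof -
    have "fm (U * block_embed d bl A * madj U) =
      (\<Sum>i<n. \<Sum>a<d1 i. \<Sum>b<d1 i. A i $$ (a,b) *\<^sub>C ?G i a b)"
      using fm_block_embed[OF Uc, of bl d1 d2 \<rho> A g] g(4) bl A \<rho>c gU by (simp add: tot_def)
    also have "\<dots> = (\<Sum>i<n. \<Sum>a<d1 i. \<Sum>b<d1 i. A i $$ (a,b) *\<^sub>C
      ?W i a b)"
    proof (intro sum.cong refl)
      fix i a b assume "i \<in> {..<n}" "a \<in> {..<d1 i}" "b \<in> {..<d1 i}"
      then have i: "i < n" "a < d1 i" "b < d1 i" by auto
      have "?G i a b
        = (\<Sum>s<d2 i. \<Sum>t<d2 i. T (ms i ! 0) s t *\<^sub>C (w (ms i ! a) s * star (w (ms i ! b) t)))"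
        using i by (intro sum.cong refl) (simp add: g_off enc_less v_def \<rho>_def)
      then show "A i $$ (a,b) *\<^sub>C ?G i a b
        = A i $$ (a,b) *\<^sub>C ?W i a b"
        using NTi[OF i(1,2)] by simp
    qed
    finally show ?thesis .
  qed
  have Wc: "U * block_embed d bl A * madj U \<in> carrier_mat d d" for A
    by (rule mult_carrier_mat[OF mult_carrier_mat[OF Uc block_embed_carrier] mU])
  have rangeB: "lft d P B = B \<longleftrightarrow> (\<exists>\<beta>. B = ?Y \<beta>)" if "B \<in> M d" for B
    unfolding range[OF that] n_def d1_def sum_equiv_classes[OF rs ms] ..
  have "phase_subspace d \<phi> = ?S"
  proof (rule Set.set_eqI, rule iffI)
    fix B assume "B \<in> phase_subspace d \<phi>"
    then have B: "B \<in> carrier_mat d d" "P B = B" by (auto simp: phase_subspace_fixed)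
    then have "lft d P (fm B) = fm B" by (simp add: lft_fm)
    then obtain \<beta> where \<beta>: "fm B = ?Y \<beta>"
      using rangeB[OF fm_M[OF B(1)]] by blast
    define A where "A i = mat (d1 i) (d1 i) (\<lambda>(a,b). \<beta> (ms i ! a) (ms i ! b))" for i
    have A: "A i \<in> carrier_mat (d1 i) (d1 i)" for i by (simp add: A_def)
    have "fm (U * block_embed d bl A * madj U) = fm B"
      unfolding emb[OF A] \<beta> by (intro sum.cong refl) (simp add: A_def)
    then have "U * block_embed d bl A * madj U = B"
      using fm_eq[OF Wc B(1)] by blast
    then show "B \<in> ?S"
      using A bl by (intro CollectI exI[of _ A]) auto
  next
    fix B assume "B \<in> ?S"
    then obtain A where A: "\<And>i. i < n \<Longrightarrow> A i \<in> carrier_mat (d1 i) (d1 i)" and BA: "B = U * block_embed d bl A * madj U"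
      using bl by auto
    have B: "B \<in> carrier_mat d d" unfolding BA by (rule Wc)
    \<comment> \<open>Inverts the enumeration of \<open>(i, a)\<close> by \<open>ms i ! a\<close>,
      so that a family of block matrices can be read as one array of coefficients.\<close>
    define pr where "pr j = (SOME q. fst q < n \<and> snd q < d1 (fst q) \<and> ms (fst q) ! snd q = j)" for j
    have pos: "fst (pr (ms i ! a)) = i \<and> snd (pr (ms i ! a)) = a" if ia: "i < n" "a < d1 i" for i a
    proof -
      define q where "q = pr (ms i ! a)"
      have "fst q < n \<and> snd q < d1 (fst q) \<and> ms (fst q) ! snd q = ms i ! a"
        unfolding q_def pr_def by (rule someI[of _ "(i,a)"]) (use ia in simp)
      then show ?thesis using ms_inj[of "fst q" i "snd q" a] ia unfolding q_def by blast
    qed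
    define \<beta> where "\<beta> j k = A (fst (pr j)) $$ (snd (pr j), snd (pr k))" for j k
    have "fm B = ?Y \<beta>"
      unfolding BA by (subst emb, erule A, intro sum.cong refl) (simp add: \<beta>_def pos)
    then have "lft d P (fm B) = fm B" using rangeB[OF fm_M[OF B]] by blast
    then have "P B = B" using fm_eq[of "P B" d B] B qc_carrier[OF qcP B] by (simp add: lft_fm)
    then show "B \<in> phase_subspace d \<phi>" using B by (simp add: phase_subspace_fixed)
  qed
  moreover have "\<forall>(d1, d2, \<rho>)\<in>set bl. d1 \<ge> 1 \<and> density d2 \<rho>"
    using d1pos dens by (auto simp: bl_def Suc_le_eq)
  ultimately have "phase_structure d \<phi> U bl"
    using Uc UU g(4) by (simp add: phase_structure_def tot_def bsize_def)
  then show ?thesis by blast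
qed

section \<open>The three conditions\<close>

text \<open>The content of \<open>phase_structure\<close> with the unitary eliminated:
  \<open>v i x\<close> stands for the column of \<open>U\<close> at offset \<open>x\<close> of block
  \<open>i\<close>, and \<open>a * d2 i + s\<close> encodes the product vector with first index
  \<open>a\<close> and second index \<open>s\<close>.\<close>

definition phase_blocks :: "nat \<Rightarrow> (complex mat \<Rightarrow> complex mat) \<Rightarrow> nat \<Rightarrow> (nat \<Rightarrow> nat) \<Rightarrow> (nat \<Rightarrow> nat) \<Rightarrow>
    (nat \<Rightarrow> complex mat) \<Rightarrow> (nat \<Rightarrow> nat \<Rightarrow> fmat) \<Rightarrow> bool" where
  "phase_blocks d \<phi> n d1 d2 \<rho> v \<longleftrightarrow> (\<forall>i<n. density (d2 i) (\<rho> i)) \<and>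
    (\<forall>i<n. \<forall>x<d1 i * d2 i. v i x \<in> V d) \<and>
    (\<forall>i<n. \<forall>j<n. \<forall>x<d1 i * d2 i. \<forall>y<d1 j * d2 j. ip (v i x) (v j y) = (if i = j \<and> x = y then 1 else 0)) \<and>
    (\<forall>B. B \<in> phase_subspace d \<phi> \<longleftrightarrow> B \<in> carrier_mat d d \<and> (\<exists>A. (\<forall>i<n. A i \<in> carrier_mat (d1 i) (d1 i)) \<and>
      fm B = (\<Sum>i<n. \<Sum>a<d1 i. \<Sum>b<d1 i. A i $$ (a,b) *\<^sub>C (\<Sum>s<d2 i. \<Sum>t<d2 i. \<rho> i $$ (s,t) *\<^sub>C
        (v i (a * d2 i + s) * star (v i (b * d2 i + t)))))))"

lemma phase_structure_blocks:
  assumes ps: "phase_structure d \<phi> U bl"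
  shows "\<exists>d2 \<rho> v. phase_blocks d \<phi> (length bl) (\<lambda>i. fst (bl ! i)) d2 \<rho> v"
proof -
  have Uc: "U \<in> carrier_mat d d" and UU: "U * madj U = 1\<^sub>m d" and tot: "sum_list (map bsize bl) \<le> d"
    and dens: "\<forall>(d1, d2, \<rho>)\<in>set bl. d1 \<ge> 1 \<and> density d2 \<rho>"
    and sub: "phase_subspace d \<phi> = {U * block_embed d bl A * madj U | A. \<forall>i<length bl. A i \<in> carrier_mat (fst (bl ! i)) (fst (bl ! i))}"
    using ps by (auto simp: phase_structure_def bsize_def)
  have mU: "madj U \<in> carrier_mat d d" using Uc by (simp add: madj_def)
  have UU': "madj U * U = 1\<^sub>m d" using mat_mult_left_right_inverse[OF Uc mU UU] .
  define d1 where "d1 i = fst (bl ! i)" for i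
  define d2 where "d2 i = fst (snd (bl ! i))" for i
  define \<rho> where "\<rho> i = snd (snd (bl ! i))" for i
  have bl: "bl ! i = (d1 i, d2 i, \<rho> i)" for i by (simp add: d1_def d2_def \<rho>_def)
  have bs: "bsize (bl ! i) = d1 i * d2 i" for i by (simp add: bsize_def bl)
  have den: "density (d2 i) (\<rho> i)" if "i < length bl" for i
    using dens nth_mem[OF that] unfolding bl[of i] by blast
  have \<rho>c: "\<rho> i \<in> carrier_mat (d2 i) (d2 i)" if "i < length bl" for i
    using den[OF that] by (simp add: density_def psd_def)
  define g where "g r = fm U * mu r 0" for r
  have gV: "g r \<in> V d" if "r < d" for r unfolding g_def using Uc that by (intro V_times fm_M V_mu)
  have UF: "star (fm U) * fm U = idm d"
    using arg_cong[OF UU', of fm] by (simp add: fm_mult[OF mU Uc] fm_madj fm_one)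
  have gorth: "ip (g r) (g c) = (if r = c then 1 else 0)" if "r < d" "c < d" for r c
  proof -
    have "ip (g r) (g c) = ip (mu r 0) (star (fm U) * fm U * mu c 0)" by (simp add: g_def ip_times mult.assoc)
    also have "\<dots> = ip (mu r 0) (mu c 0)" using that by (simp add: UF)
    finally show ?thesis by (simp add: ip_mu)
  qed
  define v where "v i x = g (block_off bl i + x)" for i x
  let ?R = "\<lambda>A. \<Sum>i<length bl. \<Sum>a<d1 i. \<Sum>b<d1 i. A i $$ (a,b) *\<^sub>C (\<Sum>s<d2 i. \<Sum>t<d2 i. \<rho> i $$ (s,t) *\<^sub>C
        (v i (a * d2 i + s) * star (v i (b * d2 i + t))))"
  let ?E = "\<lambda>B. B \<in> carrier_mat d d \<and> (\<exists>A. (\<forall>i<length bl. A i \<in> carrier_mat (d1 i) (d1 i)) \<and> fm B = ?R A)"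
  have lt: "block_off bl i + x < d" if "i < length bl" "x < d1 i * d2 i" for i x
    using block_off_le[OF that(1)] tot bs that(2) by (metis add_less_cancel_left le_trans order_less_le_trans)
  have 1: "\<forall>i<length bl. density (d2 i) (\<rho> i)" using den by blast
  have 2: "\<forall>i<length bl. \<forall>x<d1 i * d2 i. v i x \<in> V d" using gV lt by (simp add: v_def)
  have 3: "\<forall>i<length bl. \<forall>j<length bl. \<forall>x<d1 i * d2 i. \<forall>y<d1 j * d2 j. ip (v i x) (v j y) = (if i = j \<and> x = y then 1 else 0)"
  proof (intro allI impI)
    fix i j x y assume ij: "i < length bl" "j < length bl" "x < d1 i * d2 i" "y < d1 j * d2 j"
    have "(block_off bl i + x = block_off bl j + y) \<longleftrightarrow> (i = j \<and> x = y)"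
      using block_off_inj[of i bl j x y] ij bs by auto
    then show "ip (v i x) (v j y) = (if i = j \<and> x = y then 1 else 0)"
      unfolding v_def gorth[OF lt[OF ij(1,3)] lt[OF ij(2,4)]] by simp
  qed
  have emb: "fm (U * block_embed d bl A * madj U) = ?R A" if "\<forall>i<length bl. A i \<in> carrier_mat (d1 i) (d1 i)" for A
    unfolding v_def by (rule fm_block_embed[OF Uc tot bl _ \<rho>c g_def]) (use that in auto)
  have Wc: "U * block_embed d bl A * madj U \<in> carrier_mat d d" for A
    by (rule mult_carrier_mat[OF mult_carrier_mat[OF Uc block_embed_carrier] mU])
  have 4: "\<forall>B. B \<in> phase_subspace d \<phi> \<longleftrightarrow> ?E B"
  proof
    fix B
    have "B \<in> phase_subspace d \<phi> \<longleftrightarrow> (\<exists>A. B = U * block_embed d bl A * madj U \<and> (\<forall>i<length bl. A i \<in> carrier_mat (d1 i) (d1 i)))"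
      unfolding sub d1_def by blast
    also have "\<dots> \<longleftrightarrow> B \<in> carrier_mat d d \<and> (\<exists>A. (\<forall>i<length bl. A i \<in> carrier_mat (d1 i) (d1 i)) \<and>
      fm B = fm (U * block_embed d bl A * madj U))"
      using fm_eq[of B d, OF _ Wc] Wc by metis
    also have "\<dots> \<longleftrightarrow> ?E B"
      by (rule conj_cong[OF refl], rule ex_cong1, rule conj_cong[OF refl]) (simp only: emb)
    finally show "B \<in> phase_subspace d \<phi> \<longleftrightarrow> ?E B" .
  qed
  have "phase_blocks d \<phi> (length bl) d1 d2 \<rho> v"
    unfolding phase_blocks_def by (intro conjI 1 2 3 4)
  then show ?thesis unfolding d1_def by blast
qed

lemma density_ppos: "density k \<rho> \<Longrightarrow> \<rho> \<in> carrier_mat k k \<and> ppos k (fm \<rho>) \<and> tr (fm \<rho>) = 1"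
  using mtrace_fm[of \<rho> k] by (auto simp: density_def psd_iff)

lemma density_herm: assumes "density k \<rho>" "s < k" "t < k" shows "cnj (\<rho> $$ (s,t)) = \<rho> $$ (t,s)"
proof -
  have "star (fm \<rho>) = fm \<rho>" using density_ppos[OF assms(1)] ppos_star by blast
  from arg_cong[OF this, of "\<lambda>X. ent X t s"] show ?thesis
    using density_ppos[OF assms(1)] assms(2,3) by (auto simp: ent_fm)
qed

text \<open>Trace one forces a nonzero diagonal entry and positivity gives its sign; the entry later
  witnesses that the operators of a block do not vanish.\<close>

lemma density_diag: assumes "density k \<rho>" shows "\<exists>s<k. \<exists>c>0. \<rho> $$ (s,s) = complex_of_real c"
proof -
  have c: "\<rho> \<in> carrier_mat k k" "ppos k (fm \<rho>)" "tr (fm \<rho>) = 1" using density_ppos[OF assms] by auto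
  have d: "\<exists>c\<ge>0. \<rho> $$ (s,s) = complex_of_real c" if "s < k" for s
    using ppos_diag[OF c(2) that] c(1) that by (auto simp: ent_fm)
  have "(\<Sum>s<k. \<rho> $$ (s,s)) = 1"
    using c(3) c(1) by (simp add: tr_eq[OF fm_M[OF c(1)]] ent_fm)
  then have "\<exists>s<k. \<rho> $$ (s,s) \<noteq> 0" by (metis (no_types, lifting) lessThan_iff sum.neutral zero_neq_one)
  then show ?thesis using d by (metis less_eq_real_def of_real_0)
qed

text \<open>The operators E_ab (x) rho of a block with multiplicity at least two, for a, b < 2.\<close>
definition corner :: "nat \<Rightarrow> complex mat \<Rightarrow> (nat \<Rightarrow> nat \<Rightarrow> fmat) \<Rightarrow> nat \<Rightarrow> nat \<Rightarrow> fmat" where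
  "corner k \<rho> w a b = (\<Sum>s<k. \<Sum>t<k. \<rho> $$ (s,t) *\<^sub>C (w a s * star (w b t)))"

definition block_corner :: "nat \<Rightarrow> nat \<Rightarrow> complex mat \<Rightarrow> (nat \<Rightarrow> nat \<Rightarrow> fmat) \<Rightarrow> bool" where
  "block_corner d k \<rho> w \<longleftrightarrow> density k \<rho> \<and> (\<forall>a<2. \<forall>s<k. w a s \<in> V d) \<and>
    (\<forall>a<2. \<forall>b<2. \<forall>s<k. \<forall>t<k. ip (w a s) (w b t) = (if a = b \<and> s = t then 1 else 0))"

lemma block_cornerD:
  assumes "block_corner d k \<rho> w"
  shows "density k \<rho>" "a < 2 \<Longrightarrow> s < k \<Longrightarrow> w a s \<in> V d"
    "a < 2 \<Longrightarrow> b < 2 \<Longrightarrow> s < k \<Longrightarrow> t < k \<Longrightarrow> ip (w a s) (w b t) = (if a = b \<and> s = t then 1 else 0)"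
  using assms unfolding block_corner_def by blast+

lemma phase_structure_corner:
  assumes ps: "phase_structure d \<phi> U bl" and i: "i < length bl" "fst (bl ! i) > 1"
  shows "\<exists>k \<rho> w. block_corner d k \<rho> w \<and> (\<forall>a<2. \<forall>b<2. toM d (corner k \<rho> w a b) \<in> phase_subspace d \<phi>)"
proof -
  define d1 where "d1 i = fst (bl ! i)" for i
  obtain d2 \<rho> v where H: "phase_blocks d \<phi> (length bl) d1 d2 \<rho> v"
    using phase_structure_blocks[OF ps] unfolding d1_def by blast
  note H = H[unfolded phase_blocks_def]
  have H1: "density (d2 i) (\<rho> i)" using H i(1) by blast
  have d1: "1 < d1 i" using i(2) by (simp add: d1_def)
  have H2: "v i x \<in> V d" if "x < d1 i * d2 i" for x using H i(1) that by blast
  have H3: "ip (v i x) (v i y) = (if x = y then 1 else 0)" if "x < d1 i * d2 i" "y < d1 i * d2 i" for x y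
  proof -
    have "ip (v i x) (v i y) = (if i = i \<and> x = y then 1 else 0)" using H i(1) that by blast
    then show ?thesis by simp
  qed
  have H4: "B \<in> phase_subspace d \<phi>" if "B \<in> carrier_mat d d" "\<forall>i<length bl. A i \<in> carrier_mat (d1 i) (d1 i)"
    "fm B = (\<Sum>i<length bl. \<Sum>a<d1 i. \<Sum>b<d1 i. A i $$ (a,b) *\<^sub>C (\<Sum>s<d2 i. \<Sum>t<d2 i. \<rho> i $$ (s,t) *\<^sub>C
        (v i (a * d2 i + s) * star (v i (b * d2 i + t)))))" for A B
    using H that by blast
  define w where "w a s = v i (a * d2 i + s)" for a s
  have lt: "a * d2 i + s < d1 i * d2 i" if "a < 2" "s < d2 i" for a s
    using enc_less[of a "d1 i" s "d2 i"] that d1 by linarith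
  have bc: "block_corner d (d2 i) (\<rho> i) w"
    unfolding block_corner_def w_def using H1 H2 H3 lt by (simp add: enc_eq)
  have "toM d (corner (d2 i) (\<rho> i) w a b) \<in> phase_subspace d \<phi>" if ab: "a < 2" "b < 2" for a b
  proof (rule H4)
    define A where "A j = mat (d1 j) (d1 j) (\<lambda>(a',b'). if j = i \<and> a' = a \<and> b' = b then 1 else (0::complex))" for j
    show "\<forall>i<length bl. A i \<in> carrier_mat (d1 i) (d1 i)" by (simp add: A_def)
    have cM: "corner (d2 i) (\<rho> i) w a b \<in> M d" unfolding corner_def
      using block_cornerD(2)[OF bc] ab by (intro M_sum M_sc V_outer) auto
    define X where "X j a b = (\<Sum>s<d2 j. \<Sum>t<d2 j. \<rho> j $$ (s,t) *\<^sub>C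
        (v j (a * d2 j + s) * star (v j (b * d2 j + t))))" for j a b
    have "(\<Sum>j<length bl. \<Sum>a<d1 j. \<Sum>b<d1 j. A j $$ (a,b) *\<^sub>C X j a b) =
      (\<Sum>j<length bl. if j = i then \<Sum>a'<d1 j. \<Sum>b'<d1 j. if b' = b then if a' = a then X j a' b' else 0 else 0 else 0)"
    proof (rule sum.cong[OF refl])
      fix j
      have "(\<Sum>a'<d1 j. \<Sum>b'<d1 j. A j $$ (a',b') *\<^sub>C X j a' b') =
        (\<Sum>a'<d1 j. \<Sum>b'<d1 j. if j = i then if b' = b then if a' = a then X j a' b' else 0 else 0 else 0)"
        by (intro sum.cong refl) (simp add: A_def)
      then show "(\<Sum>a'<d1 j. \<Sum>b'<d1 j. A j $$ (a',b') *\<^sub>C X j a' b') =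
        (if j = i then \<Sum>a'<d1 j. \<Sum>b'<d1 j. if b' = b then if a' = a then X j a' b' else 0 else 0 else 0)"
        by (cases "j = i") simp_all
    qed
    also have "\<dots> = X i a b" using i(1) ab d1 by simp
    also have "X i a b = corner (d2 i) (\<rho> i) w a b" by (simp add: X_def corner_def w_def)
    also have "\<dots> = fm (toM d (corner (d2 i) (\<rho> i) w a b))" using cM by simp
    finally show "fm (toM d (corner (d2 i) (\<rho> i) w a b)) = (\<Sum>j<length bl. \<Sum>a<d1 j. \<Sum>b<d1 j. A j $$ (a,b) *\<^sub>C (\<Sum>s<d2 j. \<Sum>t<d2 j. \<rho> j $$ (s,t) *\<^sub>C
        (v j (a * d2 j + s) * star (v j (b * d2 j + t)))))" unfolding X_def by (rule sym)
  qed simp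
  then show ?thesis using bc by (intro exI conjI) auto
qed

lemma corner_M: "block_corner d k \<rho> w \<Longrightarrow> a < 2 \<Longrightarrow> b < 2 \<Longrightarrow> corner k \<rho> w a b \<in> M d"
  unfolding corner_def using block_cornerD(2)[of d k \<rho> w] by (intro M_sum M_sc V_outer) auto

lemma corner_ip:
  assumes "block_corner d k \<rho> w" "a < 2" "b < 2" "x \<in> V d" "y \<in> V d"
  shows "ip x (corner k \<rho> w a b * y) = (\<Sum>s<k. \<Sum>t<k. \<rho> $$ (s,t) * (ip x (w a s) * ip (w b t) y))"
  unfolding corner_def sum_distrib_right ip_simps
  using block_cornerD(2)[OF assms(1)] assms(2-5) by (intro sum.cong refl) (simp add: outer_apply[of _ d])

lemma corner_entry:
  assumes bc: "block_corner d k \<rho> w" and "a < 2" "b < 2" "a' < 2" "b' < 2" "s < k" "t < k"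
  shows "ip (w a' s) (corner k \<rho> w a b * w b' t) = (if a' = a \<and> b' = b then \<rho> $$ (s,t) else 0)"
proof -
  have "ip (w a' s) (corner k \<rho> w a b * w b' t) =
    (\<Sum>s'<k. \<Sum>t'<k. \<rho> $$ (s',t') * (ip (w a' s) (w a s') * ip (w b t') (w b' t)))"
    by (rule corner_ip[OF bc assms(2,3)]) (use block_cornerD(2)[OF bc] assms in auto)
  also have "\<dots> = (\<Sum>s'<k. \<Sum>t'<k. if t' = t then if s' = s then (if a' = a \<and> b' = b then \<rho> $$ (s',t') else 0) else 0 else 0)"
    by (intro sum.cong refl) (use assms block_cornerD(3)[OF bc] in auto)
  also have "\<dots> = (if a' = a \<and> b' = b then \<rho> $$ (s,t) else 0)" using assms by simp
  finally show ?thesis .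
qed

lemma corner_star:
  assumes bc: "block_corner d k \<rho> w"
  shows "star (corner k \<rho> w a b) = corner k \<rho> w b a"
proof -
  have "star (corner k \<rho> w a b) = (\<Sum>s<k. \<Sum>t<k. \<rho> $$ (t,s) *\<^sub>C (w b t * star (w a s)))"
    unfolding corner_def star_sum star_sc star_times star_star
    by (intro sum.cong refl) (use density_herm[OF block_cornerD(1)[OF bc]] in auto)
  also have "\<dots> = corner k \<rho> w b a" unfolding corner_def by (rule sum.swap)
  finally show ?thesis .
qed

text \<open>The two corners are adjoint to each other and square to zero. If they commuted they
  would be normal and nilpotent, hence zero, against a positive diagonal entry of
  \<open>\<rho>\<close>.\<close>

lemma corner_noncommuting:
  assumes bc: "block_corner d k \<rho> w"
  shows "corner k \<rho> w 0 1 * corner k \<rho> w 1 0 \<noteq> corner k \<rho> w 1 0 * corner k \<rho> w 0 1"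
proof
  let ?B = "corner k \<rho> w 0 1"
  assume com: "?B * corner k \<rho> w 1 0 = corner k \<rho> w 1 0 * ?B"
  have st: "corner k \<rho> w 1 0 = star ?B" using corner_star[OF bc, of 0 1] by simp
  have BB: "?B * ?B = 0"
  proof -
    have "w 0 s * star (w 1 t) * (w 0 s' * star (w 1 t')) = 0" if "s < k" "t < k" "s' < k" for s t s' t'
      using block_cornerD(2,3)[OF bc] that by (simp add: outer_times[of _ d])
    then show ?thesis unfolding corner_def
      by (simp add: sum_distrib_left sum_distrib_right)
  qed
  have "ip (star ?B * ?B) (star ?B * ?B) = tr (star ?B * (?B * star ?B) * ?B)"
    by (simp add: ip_def mult.assoc)
  also have "\<dots> = tr (star ?B * (star ?B * ?B) * ?B)" using com st by simp
  also have "\<dots> = tr (star ?B * star ?B * (?B * ?B))" by (simp only: mult.assoc)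
  also have "\<dots> = 0" by (simp only: BB mult_zero_right tr_zero)
  finally have "star ?B * ?B = 0" by (simp only: ip_eq_0)
  then have "ip ?B ?B = 0" by (simp add: ip_def)
  then have B0: "?B = 0" by (simp only: ip_eq_0)
  obtain s c where s: "s < k" "c > 0" "\<rho> $$ (s,s) = complex_of_real c"
    using density_diag[OF block_cornerD(1)[OF bc]] by blast
  have "ip (w 0 s) (?B * w 1 s) = \<rho> $$ (s,s)" using corner_entry[OF bc, of 0 1 0 1 s s] s(1) by simp
  then show False using B0 s by simp
qed

lemma phspan_commute:
  assumes "\<And>X Y. X \<in> phases d \<phi> \<Longrightarrow> Y \<in> phases d \<phi> \<Longrightarrow> X * Y = Y * X" "X \<in> phspan d \<phi>" "Y \<in> phspan d \<phi>"
  shows "X * Y = Y * X"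
proof -
  obtain n c Z n' c' Z' where Z: "\<forall>i<(n::nat). Z i \<in> phases d \<phi>" "X = (\<Sum>i<n. c i *\<^sub>C Z i)"
    and Z': "\<forall>i<(n'::nat). Z' i \<in> phases d \<phi>" "Y = (\<Sum>i<n'. c' i *\<^sub>C Z' i)"
    using assms(2,3) unfolding phspan_def by blast
  have "X * Y = (\<Sum>i<n. \<Sum>j<n'. (c i * c' j) *\<^sub>C (Z i * Z' j))"
    unfolding Z(2) Z'(2) sum_distrib_left sum_distrib_right by (subst sum.swap) (simp add: mult.commute)
  also have "\<dots> = (\<Sum>i<n. \<Sum>j<n'. (c i * c' j) *\<^sub>C (Z' j * Z i))"
    using Z(1) Z'(1) assms(1) by (intro sum.cong refl) auto
  also have "\<dots> = Y * X"
    unfolding Z(2) Z'(2) sum_distrib_left sum_distrib_right by (simp add: mult.commute)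
  finally show ?thesis .
qed

text \<open>The commutator is bilinear, so it vanishes on all pairs of phase points exactly when it
  vanishes on their span.\<close>

lemma noncommuting_phase_points_iff:
  assumes "lin_map d \<phi>"
  shows "(\<exists>Z1 Z2. phase_point d \<phi> Z1 \<and> phase_point d \<phi> Z2 \<and> Z1 * Z2 \<noteq> Z2 * Z1) \<longleftrightarrow>
    (\<exists>X\<in>phspan d \<phi>. \<exists>Y\<in>phspan d \<phi>. X * Y \<noteq> Y * X)"
proof -
  have "(\<exists>Z1 Z2. phase_point d \<phi> Z1 \<and> phase_point d \<phi> Z2 \<and> Z1 * Z2 \<noteq> Z2 * Z1) \<longleftrightarrow>
    (\<exists>X\<in>phases d \<phi>. \<exists>Y\<in>phases d \<phi>. X * Y \<noteq> Y * X)"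
  proof
    assume "\<exists>Z1 Z2. phase_point d \<phi> Z1 \<and> phase_point d \<phi> Z2 \<and> Z1 * Z2 \<noteq> Z2 * Z1"
    then obtain Z1 Z2 where Z: "Z1 \<in> carrier_mat d d" "Z2 \<in> carrier_mat d d" "fm Z1 \<in> phases d \<phi>" "fm Z2 \<in> phases d \<phi>" "Z1 * Z2 \<noteq> Z2 * Z1"
      unfolding phase_point_iff[OF assms] by blast
    then have "fm (Z1 * Z2) \<noteq> fm (Z2 * Z1)" by (subst fm_eq[of _ d]) auto
    then have "fm Z1 * fm Z2 \<noteq> fm Z2 * fm Z1" using Z(1,2) by (simp add: fm_mult[of _ d])
    then show "\<exists>X\<in>phases d \<phi>. \<exists>Y\<in>phases d \<phi>. X * Y \<noteq> Y * X" using Z by blast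
  next
    assume "\<exists>X\<in>phases d \<phi>. \<exists>Y\<in>phases d \<phi>. X * Y \<noteq> Y * X"
    then obtain X Y where XY: "X \<in> phases d \<phi>" "Y \<in> phases d \<phi>" "X * Y \<noteq> Y * X" by blast
    then have M: "X \<in> M d" "Y \<in> M d" by (auto simp: phases_def)
    have "toM d X * toM d Y \<noteq> toM d Y * toM d X"
    proof
      assume "toM d X * toM d Y = toM d Y * toM d X"
      from arg_cong[OF this, of fm] show False using XY(3) M by (simp add: fm_mult[of _ d])
    qed
    then show "\<exists>Z1 Z2. phase_point d \<phi> Z1 \<and> phase_point d \<phi> Z2 \<and> Z1 * Z2 \<noteq> Z2 * Z1"
      unfolding phase_point_iff[OF assms] using XY(1,2) M by (intro exI[of _ "toM d X"] exI[of _ "toM d Y"]) simp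
  qed
  also have "\<dots> \<longleftrightarrow> (\<exists>X\<in>phspan d \<phi>. \<exists>Y\<in>phspan d \<phi>. X * Y \<noteq> Y * X)"
    using phspan_commute[of d \<phi>] phases_phspan[of _ d \<phi>] by blast
  finally show ?thesis .
qed

lemma fm_phspan: "lin_map d \<phi> \<Longrightarrow> X \<in> M d \<Longrightarrow> toM d X \<in> phase_subspace d \<phi> \<Longrightarrow> X \<in> phspan d \<phi>"
  by (simp add: phase_subspace_iff)

text \<open>The sum is the quadratic form of the partial transpose of Y at v.\<close>
lemma separable_ppt:
  assumes "separable d k Y"
  shows "0 \<le> Re (\<Sum>i<d. \<Sum>a<k. \<Sum>j<d. \<Sum>b<k. cnj (v i a) * Y $$ (i * k + b, j * k + a) * v j b)"
proof -
  obtain n :: nat and p \<sigma> \<tau> where p: "\<forall>m<n. p m \<ge> (0::real) \<and> density d (\<sigma> m) \<and> density k (\<tau> m)"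
    and Y: "Y = mat (d*k) (d*k) (\<lambda>rc. \<Sum>m<n. complex_of_real (p m) * kron (\<sigma> m) (\<tau> m) $$ rc)"
    using assms unfolding separable_def by blast
  have pos: "0 \<le> Re (\<Sum>i<d. \<Sum>a<k. \<Sum>j<d. \<Sum>b<k. cnj (v i a) * (s $$ (i,j) * t $$ (b,a)) * v j b)"
    if "density d s" "density k t" for s t
  proof -
    have t: "t \<in> carrier_mat k k" "ppos k (fm t)" using density_ppos[OF that(2)] by auto
    obtain N :: nat and u where u: "\<forall>m<N. u m \<in> V k" "fm t = (\<Sum>m<N. u m * star (u m))" using ppos_decomp[OF t(2)] by blast
    have tba: "t $$ (b,a) = (\<Sum>m<N. ent (u m) b 0 * cnj (ent (u m) a 0))" if "a < k" "b < k" for a b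
    proof -
      have "t $$ (b,a) = ent (fm t) b a" using t(1) that by (auto simp: ent_fm)
      then show ?thesis unfolding u(2) ent_sum using u(1) by (simp add: ent_outer[of _ k])
    qed
    \<comment> \<open>Transposing \<open>t\<close> merely conjugates its rank-one pieces;
      contracting the second factor with them leaves forms of the positive matrix \<open>s\<close>
      at the vectors \<open>y m\<close>.\<close>
    define y where "y m j = (\<Sum>b<k. ent (u m) b 0 * v j b)" for m j
    let ?g = "\<lambda>m i a j b. (cnj (ent (u m) a 0) * cnj (v i a)) * s $$ (i,j) * (ent (u m) b 0 * v j b)"
    have "(\<Sum>i<d. \<Sum>a<k. \<Sum>j<d. \<Sum>b<k. cnj (v i a) * (s $$ (i,j) * t $$ (b,a)) * v j b)
      = (\<Sum>i<d. \<Sum>a<k. \<Sum>j<d. \<Sum>b<k. \<Sum>m<N. ?g m i a j b)"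
      by (intro sum.cong refl) (simp add: tba sum_distrib_left sum_distrib_right mult_ac)
    also have "\<dots> = (\<Sum>i<d. \<Sum>a<k. \<Sum>m<N. \<Sum>j<d. \<Sum>b<k. ?g m i a j b)"
      by (rule sum.cong[OF refl], rule sum.cong[OF refl], rule sum_swap3)
    also have "\<dots> = (\<Sum>m<N. \<Sum>i<d. \<Sum>a<k. \<Sum>j<d. \<Sum>b<k. ?g m i a j b)"
      by (rule sum_swap3)
    also have "\<dots> = (\<Sum>m<N. \<Sum>i<d. \<Sum>j<d. cnj (y m i) * s $$ (i,j) * y m j)"
    proof (rule sum.cong[OF refl], rule sum.cong[OF refl])
      fix m i
      have "(\<Sum>a<k. \<Sum>j<d. \<Sum>b<k. ?g m i a j b)
        = (\<Sum>j<d. \<Sum>a<k. \<Sum>b<k. ?g m i a j b)"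
        by (rule sum.swap)
      also have "\<dots> = (\<Sum>j<d. cnj (y m i) * s $$ (i,j) * y m j)"
        by (simp add: y_def sum_distrib_left sum_distrib_right) (intro sum.cong refl sum.swap)
      finally show "(\<Sum>a<k. \<Sum>j<d. \<Sum>b<k. ?g m i a j b)
        = (\<Sum>j<d. cnj (y m i) * s $$ (i,j) * y m j)" .
    qed
    finally have eq: "(\<Sum>i<d. \<Sum>a<k. \<Sum>j<d. \<Sum>b<k. cnj (v i a) * (s $$ (i,j) * t $$ (b,a)) * v j b)
      = (\<Sum>m<N. \<Sum>i<d. \<Sum>j<d. cnj (y m i) * s $$ (i,j) * y m j)" .
    have "0 \<le> Re (\<Sum>i<d. \<Sum>j<d. cnj (y m i) * s $$ (i,j) * y m j)" for m
      using that(1) by (simp only: density_def psd_def)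
    then show ?thesis unfolding eq Re_sum[of "\<lambda>m. \<Sum>i<d. \<Sum>j<d. cnj (y m i) * s $$ (i,j) * y m j"] by (rule sum_nonneg)
  qed
  have dims: "dim_row (\<sigma> m) = d" "dim_col (\<sigma> m) = d" "dim_row (\<tau> m) = k" "dim_col (\<tau> m) = k" if "m < n" for m
    using p that by (auto dest!: density_ppos)
  let ?h = "\<lambda>m i a j b. complex_of_real (p m) * (cnj (v i a) * (\<sigma> m $$ (i,j) * \<tau> m $$ (b,a)) * v j b)"
  have "(\<Sum>i<d. \<Sum>a<k. \<Sum>j<d. \<Sum>b<k. cnj (v i a) * Y $$ (i * k + b, j * k + a) * v j b)
    = (\<Sum>i<d. \<Sum>a<k. \<Sum>j<d. \<Sum>b<k. \<Sum>m<n. ?h m i a j b)"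
    by (intro sum.cong refl) (simp add: Y enc_less kron_def dims sum_distrib_left sum_distrib_right mult_ac)
  also have "\<dots> = (\<Sum>i<d. \<Sum>a<k. \<Sum>m<n. \<Sum>j<d. \<Sum>b<k. ?h m i a j b)"
    by (rule sum.cong[OF refl], rule sum.cong[OF refl], rule sum_swap3)
  also have "\<dots> = (\<Sum>m<n. \<Sum>i<d. \<Sum>a<k. \<Sum>j<d. \<Sum>b<k. ?h m i a j b)"
    by (rule sum_swap3)
  also have "\<dots> = (\<Sum>m<n. complex_of_real (p m) * (\<Sum>i<d. \<Sum>a<k. \<Sum>j<d. \<Sum>b<k. cnj (v i a) * (\<sigma> m $$ (i,j) * \<tau> m $$ (b,a)) * v j b))"
    by (simp only: sum_distrib_left)
  finally have "Re (\<Sum>i<d. \<Sum>a<k. \<Sum>j<d. \<Sum>b<k. cnj (v i a) * Y $$ (i * k + b, j * k + a) * v j b) =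
    (\<Sum>m<n. p m * Re (\<Sum>i<d. \<Sum>a<k. \<Sum>j<d. \<Sum>b<k. cnj (v i a) * (\<sigma> m $$ (i,j) * \<tau> m $$ (b,a)) * v j b))"
    by (simp only: Re_sum Re_complex_of_real times_complex.sel Im_complex_of_real mult_zero_left diff_zero)
  also have "\<dots> \<ge> 0" using p pos by (intro sum_nonneg mult_nonneg_nonneg) auto
  finally show ?thesis .
qed

section \<open>Ampliations of channels and the entangled block state\<close>

lemma qc_ampl_mtrace:
  assumes Q: "quantum_channel d Q" and X: "X \<in> carrier_mat (d*k) (d*k)"
  shows "mtrace (ampl d k Q X) = mtrace X"
proof -
  define Z where "Z a = mat d d (\<lambda>(i,j). X $$ (i*k + a, j*k + a))" for a
  have Zc: "Z a \<in> carrier_mat d d" for a by (simp add: Z_def)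
  have QZ: "Q (Z a) \<in> carrier_mat d d" for a by (rule qc_carrier[OF Q Zc])
  have "mtrace (ampl d k Q X) = (\<Sum>r<d*k. Q (Z (r mod k)) $$ (r div k, r div k))"
    by (simp add: mtrace_def ampl_def Z_def)
  also have "\<dots> = (\<Sum>i<d. \<Sum>a<k. Q (Z a) $$ (i,i))" by (simp add: sum_prod_split)
  also have "\<dots> = (\<Sum>a<k. \<Sum>i<d. Q (Z a) $$ (i,i))" by (rule sum.swap)
  also have "\<dots> = (\<Sum>a<k. mtrace (Q (Z a)))" using carrier_matD(1)[OF QZ] by (simp add: mtrace_def)
  also have "\<dots> = (\<Sum>a<k. mtrace (Z a))" using Q Zc by (simp add: quantum_channel_def trace_preserving_def)
  also have "\<dots> = (\<Sum>a<k. \<Sum>i<d. X $$ (i*k + a, i*k + a))" by (simp add: mtrace_def Z_def)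
  also have "\<dots> = (\<Sum>i<d. \<Sum>a<k. X $$ (i*k + a, i*k + a))" by (rule sum.swap)
  also have "\<dots> = mtrace X" using X by (simp add: mtrace_def sum_prod_split)
  finally show ?thesis .
qed

lemma qc_ampl_density:
  assumes "quantum_channel d Q" "density (d*k) X" shows "density (d*k) (ampl d k Q X)"
  using assms qc_ampl_mtrace[of d Q X k]
  by (simp add: density_def quantum_channel_def completely_positive_def psd_def[of _ X])

lemma sum_swap4:
  fixes f :: "_ \<Rightarrow> _ \<Rightarrow> _ \<Rightarrow> _ \<Rightarrow> 'a::comm_monoid_add"
  shows "(\<Sum>i\<in>I. \<Sum>a\<in>A. \<Sum>j\<in>J. \<Sum>b\<in>B. f i a j b) = (\<Sum>a\<in>A. \<Sum>b\<in>B. \<Sum>i\<in>I. \<Sum>j\<in>J. f i a j b)"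
proof -
  have "(\<Sum>i\<in>I. \<Sum>a\<in>A. \<Sum>j\<in>J. \<Sum>b\<in>B. f i a j b) = (\<Sum>a\<in>A. \<Sum>i\<in>I. \<Sum>j\<in>J. \<Sum>b\<in>B. f i a j b)"
    by (rule sum.swap)
  also have "\<dots> = (\<Sum>a\<in>A. \<Sum>b\<in>B. \<Sum>i\<in>I. \<Sum>j\<in>J. f i a j b)"
    by (rule sum.cong[OF refl]) (rule sum_swap3)
  finally show ?thesis .
qed

lemma bipartite_form:
  fixes F :: "nat \<Rightarrow> nat \<Rightarrow> 'a::comm_monoid_add"
  shows "(\<Sum>r<d*k. \<Sum>c<d*k. F r c) = (\<Sum>a<k. \<Sum>b<k. \<Sum>i<d. \<Sum>j<d. F (i*k+a) (j*k+b))"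
  unfolding sum_prod_split by (rule sum_swap4)

text \<open>The state 1/2 sum E_ab (x) rho (x) E_ab, which is maximally entangled on the block.\<close>
definition corner_state :: "nat \<Rightarrow> nat \<Rightarrow> complex mat \<Rightarrow> (nat \<Rightarrow> nat \<Rightarrow> fmat) \<Rightarrow> complex mat" where
  "corner_state d k \<rho> w = mat (d*2) (d*2) (\<lambda>(r,c). ent (corner k \<rho> w (r mod 2) (c mod 2)) (r div 2) (c div 2) / 2)"

lemma corner_state_index:
  assumes "i < d" "j < d" "a < 2" "b < 2"
  shows "corner_state d k \<rho> w $$ (i*2+a, j*2+b) = ent (corner k \<rho> w a b) i j / 2"
  using assms enc_less[OF assms(1,3)] enc_less[OF assms(2,4)] by (simp add: corner_state_def)

lemma corner_state_density:
  assumes bc: "block_corner d k \<rho> w"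
  shows "density (d*2) (corner_state d k \<rho> w)"
proof -
  have \<rho>: "\<rho> \<in> carrier_mat k k" "ppos k (fm \<rho>)" "tr (fm \<rho>) = 1"
    using density_ppos[OF block_cornerD(1)[OF bc]] by auto
  have "psd (d*2) (corner_state d k \<rho> w)" unfolding psd_def
  proof (intro conjI allI)
    show "corner_state d k \<rho> w \<in> carrier_mat (d*2) (d*2)" by (simp add: corner_state_def)
    fix v :: "nat \<Rightarrow> complex"
    define va where "va a = colv d (\<lambda>i. v (i*2+a))" for a
    \<comment> \<open>The form of the block state at \<open>v\<close> is half the form of
      \<open>\<rho>\<close> at this vector of overlaps.\<close>
    define x where "x s = (\<Sum>b<2. ip (w b s) (va b))" for s
    let ?g = "\<lambda>a b s t. (\<rho> $$ (s,t) / 2) * (ip (va a) (w a s) * ip (w b t) (va b))"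
    let ?L = "\<Sum>r<d*2. \<Sum>c<d*2. cnj (v r) * corner_state d k \<rho> w $$ (r,c) * v c"
    let ?R = "\<Sum>s<k. \<Sum>t<k. cnj (x s) * \<rho> $$ (s,t) * x t"
    have "?L
      = (\<Sum>a<2. \<Sum>b<2. \<Sum>i<d. \<Sum>j<d. cnj (v (i*2+a)) * (ent (corner k \<rho> w a b) i j / 2) * v (j*2+b))"
      unfolding bipartite_form by (intro sum.cong refl) (simp add: corner_state_index del: sum_divide_distrib)
    also have "\<dots> = (\<Sum>a<2. \<Sum>b<2. ip (va a) (corner k \<rho> w a b * va b) / 2)"
      unfolding va_def
      by (intro sum.cong refl) (simp add: ip_colv[OF corner_M[OF bc]] sum_divide_distrib)
    also have "\<dots> = (\<Sum>a<2. \<Sum>b<2. \<Sum>s<k. \<Sum>t<k. ?g a b s t)"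
      by (intro sum.cong refl) (simp add: corner_ip[OF bc] va_def sum_divide_distrib)
    also have "\<dots> = (\<Sum>s<k. \<Sum>t<k. \<Sum>a<2. \<Sum>b<2. ?g a b s t)"
    proof -
      have "(\<Sum>a<(2::nat). \<Sum>b<(2::nat). \<Sum>s<k. \<Sum>t<k. ?g a b s t)
        = (\<Sum>s<k. \<Sum>a<(2::nat). \<Sum>b<(2::nat). \<Sum>t<k. ?g a b s t)"
        by (rule sum_swap3)
      also have "\<dots> = (\<Sum>s<k. \<Sum>t<k. \<Sum>a<(2::nat). \<Sum>b<(2::nat). ?g a b s t)"
        by (rule sum.cong[OF refl]) (rule sum_swap3)
      finally show ?thesis .
    qed
    also have "\<dots> = (\<Sum>s<k. \<Sum>t<k. cnj (x s) * \<rho> $$ (s,t) * x t / 2)"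
      by (intro sum.cong refl) (simp add: x_def ip_cnj numeral_2_eq_2 algebra_simps add_divide_distrib)
    also have "\<dots> = ?R / 2"
      by (simp add: sum_divide_distrib)
    finally have eq: "?L =
      ?R / 2" .
    have "Im ?R = 0 \<and> 0 \<le> Re ?R"
      using block_cornerD(1)[OF bc] unfolding density_def psd_def by blast
    then show "Im ?L = 0"
      "0 \<le> Re ?L"
      unfolding eq by simp_all
  qed
  moreover have "mtrace (corner_state d k \<rho> w) = 1"
  proof -
    have trc: "tr (corner k \<rho> w a a) = 1" if a: "a < 2" for a
    proof -
      have "tr (corner k \<rho> w a a) = (\<Sum>s<k. \<Sum>t<k. \<rho> $$ (s,t) * ip (w a t) (w a s))"
        unfolding corner_def tr_sum tr_sc ip_def by (intro sum.cong refl arg_cong2[where f = "(*)"] tr_comm)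
      also have "\<dots> = (\<Sum>s<k. \<Sum>t<k. if t = s then \<rho> $$ (s,t) else 0)"
        by (intro sum.cong refl) (use block_cornerD(3)[OF bc a a] in simp)
      also have "\<dots> = (\<Sum>s<k. \<rho> $$ (s,s))" by simp
      also have "\<dots> = 1" using \<rho>(3) \<rho>(1) by (simp add: tr_eq[OF fm_M[OF \<rho>(1)]] ent_fm)
      finally show ?thesis .
    qed
    have "mtrace (corner_state d k \<rho> w) = (\<Sum>r<d*2. corner_state d k \<rho> w $$ (r,r))"
      by (simp add: mtrace_def corner_state_def)
    also have "\<dots> = (\<Sum>i<d. \<Sum>a<2. ent (corner k \<rho> w a a) i i / 2)"
      unfolding sum_prod_split by (intro sum.cong refl) (simp add: corner_state_index)
    also have "\<dots> = (\<Sum>a<2. \<Sum>i<d. ent (corner k \<rho> w a a) i i / 2)" by (rule sum.swap)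
    also have "\<dots> = (\<Sum>a<2. tr (corner k \<rho> w a a) / 2)"
      by (intro sum.cong refl) (simp add: tr_eq[OF corner_M[OF bc]] sum_divide_distrib)
    also have "\<dots> = 1" by (simp add: trc numeral_2_eq_2)
    finally show ?thesis .
  qed
  ultimately show ?thesis by (simp add: density_def)
qed

lemma corner_state_not_separable:
  assumes bc: "block_corner d k \<rho> w"
  shows "\<not> separable d 2 (corner_state d k \<rho> w)"
proof
  assume sep: "separable d 2 (corner_state d k \<rho> w)"
  obtain s c where s: "s < k" "c > 0" "\<rho> $$ (s,s) = complex_of_real c"
    using density_diag[OF block_cornerD(1)[OF bc]] by blast
  \<comment> \<open>A singlet: \<open>w 0 s\<close> tensor e_1 minus \<open>w 1 s\<close> tensor
    e_0. On it the form of the partial transpose takes the value minus the diagonal entry of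
    \<open>\<rho>\<close> at \<open>s\<close>.\<close>
  define y where "y a = (if a = (0::nat) then (-1) *\<^sub>C w 1 s else w 0 s)" for a
  have yV: "y a \<in> V d" for a using block_cornerD(2)[OF bc, of 0 s] block_cornerD(2)[OF bc, of 1 s] s(1) by (simp add: y_def)
  define v where "v i a = ent (y a) i 0" for i a
  have cy: "colv d (\<lambda>i. v i a) = y a" for a unfolding v_def by (rule colv_ent[OF yV])
  have "(\<Sum>i<d. \<Sum>a<2. \<Sum>j<d. \<Sum>b<2. cnj (v i a) * corner_state d k \<rho> w $$ (i * 2 + b, j * 2 + a) * v j b)
    = (\<Sum>a<2. \<Sum>b<2. \<Sum>i<d. \<Sum>j<d. cnj (v i a) * corner_state d k \<rho> w $$ (i * 2 + b, j * 2 + a) * v j b)"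
    by (rule sum_swap4)
  also have "\<dots> = (\<Sum>a<2. \<Sum>b<2. \<Sum>i<d. \<Sum>j<d. cnj (v i a) * (ent (corner k \<rho> w b a) i j / 2) * v j b)"
    by (intro sum.cong refl) (simp add: corner_state_index)
  also have "\<dots> = (\<Sum>a<2. \<Sum>b<2. ip (y a) (corner k \<rho> w b a * y b) / 2)"
    unfolding cy[symmetric]
    by (intro sum.cong refl) (simp add: ip_colv[OF corner_M[OF bc]] sum_divide_distrib)
  also have "\<dots> = - complex_of_real c"
    using s(1,3) by (simp add: numeral_2_eq_2 y_def corner_entry[OF bc])
  finally have "0 \<le> Re (- complex_of_real c)" using separable_ppt[OF sep, of v] by simp
  then show False using s(2) by simp
qed

lemma corner_state_fixed:
  assumes P: "quantum_channel d P" and bc: "block_corner d k \<rho> w"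
    and fixed: "\<And>a b. a < 2 \<Longrightarrow> b < 2 \<Longrightarrow> P (toM d (corner k \<rho> w a b)) = toM d (corner k \<rho> w a b)"
  shows "ampl d 2 P (corner_state d k \<rho> w) = corner_state d k \<rho> w"
proof (rule eq_matI)
  fix r c assume "r < dim_row (corner_state d k \<rho> w)" "c < dim_col (corner_state d k \<rho> w)"
  then have rc: "r < d*2" "c < d*2" by (auto simp: corner_state_def)
  define C where "C = toM d (corner k \<rho> w (r mod 2) (c mod 2))"
  have Cc: "C \<in> carrier_mat d d" by (simp add: C_def)
  have ij: "r div 2 < d" "c div 2 < d" using rc by auto
  have "mat d d (\<lambda>(i,j). corner_state d k \<rho> w $$ (i*2 + r mod 2, j*2 + c mod 2)) = (1/2) \<cdot>\<^sub>m C"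
    by (rule eq_matI) (auto simp: corner_state_index C_def)
  moreover have "P ((1/2) \<cdot>\<^sub>m C) = (1/2) \<cdot>\<^sub>m C"
    using qc_lin[OF P] Cc fixed[of "r mod 2" "c mod 2"] by (simp add: lin_map_def C_def)
  ultimately show "ampl d 2 P (corner_state d k \<rho> w) $$ (r,c) = corner_state d k \<rho> w $$ (r,c)"
    using rc ij by (simp add: ampl_def) (simp add: C_def corner_state_def)
qed (auto simp: ampl_def corner_state_def)

lemma asymptotic_exists:
  assumes \<phi>: "quantum_channel d \<phi>" and s: "strict_mono s" and \<psi>: "quantum_channel d \<psi>"
    and c: "conv d (\<lambda>n. \<phi> ^^ s n) \<psi>"
  shows "\<exists>Q t. quantum_channel d Q \<and> asymptotic d \<phi> (\<lambda>A. \<psi> (Q A)) t"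
proof -
  obtain Q t where Q: "quantum_channel d Q" "strict_mono (t :: nat \<Rightarrow> nat)" "conv d (\<lambda>n. \<phi> ^^ t n) (\<lambda>A. \<psi> (Q A))"
    "\<And>A. A \<in> carrier_mat d d \<Longrightarrow> \<psi> (Q (\<psi> (Q A))) = \<psi> (Q A)"
    by (rule limit_point_inverse[OF assms]) blast
  have "asymptotic d \<phi> (\<lambda>A. \<psi> (Q A)) t"
    using \<phi> qc_comp[OF \<psi> Q(1)] Q(2-4) by (intro asymptotic.intro) auto
  then show ?thesis using Q(1) by blast
qed

lemma corner_AES:
  assumes \<phi>: "quantum_channel d \<phi>" and bc: "block_corner d k \<rho> w"
    and ph: "\<And>a b. a < 2 \<Longrightarrow> b < 2 \<Longrightarrow> toM d (corner k \<rho> w a b) \<in> phase_subspace d \<phi>"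
  shows "asympt_ent_saving d \<phi>"
  unfolding asympt_ent_saving_def
proof (intro allI impI notI)
  fix \<psi>0 assume lp: "power_limit_point d \<phi> \<psi>0" and eb: "entanglement_breaking d \<psi>0"
  then obtain s where s: "strict_mono s" and c0: "conv d (\<lambda>n. \<phi> ^^ s n) \<psi>0"
    unfolding power_limit_point_def conv_def by blast
  \<comment> \<open>A limit point is a mere function and may return matrices of the wrong size.
    Cutting it to \<open>d\<close> by \<open>d\<close> yields a channel, and \<open>ampl\<close>
    sees no difference.\<close>
  define \<psi> where "\<psi> A = mat d d (\<lambda>(i,j). \<psi>0 A $$ (i,j))" for A
  have c: "conv d (\<lambda>n. \<phi> ^^ s n) \<psi>" using c0 by (simp add: conv_def \<psi>_def)
  have \<psi>: "quantum_channel d \<psi>" by (rule conv_qc[OF qc_pow[OF \<phi>] c]) (simp add: \<psi>_def)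
  have ampl_eq: "ampl d k' \<psi> X = ampl d k' \<psi>0 X" for k' X
    unfolding ampl_def by (rule cong_mat) (auto simp: \<psi>_def less_mult_imp_div_less)
  obtain Q t where Q: "quantum_channel d Q" and as: "asymptotic d \<phi> (\<lambda>A. \<psi> (Q A)) t"
    using asymptotic_exists[OF \<phi> s \<psi> c] by blast
  interpret asymptotic d \<phi> "\<lambda>A. \<psi> (Q A)" t by (rule as)
  have fixed: "\<psi> (Q (toM d (corner k \<rho> w a b))) = toM d (corner k \<rho> w a b)" if "a < 2" "b < 2" for a b
    using ph[OF that] unfolding phase_subspace_fixed by simp
  have "ampl d 2 \<psi> (ampl d 2 Q (corner_state d k \<rho> w)) = corner_state d k \<rho> w"
    using corner_state_fixed[OF qcP bc fixed] ampl_comp[of d Q 2 \<psi>] qc_carrier[OF Q] by simp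
  moreover have "density (d*2) (ampl d 2 Q (corner_state d k \<rho> w))"
    by (rule qc_ampl_density[OF Q corner_state_density[OF bc]])
  ultimately have "separable d 2 (corner_state d k \<rho> w)"
    using eb unfolding entanglement_breaking_def ampl_eq by metis
  then show False using corner_state_not_separable[OF bc] by blast
qed

text \<open>Since every \<open>d1\<close> equals 1, a block contributes only the multiples of one
  state \<open>D i\<close>, and distinct blocks have orthogonal supports.\<close>

lemma phase_structure_abelian:
  assumes ps: "phase_structure d \<phi> U bl" and ab: "\<not> (\<exists>i<length bl. fst (bl ! i) > 1)"
  shows "\<exists>n D. (\<forall>i<(n::nat). ppos d (D i) \<and> tr (D i) = 1) \<and> (\<forall>i<n. \<forall>j<n. i \<noteq> j \<longrightarrow> D i * D j = 0) \<and>
    (\<forall>B\<in>phase_subspace d \<phi>. \<exists>c. fm B = (\<Sum>i<n. c i *\<^sub>C D i))"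
proof -
  define n where "n = length bl"
  define d1 where "d1 i = fst (bl ! i)" for i
  obtain d2 \<rho> v where H: "phase_blocks d \<phi> n d1 d2 \<rho> v"
    using phase_structure_blocks[OF ps] unfolding d1_def n_def by blast
  note H = H[unfolded phase_blocks_def]
  have d1: "d1 i = 1" if "i < n" for i
  proof -
    have "fst (bl ! i) \<ge> 1" using ps that nth_mem[of i bl] unfolding phase_structure_def n_def by fastforce
    moreover have "\<not> fst (bl ! i) > 1" using ab that unfolding n_def by blast
    ultimately show ?thesis unfolding d1_def by linarith
  qed
  have den: "density (d2 i) (\<rho> i)" if "i < n" for i using H that by blast
  have vV: "v i x \<in> V d" if "i < n" "x < d2 i" for i x
  proof -
    have "x < d1 i * d2 i" using d1 that by simp
    then show ?thesis using H that(1) by blast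
  qed
  have vo: "ip (v i x) (v j y) = (if i = j \<and> x = y then 1 else 0)" if "i < n" "j < n" "x < d2 i" "y < d2 j" for i j x y
  proof -
    have "x < d1 i * d2 i" "y < d1 j * d2 j" using d1 that by simp_all
    then show ?thesis using H that(1,2) by blast
  qed
  define D where "D i = (\<Sum>s<d2 i. \<Sum>t<d2 i. \<rho> i $$ (s,t) *\<^sub>C (v i s * star (v i t)))" for i
  have DM: "D i \<in> M d" if "i < n" for i unfolding D_def using vV[OF that] by (intro M_sum M_sc V_outer) auto
  have 1: "ppos d (D i) \<and> tr (D i) = 1" if i: "i < n" for i
  proof
    have \<rho>: "\<rho> i \<in> carrier_mat (d2 i) (d2 i)" "tr (fm (\<rho> i)) = 1" using density_ppos[OF den[OF i]] by auto
    have "\<exists>c\<ge>0. ip x (D i * x) = complex_of_real c" if x: "x \<in> V d" for x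
    proof -
      define y where "y s = ip (v i s) x" for s
      have "ip x (D i * x) = (\<Sum>s<d2 i. \<Sum>t<d2 i. cnj (y s) * \<rho> i $$ (s,t) * y t)"
        unfolding D_def sum_distrib_right ip_simps y_def
        using vV[OF i] x by (intro sum.cong refl) (simp add: outer_apply[of _ d] ip_cnj)
      moreover have "Im (\<Sum>s<d2 i. \<Sum>t<d2 i. cnj (y s) * \<rho> i $$ (s,t) * y t) = 0 \<and> 0 \<le> Re (\<Sum>s<d2 i. \<Sum>t<d2 i. cnj (y s) * \<rho> i $$ (s,t) * y t)"
        using den[OF i] unfolding density_def psd_def by blast
      ultimately show ?thesis by (intro exI[of _ "Re (ip x (D i * x))"]) (auto simp: complex_eq_iff)
    qed
    then show "ppos d (D i)" using DM[OF i] by (simp add: ppos_def)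
    have "tr (D i) = (\<Sum>s<d2 i. \<Sum>t<d2 i. \<rho> i $$ (s,t) * ip (v i t) (v i s))"
      unfolding D_def tr_sum tr_sc ip_def by (intro sum.cong refl arg_cong2[where f = "(*)"] tr_comm)
    also have "\<dots> = (\<Sum>s<d2 i. \<Sum>t<d2 i. if t = s then \<rho> i $$ (s,t) else 0)"
      by (intro sum.cong refl) (use vo[OF i i] in simp)
    also have "\<dots> = (\<Sum>s<d2 i. \<rho> i $$ (s,s))" by simp
    also have "\<dots> = 1" using \<rho>(2) \<rho>(1) by (simp add: tr_eq[OF fm_M[OF \<rho>(1)]] ent_fm)
    finally show "tr (D i) = 1" .
  qed
  have 2: "D i * D j = 0" if ij: "i < n" "j < n" "i \<noteq> j" for i j
  proof -
    have "v i s * star (v i t) * (v j s' * star (v j t')) = 0" if "s < d2 i" "t < d2 i" "s' < d2 j" for s t s' t'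
      using vV[OF ij(1)] vV[OF ij(2)] vo[OF ij(1,2)] ij(3) that by (simp add: outer_times[of _ d])
    then show ?thesis unfolding D_def by (simp add: sum_distrib_left sum_distrib_right)
  qed
  have 3: "\<exists>c. fm B = (\<Sum>i<n. c i *\<^sub>C D i)" if "B \<in> phase_subspace d \<phi>" for B
  proof -
    have "\<exists>A. fm B = (\<Sum>i<n. \<Sum>a<d1 i. \<Sum>b<d1 i. A i $$ (a,b) *\<^sub>C (\<Sum>s<d2 i. \<Sum>t<d2 i. \<rho> i $$ (s,t) *\<^sub>C
        (v i (a * d2 i + s) * star (v i (b * d2 i + t)))))" using H that by blast
    then obtain A where "fm B = (\<Sum>i<n. \<Sum>a<d1 i. \<Sum>b<d1 i. A i $$ (a,b) *\<^sub>C (\<Sum>s<d2 i. \<Sum>t<d2 i. \<rho> i $$ (s,t) *\<^sub>C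
        (v i (a * d2 i + s) * star (v i (b * d2 i + t)))))" ..
    also have "\<dots> = (\<Sum>i<n. A i $$ (0,0) *\<^sub>C D i)"
      by (intro sum.cong refl) (simp add: d1 D_def)
    finally show ?thesis by (rule exI[of _ "\<lambda>i. A i $$ (0,0)"])
  qed
  show ?thesis using 1 2 3 by (intro exI[of _ n] exI[of _ D]) blast
qed

text \<open>The output is the sum of the \<open>D i\<close> tensor \<open>T i\<close>, where
  \<open>T i\<close> collects the coefficients of \<open>D i\<close>. Positivity of the output
  passes to the \<open>T i\<close>, and dividing them by their traces \<open>p i\<close> exhibits a
  convex combination of product states.\<close>

lemma abelian_entanglement_breaking:
  assumes P: "quantum_channel d P" and D: "\<And>i. i < n \<Longrightarrow> ppos d (D i) \<and> tr (D i) = 1"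
    and DD: "\<And>i j. i < n \<Longrightarrow> j < n \<Longrightarrow> i \<noteq> j \<Longrightarrow> D i * D j = 0"
    and ex: "\<And>A. A \<in> carrier_mat d d \<Longrightarrow> \<exists>c. fm (P A) = (\<Sum>i<(n::nat). c i *\<^sub>C D i)"
  shows "entanglement_breaking d P"
  unfolding entanglement_breaking_def
proof (intro allI impI)
  fix k R assume R: "density (d*k) R"
  have DM: "D i \<in> M d" "star (D i) = D i" "D i \<noteq> 0" if "i < n" for i
    using D[OF that] ppos_star by (auto simp: ppos_def)
  have Rc: "R \<in> carrier_mat (d*k) (d*k)" "psd (d*k) R" "mtrace R = 1" using R by (auto simp: density_def psd_def)
  \<comment> \<open>A matrix of size zero cannot have trace one; \<open>k > 0\<close> makes the
    default state \<open>mu 0 0\<close> below available.\<close>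
  have k0: "k > 0"
  proof (rule ccontr)
    assume "\<not> k > 0"
    then have "dim_row R = 0" using Rc(1) by simp
    then show False using Rc(3) by (simp add: mtrace_def)
  qed
  define Z where "Z a b = mat d d (\<lambda>(i,j). R $$ (i*k + a, j*k + b))" for a b
  have Zc: "Z a b \<in> carrier_mat d d" for a b by (simp add: Z_def)
  have PZ: "P (Z a b) \<in> carrier_mat d d" for a b by (rule qc_carrier[OF P Zc])
  \<comment> \<open>The \<open>D i\<close> annihilate each other and are thus orthogonal for
    \<open>ip\<close>, so coefficients are orthogonal projections.\<close>
  define C where "C i a b = ip (D i) (fm (P (Z a b))) / complex_of_real (nsq (D i))" for i a b
  have nz: "nsq (D i) > 0" if "i < n" for i using DM(3)[OF that] by simp
  have ipD: "ip (D i) (D j) = (if j = i then complex_of_real (nsq (D i)) else 0)" if "i < n" "j < n" for i j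
    using DD[OF that] DM(2)[OF that(1)] by (cases "j = i") (simp add: ip_self, simp add: ip_def)
  have expand: "fm (P (Z a b)) = (\<Sum>i<n. C i a b *\<^sub>C D i)" for a b
  proof -
    obtain c where c: "fm (P (Z a b)) = (\<Sum>i<n. c i *\<^sub>C D i)" using ex[OF Zc] by blast
    have "C i a b = c i" if i: "i < n" for i
    proof -
      have "ip (D i) (fm (P (Z a b))) = (\<Sum>j<n. if j = i then c j * complex_of_real (nsq (D i)) else 0)"
        unfolding c ip_simps using ipD[OF i] by (intro sum.cong refl) simp
      then show ?thesis using i nz[OF i] by (simp add: C_def)
    qed
    then show ?thesis unfolding c by simp
  qed
  define T where "T i = mat k k (\<lambda>(a,b). C i a b)" for i
  have Tc: "T i \<in> carrier_mat k k" for i by (simp add: T_def)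
  have ps: "psd (d*k) (ampl d k P R)" using P Rc(2) by (simp add: quantum_channel_def completely_positive_def)
  have amp: "ampl d k P R $$ (i*k+a, j*k+b) = P (Z a b) $$ (i,j)" if "i < d" "j < d" "a < k" "b < k" for i j a b
    using that by (simp add: ampl_def Z_def enc_less)
  have Tpsd: "psd k (T i)" if i: "i < n" for i
    unfolding psd_def
  proof (intro conjI allI)
    show "T i \<in> carrier_mat k k" by (rule Tc)
    fix x :: "nat \<Rightarrow> complex"
    obtain m :: nat and u where u: "\<forall>l<m. u l \<in> V d" "D i = (\<Sum>l<m. u l * star (u l))" using ppos_decomp D[OF i] by blast
    \<comment> \<open>The test vector \<open>u l\<close> tensor \<open>x\<close>. Over the rank-one
      pieces \<open>u l\<close> of \<open>D i\<close>, the forms of the positive output add up to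
      \<open>nsq (D i)\<close> times the form of \<open>T i\<close> at \<open>x\<close>.\<close>
    define f where "f l r = ent (u l) (r div k) 0 * x (r mod k)" for l r
    let ?F = "\<lambda>l. \<Sum>r<d*k. \<Sum>c<d*k. cnj (f l r) * ampl d k P R $$ (r,c) * f l c"
    let ?I = "\<lambda>l a b. cnj (x a) * ip (u l) (fm (P (Z a b)) * u l) * x b"
    let ?T = "\<Sum>a<k. \<Sum>b<k. cnj (x a) * T i $$ (a,b) * x b"
    have ipF: "ip (D i) F = (\<Sum>l<m. ip (u l) (F * u l))" for F
    proof -
      have "ip (D i) F = tr (F * D i)" unfolding ip_def DM(2)[OF i] by (rule tr_comm)
      then show ?thesis unfolding u(2) sum_distrib_left tr_sum tr_outer .
    qed
    have form: "?F l
      = (\<Sum>a<k. \<Sum>b<k. ?I l a b)" if l: "l < m" for l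
    proof -
      have ul: "u l = colv d (\<lambda>i. ent (u l) i 0)" using colv_ent u(1) l by metis
      have "?F l
        = (\<Sum>a<k. \<Sum>b<k. \<Sum>i<d. \<Sum>j<d. cnj (x a) * (cnj (ent (u l) i 0) * ent (fm (P (Z a b))) i j * ent (u l) j 0) * x b)"
        unfolding bipartite_form
        using carrier_matD[OF PZ] by (intro sum.cong refl) (simp add: amp f_def ent_fm mult_ac)
      also have "\<dots> = (\<Sum>a<k. \<Sum>b<k. ?I l a b)"
        by (intro sum.cong refl, subst (3) ul, subst (2) ul)
          (simp only: ip_colv[OF fm_M[OF PZ]] sum_distrib_left sum_distrib_right)
      finally show ?thesis .
    qed
    have "?T
      = (\<Sum>a<k. \<Sum>b<k. \<Sum>l<m. ?I l a b / complex_of_real (nsq (D i)))"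
      by (intro sum.cong refl) (simp add: T_def C_def ipF sum_distrib_left sum_distrib_right sum_divide_distrib)
    also have "\<dots> = (\<Sum>l<m. \<Sum>a<k. \<Sum>b<k. ?I l a b / complex_of_real (nsq (D i)))"
      by (rule sum_swap3)
    also have "\<dots> = (\<Sum>l<m. ?F l / complex_of_real (nsq (D i)))"
      by (intro sum.cong refl) (simp add: form sum_divide_distrib)
    finally have eq: "?T
      = (\<Sum>l<m. ?F l / complex_of_real (nsq (D i)))" .
    have pos: "Im (?F l) = 0 \<and> 0 \<le> Re (?F l)" for l
      using ps unfolding psd_def by blast
    define G where "G l = ?F l" for l
    have G: "Im (G l) = 0" "0 \<le> Re (G l)" for l using pos by (simp_all add: G_def)
    show "Im ?T = 0"
      "0 \<le> Re ?T"
      unfolding eq G_def[symmetric] Im_sum Re_sum using G nz[OF i]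
      by (auto intro!: sum_nonneg sum.neutral divide_nonneg_pos simp: Im_divide_of_real Re_divide_of_real)
  qed
  have Tdiag: "\<exists>c\<ge>0. C i a a = complex_of_real c" if "i < n" "a < k" for i a
    using ppos_diag[of k "fm (T i)" a] Tpsd[OF that(1)] that(2) unfolding psd_iff by (simp add: ent_fm T_def)
  define p where "p i = Re (\<Sum>a<k. C i a a)" for i
  have p_eq: "(\<Sum>a<k. C i a a) = complex_of_real (p i)" if "i < n" for i
  proof -
    have "Im (C i a a) = 0" if "a < k" for a using Tdiag[OF \<open>i < n\<close> that] by auto
    then show ?thesis by (simp add: p_def complex_eq_iff)
  qed
  have Cre: "0 \<le> Re (C i a a)" if "i < n" "a < k" for i a using Tdiag[OF that] by auto
  have p0: "p i \<ge> 0" if "i < n" for i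
    unfolding p_def Re_sum using Cre[OF that] by (intro sum_nonneg) auto
  have C0: "C i a b = 0" if i: "i < n" and "p i = 0" "a < k" "b < k" for i a b
  proof -
    have re0: "Re (C i a a) = 0" if "a < k" for a
      using sum_nonneg_eq_0_iff[of "{..<k}" "\<lambda>a. Re (C i a a)"] Cre[OF i] \<open>p i = 0\<close> that by (auto simp: p_def)
    have "C i a a = 0" if "a < k" for a
      using Tdiag[OF i that] re0[OF that] by (metis Re_complex_of_real of_real_0)
    then have "ent (fm (T i)) a a = 0" if "a < k" for a
      using that by (simp add: ent_fm T_def)
    then have "fm (T i) = 0" using ppos_diag_0[of k "fm (T i)"] Tpsd[OF i] by (simp add: psd_iff)
    then have "ent (fm (T i)) a b = 0" by simp
    then show ?thesis using that by (simp add: ent_fm T_def)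
  qed
  \<comment> \<open>A block of weight zero has \<open>T i = 0\<close> by \<open>C0\<close>, so any
    state may be prepared there.\<close>
  define \<tau> where "\<tau> i = (if p i = 0 then toM k (mu 0 0) else complex_of_real (1 / p i) \<cdot>\<^sub>m T i)" for i
  have \<tau>: "density k (\<tau> i)" if i: "i < n" for i
  proof (cases "p i = 0")
    case True
    have "ppos k (mu 0 0)" using ppos_outer[of "mu 0 0" k] k0 by (simp add: mu_mult)
    moreover have "tr (mu 0 0) = 1" using k0 by (simp add: tr_eq[of _ 1])
    ultimately show ?thesis using True k0 by (simp add: \<tau>_def density_def psd_iff mtrace_fm[of _ k])
  next
    case False
    have "ppos k (complex_of_real (1 / p i) *\<^sub>C fm (T i))"
    proof -
      have "ip v (complex_of_real (1 / p i) *\<^sub>C fm (T i) * v) = complex_of_real (c / p i)"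
        if "ip v (fm (T i) * v) = complex_of_real c" for v c using that by simp
      moreover have "c / p i \<ge> 0" if "c \<ge> 0" for c using that p0[OF i] by simp
      moreover have "ppos k (fm (T i))" using Tpsd[OF i] by (simp add: psd_iff)
      ultimately show ?thesis unfolding ppos_def by (metis M_sc)
    qed
    moreover have "mtrace (T i) = complex_of_real (p i)" using p_eq[OF i] by (simp add: mtrace_def T_def)
    then have "tr (fm (T i)) = complex_of_real (p i)" using mtrace_fm[OF Tc] by simp
    ultimately show ?thesis using False Tc
      by (simp add: \<tau>_def density_def psd_iff mtrace_fm[of _ k] fm_smult)
  qed
  have pt: "complex_of_real (p i) * \<tau> i $$ (a,b) = C i a b" if "i < n" "a < k" "b < k" for i a b
    using that C0[OF that(1) _ that(2,3)] Tc[of i] by (auto simp: \<tau>_def T_def)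
  define \<sigma> where "\<sigma> i = toM d (D i)" for i
  have \<sigma>: "density d (\<sigma> i)" if "i < n" for i
    using D[OF that] DM(1)[OF that] by (simp add: \<sigma>_def density_def psd_iff mtrace_fm[of _ d])
  have sum1: "(\<Sum>i<n. p i) = 1"
  proof -
    have "complex_of_real (\<Sum>i<n. p i) = (\<Sum>i<n. \<Sum>a<k. C i a a)" by (simp add: p_eq)
    also have "\<dots> = (\<Sum>a<k. \<Sum>i<n. C i a a)" by (rule sum.swap)
    also have "\<dots> = (\<Sum>a<k. tr (fm (P (Z a a))))" unfolding expand using D by (intro sum.cong refl) simp
    also have "\<dots> = (\<Sum>a<k. mtrace (Z a a))"
      using P Zc by (simp add: mtrace_fm[OF PZ, symmetric] quantum_channel_def trace_preserving_def)
    also have "\<dots> = (\<Sum>a<k. \<Sum>i<d. R $$ (i*k+a, i*k+a))" by (simp add: mtrace_def Z_def)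
    also have "\<dots> = (\<Sum>i<d. \<Sum>a<k. R $$ (i*k+a, i*k+a))" by (rule sum.swap)
    also have "\<dots> = mtrace R" using Rc(1) by (simp add: mtrace_def sum_prod_split)
    finally show ?thesis using Rc(3) of_real_eq_1_iff by metis
  qed
  have st: "\<forall>i<n. p i \<ge> 0 \<and> density d (\<sigma> i) \<and> density k (\<tau> i)" using p0 \<sigma> \<tau> by blast
  let ?K = "mat (d*k) (d*k) (\<lambda>rc. \<Sum>i<n. complex_of_real (p i) * kron (\<sigma> i) (\<tau> i) $$ rc)"
  have "ampl d k P R = ?K"
  proof (rule eq_matI)
    fix r c assume "r < dim_row (?K)"
      "c < dim_col (?K)"
    then have rc: "r < d*k" "c < d*k" by auto
    then have ij: "r div k < d" "c div k < d" "r mod k < k" "c mod k < k" using k0 by (auto simp: less_mult_imp_div_less)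
    have \<tau>d: "dim_row (\<tau> i) = k" "dim_col (\<tau> i) = k" for i using Tc[of i] by (simp_all add: \<tau>_def)
    have "ampl d k P R $$ (r,c) = P (Z (r mod k) (c mod k)) $$ (r div k, c div k)"
      using rc by (simp add: ampl_def Z_def)
    also have "\<dots> = ent (fm (P (Z (r mod k) (c mod k)))) (r div k) (c div k)"
      using ij carrier_matD[OF PZ] by (simp add: ent_fm)
    also have "\<dots> = (\<Sum>i<n. complex_of_real (p i) * \<tau> i $$ (r mod k, c mod k) * ent (D i) (r div k) (c div k))"
      unfolding expand ent_sum ent_sc by (intro sum.cong refl) (simp add: pt ij)
    also have "\<dots> = (\<Sum>i<n. complex_of_real (p i) * kron (\<sigma> i) (\<tau> i) $$ (r,c))"
      by (intro sum.cong refl) (simp add: kron_def \<sigma>_def \<tau>d ij rc)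
    finally show "ampl d k P R $$ (r,c) = ?K $$ (r,c)"
      using rc by simp
  qed (auto simp: ampl_def)
  from st sum1 this show "separable d k (ampl d k P R)"
    unfolding separable_def by (intro exI[of _ n] exI[of _ p] exI[of _ \<sigma>] exI[of _ \<tau>] conjI)
qed

text \<open>Condition (2) implies both others and its failure refutes both, so (1) and (3) are never
  compared directly.\<close>

theorem mainTheorem17:
  fixes d :: nat and \<phi> :: "complex mat \<Rightarrow> complex mat"
  assumes "quantum_channel d \<phi>"
  shows "(asympt_ent_saving d \<phi> \<longleftrightarrow>
            (\<exists>U bl. phase_structure d \<phi> U bl \<and> (\<exists>i<length bl. fst (bl ! i) > 1)))
       \<and> ((\<exists>U bl. phase_structure d \<phi> U bl \<and> (\<exists>i<length bl. fst (bl ! i) > 1)) \<longleftrightarrow>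
            (\<exists>Z1 Z2. phase_point d \<phi> Z1 \<and> phase_point d \<phi> Z2 \<and> Z1 * Z2 \<noteq> Z2 * Z1))"
proof -
  note lin = qc_lin[OF assms]
  let ?S = "\<exists>U bl. phase_structure d \<phi> U bl \<and> (\<exists>i<length bl. fst (bl ! i) > 1)"
  let ?N = "\<exists>Z1 Z2. phase_point d \<phi> Z1 \<and> phase_point d \<phi> Z2 \<and> Z1 * Z2 \<noteq> Z2 * Z1"
  have S: "asympt_ent_saving d \<phi> \<and> ?N" if yS: ?S
  proof -
    obtain U bl i where "phase_structure d \<phi> U bl" "i < length bl" "fst (bl ! i) > 1"
      using yS by blast
    from phase_structure_corner[OF this] obtain k \<rho> w where bc: "block_corner d k \<rho> w"
      and ph': "\<forall>a<2. \<forall>b<2. toM d (corner k \<rho> w a b) \<in> phase_subspace d \<phi>"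
      by blast
    have ph: "toM d (corner k \<rho> w a b) \<in> phase_subspace d \<phi>" if "a < 2" "b < 2" for a b
      using ph' that by blast
    have "corner k \<rho> w a b \<in> phspan d \<phi>" if "a < 2" "b < 2" for a b
      by (rule fm_phspan[OF lin corner_M[OF bc that] ph[OF that]])
    from this[of 0 1] this[of 1 0] have "?N"
      unfolding noncommuting_phase_points_iff[OF lin] using corner_noncommuting[OF bc]
      by (intro bexI[of _ "corner k \<rho> w 0 1"] bexI[of _ "corner k \<rho> w 1 0"]) auto
    with corner_AES[OF assms bc ph] show ?thesis by blast
  qed
  \<comment> \<open>The negation of \<open>?S\<close> speaks about all decompositions, so it applies
    to the one constructed here.\<close>
  have nS: "\<not> asympt_ent_saving d \<phi> \<and> \<not> ?N" if nS: "\<not> ?S"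
  proof -
    \<comment> \<open>Compactness supplies a limit point to start from, which the failure of (1)
      requires.\<close>
    obtain s \<psi> where s: "strict_mono s" "quantum_channel d \<psi>" "conv d (\<lambda>n. \<phi> ^^ s n) \<psi>"
      using qc_compact[of d "\<lambda>n. \<phi> ^^ n"] qc_pow[OF assms] by blast
    obtain Q t where "quantum_channel d Q" and as: "asymptotic d \<phi> (\<lambda>A. \<psi> (Q A)) t"
      using asymptotic_exists[OF assms s] by blast
    define P where "P = (\<lambda>A. \<psi> (Q A))"
    interpret asymptotic d \<phi> P t unfolding P_def by (rule as)
    obtain U bl where ps: "phase_structure d \<phi> U bl"
      using phase_structure_exists[OF asymptotic_axioms] by blast
    have "\<not> (\<exists>i<length bl. fst (bl ! i) > 1)" using nS ps by blast
    from phase_structure_abelian[OF ps this] obtain n :: nat and D where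
      D: "\<And>i. i < n \<Longrightarrow> ppos d (D i) \<and> tr (D i) = 1" "\<And>i j. i < n \<Longrightarrow> j < n \<Longrightarrow> i \<noteq> j \<Longrightarrow> D i * D j = 0"
      and span: "\<And>B. B \<in> phase_subspace d \<phi> \<Longrightarrow> \<exists>c. fm B = (\<Sum>i<n. c i *\<^sub>C D i)"
      by blast
    have "P A \<in> phase_subspace d \<phi>" if "A \<in> carrier_mat d d" for A
      unfolding phase_subspace_fixed using idP[OF that] qc_carrier[OF qcP that] by simp
    then have "entanglement_breaking d P"
      by (intro abelian_entanglement_breaking[OF qcP D span])
    moreover have "power_limit_point d \<phi> P"
      using t cv unfolding power_limit_point_def conv_def by blast
    ultimately have 1: "\<not> asympt_ent_saving d \<phi>" unfolding asympt_ent_saving_def by blast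
    have "X * Y = Y * X" if XY: "X \<in> phspan d \<phi>" "Y \<in> phspan d \<phi>" for X Y
    proof -
      have M: "X \<in> M d" "Y \<in> M d" using phspan_fixed(1) XY by blast+
      then have "toM d X \<in> phase_subspace d \<phi>" "toM d Y \<in> phase_subspace d \<phi>"
        using XY by (simp_all add: phase_subspace_iff[OF lin])
      then obtain c c' where c: "X = (\<Sum>i<n. c i *\<^sub>C D i)" "Y = (\<Sum>i<n. c' i *\<^sub>C D i)"
        using span M fm_toM by metis
      have com: "D i * D j = D j * D i" if "i < n" "j < n" for i j
        using D(2)[OF that] D(2)[OF that(2,1)] by (cases "i = j") auto
      have "X * Y = (\<Sum>i<n. \<Sum>j<n. (c i * c' j) *\<^sub>C (D i * D j))"
        unfolding c sum_distrib_left sum_distrib_right by (subst sum.swap) (simp add: mult.commute)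
      also have "\<dots> = (\<Sum>i<n. \<Sum>j<n. (c i * c' j) *\<^sub>C (D j * D i))"
        using com by (intro sum.cong refl) auto
      also have "\<dots> = Y * X"
        unfolding c sum_distrib_left sum_distrib_right by (simp add: mult.commute)
      finally show ?thesis .
    qed
    then have "\<not> ?N" unfolding noncommuting_phase_points_iff[OF lin] by blast
    with 1 show ?thesis by blast
  qed
  show ?thesis using S nS by blast
qed

end
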